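(* Let $\mathsf{M}$ and $\mathsf{N}$ be complexity measures defined on all (possibly partial) Boolean functions, and let $f:\mathcal{D}\subseteq\{0,1\}^n\to\{0,1\}$ be a (possibly partial) Boolean function. Then: (i) (the certification transform is monotone) If $\mathsf{M}(g)\le\mathsf{N}(g)$ for every (possibly partial) Boolean function $g$, then $\mathsf{M}^{\mathsf{cert}}(f)\le\mathsf{N}^{\mathsf{cert}}(f)$. Furthermore, if $\mathsf{M}$ is stable, then the following also hold: (ii) (certification is easier than decision) $\mathsf{M}^{\mathsf{cert}}(f)\le\mathsf{M}(f)$. (iii) (the certification transform is idempotent) $\left(\mathsf{M}^{\mathsf{cert}}\right)^{\mathsf{cert}}(f)=\mathsf{M}^{\mathsf{cert}}(f)$. (iv) (Sandwich Lemma) If $\mathsf{M}^{\mathsf{cert}}(g)\le\mathsf{N}(g)\le\mathsf{M}(g)$ for all (possibly partial) Boolean functions $g$, then $\mathsf{M}^{\mathsf{cert}}(f)=\mathsf{N}^{\mathsf{cert}}(f)$. There are a few non-stable measures that also verify items (ii)–(iv) trivially because they collapse to a constant (under $\mathsf{M}\mapsto\mathsf{M}^{\mathsf{cert}}$). Among all the measures in the list given in the context, the only ones for which items (ii)–(iv) fail to hold are $\mathsf{C}_1$, $\mathsf{FC}_1$, $\mathsf{UC}_1$ and $\mathrm{ndeg}$.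
   Context: A (possibly partial) Boolean function is a map $f:\mathcal{D}\to\{0,1\}$ with $\mathcal{D}\subseteq\{0,1\}^n$ for some $n$; it is total if $\mathcal{D}=\{0,1\}^n$. A complexity measure assigns a real number to every (possibly partial) Boolean function. For $z\in\mathcal{D}$, $f^{\mathsf{cert}}_z$ is the partial function with domain $\{z\}\cup\{y\in\mathcal{D}: f(y)\ne f(z)\}$, with $f^{\mathsf{cert}}_z(z)=1$ and $f^{\mathsf{cert}}_z(y)=0$ whenever $f(y)\neq f(z)$. For a complexity measure $\mathsf{M}$, $\mathsf{M}^{\mathsf{cert}}$ is the complexity measure $\mathsf{M}^{\mathsf{cert}}(f):=\max_{z\in\mathcal{D}}\mathsf{M}(f^{\mathsf{cert}}_z)$. A complexity measure $\mathsf{M}$ is stable if for every (possibly partial) Boolean function $f:\mathcal{D}\to\{0,1\}$: (1) $\mathsf{M}(f)=\mathsf{M}(\neg f)$, where $\neg f=1-f$; and (2) for every restriction $g$ of $f$ to a domain $\mathcal{D}'\subseteq\mathcal{D}$, $\mathsf{M}(g)\le\mathsf{M}(f)$. List of measures for the last sentence (for $f:\mathcal{D}\subseteq\{0,1\}^n\to\{0,1\}$): Query measures. $\mathsf{D}(f)$: worst-case number of queries of the best deterministic query algorithm computing $f$. $\mathsf{R}(f)$: same for randomized algorithms with two-sided error at most $1/3$. $\mathsf{R}_0(f)$: minimum worst-case expected number of queries of a randomized algorithm that is correct with probability 1 on every input of $\mathcal{D}$. $\mathsf{Q}(f)$: minimum number of queries of a quantum algorithm that outputs $f(x)$ with probability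 at least $2/3$ for every $x\in\mathcal{D}$. $\mathsf{Q}_0(f)$: minimum number of queries of a quantum algorithm that on each $x\in\mathcal{D}$ outputs $\bot$ with probability at most $1/2$ and, when it outputs a Boolean value, this value is $f(x)$ with probability 1. $\mathsf{Q}_{\mathsf{E}}(f)$: minimum number of queries of a quantum algorithm that outputs $f(x)$ with probability 1 for every $x\in\mathcal{D}$. Certificates. A partial assignment is $\rho\in\{0,1,*\}^n$; $|\rho|$ is its number of non-$*$ positions; $\rho\prec\tau$ means $\rho_i=\tau_i$ whenever $\rho_i\neq *$; two partial assignments conflict if at some index both are assigned with different values. A certificate for $x\in\mathcal{D}$ is a partial assignment $c\prec x$ such that $f(z)=f(x)$ for all $z\in\mathcal{D}$ with $c\prec z$. $\mathsf{C}(f,x)$ is the minimum of $|c|$ over certificates $c$ for $x$; $\mathsf{C}_b(f)=\max_{x\in f^{-1}(b)}\mathsf{C}(f,x)$ for $b\in\{0,1\}$; $\mathsf{C}(f)=\max\{\mathsf{C}_0(f),\mathsf{C}_1(f)\}$. $\mathsf{UC}_b(f)$ is the minimum of $\max_{x\in f^{-1}(b)}|c_x|$ over families $(c_x)_{x\in\mathcal{D}}$ where each $c_x$ is a certificate for $x$ and for all $x,y$ either $c_x=c_y$ or $c_x,c_y$ conflict; $\mathsf{UC}(f)=\max\{\mathsf{UC}_0(f),\mathsf{UC}_1(f)\}$. Weight programs. In each of the following, one minimizes $\max_{x\in\mathcal{D}}\sum_{i\in[n]}w_x(i)$ over nonnegative weights $(w_x(i))_{x\in\mathcal{D},i\in[n]}$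 subject to a condition for all $x,y\in\mathcal{D}$ with $f(x)\neq f(y)$: for $\mathsf{EC}(f)$ the weights are also at most $1$ and the condition is $\sum_{i:x_i\ne y_i}w_x(i)w_y(i)\ge1$; for $\sqrt{\mathsf{CG}(f)}$ (which defines $\mathsf{CG}(f)$) the condition is the same but without the upper bound $1$ on the weights; for $\mathsf{MM}(f)$ the condition is $\sum_{i:x_i\ne y_i}\sqrt{w_x(i)w_y(i)}\ge1$; for $\mathsf{CAdv}(f)$ it is $\sum_{i:x_i\ne y_i}\min\{w_x(i),w_y(i)\}\ge1$. $\mathsf{FC}_b(f)$ is the minimum of $\max_{x\in f^{-1}(b)}\sum_i w_x(i)$ over nonnegative weights with $\sum_{i:x_i\neq y_i}w_x(i)\ge1$ for all $x,y\in\mathcal{D}$ with $f(x)\ne f(y)$; $\mathsf{FC}(f)=\max\{\mathsf{FC}_0(f),\mathsf{FC}_1(f)\}$. Partition bound. For $\varepsilon\ge0$, $\mathsf{Prt}_\varepsilon(f)$ is the minimum of $\sum_{b\in\{0,1\}}\sum_A w_{b,A}2^{|A|}$ over $w_{b,A}\ge0$, $A$ ranging over partial assignments, subject to $\sum_{A\prec x}w_{f(x),A}\ge1-\varepsilon$ for all $x\in\mathcal{D}$ and $\sum_{A\prec x}\sum_b w_{b,A}=1$ for all $x\in\{0,1\}^n$; $\mathsf{prt}_\varepsilon(f)=\log_2\mathsf{Prt}_\varepsilon(f)$ and $\mathsf{prt}=\mathsf{prt}_{1/3}$. Sabotage. For $b\in\{*,\dagger\}$ let $P_f^b$ be the set of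 $\rho\in\{0,1,b\}^n$ (with $b$ read as "unassigned") that are consistent with both some $x\in f^{-1}(0)$ and some $y\in f^{-1}(1)$; $f_{\mathsf{sab}}:P_f^*\cup P_f^\dagger\to\{0,1\}$ is $0$ on $P_f^*$ and $1$ on $P_f^\dagger$; $\mathsf{RS}(f)=\mathsf{R}_0(f_{\mathsf{sab}})$. Sensitivity measures. For $B\subseteq[n]$, $x^B$ is $x$ with the bits in $B$ flipped; $B$ is a sensitive block for $x$ if $x^B\in\mathcal{D}$ and $f(x^B)\neq f(x)$. $\mathsf{s}(f)$ is the maximum over $x\in\mathcal{D}$ of the number of sensitive blocks of size one. $\lambda(f)$ is the spectral norm of the $\mathcal{D}\times\mathcal{D}$ matrix with entry $1$ at $(x,y)$ if $f(x)\ne f(y)$ and $x,y$ are at Hamming distance $1$, and $0$ otherwise. $\mathsf{bs}(f)$ is the maximum over $x\in\mathcal{D}$ of the maximum number of pairwise disjoint sensitive blocks for $x$. $\mathsf{fbs}(f)=\max_{x\in\mathcal{D}}\mathsf{fbs}(f,x)$, where $\mathsf{fbs}(f,x)$ is the maximum of $\sum_B w(B)$ over weights $w(B)\in[0,1]$ on the sensitive blocks $B$ for $x$ with $\sum_{B\ni i}w(B)\le1$ for all $i\in[n]$. $\mathsf{cfbs}(f)=\min_g\max_{x\in\mathcal{D}}\mathsf{fbs}(g,x)$, over total functions $g$ that agree with $f$ on $\mathcal{D}$. Degree measures. $\deg(f)$ (resp. $\widetilde{\deg}(f)$) is the minimum degree of a multilinear real polynomial $P$ with $P(x)\in[0,1]$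 for all $x\in\{0,1\}^n$ and $P(x)=f(x)$ (resp. $|P(x)-f(x)|\le1/3$) for all $x\in\mathcal{D}$. $\mathrm{ndeg}(f)$ is the minimum degree of a real polynomial $P$ with $P(x)=0$ on $f^{-1}(0)$ and $P(x)\ne0$ on $f^{-1}(1)$. $\mathrm{rdeg}(f)$ is the minimum of $\max\{\deg P,\deg Q\}$ over real polynomials $P,Q$ with $P(x)/Q(x)=f(x)$ for all $x\in\mathcal{D}$. For $\epsilon\geq 0$, the block-multilinear $\epsilon$-approximate bounded-polynomial degree of $f$ (with inputs relabelled to $\{-1,1\}^n$ via $x\mapsto 2x-1$) is the minimum $d$ such that there is a real polynomial $P:\mathbb{R}^{d(n+1)}\to\mathbb{R}$ of degree $d$ whose variables are partitioned into $d$ blocks with every monomial containing exactly one variable from each block, such that, with $\widetilde{x}=(1,x_1,\dots,x_n)$, for all $x\in\mathcal{D}$ one has $0\le P(\widetilde{x},\dots,\widetilde{x})\le1$ and $|P(\widetilde{x},\dots,\widetilde{x})-f(x)|\le\epsilon$, and $|P(z)|\le1$ for all $z\in\{-1,1\}^{d(n+1)}$; the list contains this measure, including the cases $\epsilon=1/3$ and $\epsilon=0$.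
   Formalization: The block-multilinear ε-approximate degree for 0 ≤ ε < 1/2 is added to the list of failing measures, because (ii) is false for it as defined; collapse to a constant is shown for C_0 and FC_0 and is taken over non-constant functions. *)

theory Defs
  imports
    "HOL-Analysis.Analysis"
    "HOL-Probability.Probability"
    "HOL-Library.Poly_Mapping"
begin

section \<open>Partial Boolean functions, complexity measures, certification\<close>

text \<open>
  A partial Boolean function on \<open>n\<close> variables is a partial map from Boolean lists of length \<open>n\<close>,
  its domain being \<^term>\<open>dom f\<close>.  The domain is nonempty, so that maxima over it exist.
  Measures are only ever evaluated at arguments satisfying \<open>boolean_function\<close>; their values
  elsewhere are irrelevant.
\<close>

type_synonym bfun = "bool list \<rightharpoonup> bool"

type_synonym complexity_measure = "nat \<Rightarrow> bfun \<Rightarrow> real"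

definition boolean_function :: "nat \<Rightarrow> bfun \<Rightarrow> bool" where
  "boolean_function n f \<longleftrightarrow> dom f \<noteq> {} \<and> dom f \<subseteq> {x. length x = n}"

definition bneg :: "bfun \<Rightarrow> bfun" where
  "bneg f = (\<lambda>x. map_option Not (f x))"

definition cert_fun :: "bfun \<Rightarrow> bool list \<Rightarrow> bfun" where
  "cert_fun f z = (\<lambda>y. if y = z then Some True
                       else if y \<in> dom f \<and> f y \<noteq> f z then Some False else None)"

definition cert :: "complexity_measure \<Rightarrow> complexity_measure" where
  "cert M n f = Max ((\<lambda>z. M n (cert_fun f z)) ` dom f)"

definition stable_measure :: "complexity_measure \<Rightarrow> bool" where
  "stable_measure M \<longleftrightarrow> (\<forall>n f. boolean_function n f \<longrightarrow>
     M n f = M n (bneg f) \<and>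
     (\<forall>D'. D' \<noteq> {} \<and> D' \<subseteq> dom f \<longrightarrow> M n (f |` D') \<le> M n f))"

definition fiber :: "('a list \<rightharpoonup> bool) \<Rightarrow> bool \<Rightarrow> 'a list set" where
  "fiber f b = {x. f x = Some b}"

definition bvalue :: "bfun \<Rightarrow> bool list \<Rightarrow> real" where
  "bvalue f x = of_bool (f x = Some True)"

definition differing :: "nat \<Rightarrow> 'a list \<Rightarrow> 'a list \<Rightarrow> nat set" where
  "differing n x y = {i. i < n \<and> x ! i \<noteq> y ! i}"


section \<open>Classical query complexity\<close>

text \<open>
  Decision trees over an arbitrary input alphabet: the sabotage function below is not over bits.
\<close>

datatype 'a dtree = Leaf bool | Query nat "'a \<Rightarrow> 'a dtree"

primrec answer :: "'a dtree \<Rightarrow> 'a list \<Rightarrow> bool" where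
  "answer (Leaf b) x = b"
| "answer (Query i t) x = answer (t (x ! i)) x"

primrec num_queries :: "'a dtree \<Rightarrow> 'a list \<Rightarrow> nat" where
  "num_queries (Leaf b) x = 0"
| "num_queries (Query i t) x = Suc (num_queries (t (x ! i)) x)"

primrec tree_on :: "nat \<Rightarrow> 'a dtree \<Rightarrow> bool" where
  "tree_on n (Leaf b) \<longleftrightarrow> True"
| "tree_on n (Query i t) \<longleftrightarrow> i < n \<and> (\<forall>a. tree_on n (t a))"

definition D_query :: complexity_measure where
  "D_query n f = real (LEAST k. \<exists>t. tree_on n t \<and>
     (\<forall>x \<in> dom f. f x = Some (answer t x) \<and> num_queries t x \<le> k))"

text \<open>A randomized query algorithm is a probability distribution on decision trees.\<close>

definition randomized_algorithm :: "nat \<Rightarrow> 'a dtree pmf \<Rightarrow> bool" where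
  "randomized_algorithm n p \<longleftrightarrow> (\<forall>t \<in> set_pmf p. tree_on n t)"

definition R_query :: complexity_measure where
  "R_query n f = real (LEAST k. \<exists>p. randomized_algorithm n p \<and>
     (\<forall>x \<in> dom f. measure_pmf.prob p {t. f x \<noteq> Some (answer t x)} \<le> 1 / 3 \<and>
                  (\<forall>t \<in> set_pmf p. num_queries t x \<le> k)))"

definition R0_query :: "nat \<Rightarrow> ('a list \<rightharpoonup> bool) \<Rightarrow> real" where
  "R0_query n f = Inf {c. 0 \<le> c \<and> (\<exists>p. randomized_algorithm n p \<and>
     (\<forall>x \<in> dom f. measure_pmf.prob p {t. f x = Some (answer t x)} = 1 \<and>
                  (\<integral>\<^sup>+ t. of_nat (num_queries t x) \<partial>measure_pmf p) \<le> ennreal c))}"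


section \<open>Quantum query complexity\<close>

text \<open>
  The state space has basis \<open>|i, b, w\<rangle>\<close> with query register \<open>i \<le> n\<close>, answer bit \<open>b\<close> and
  workspace \<open>w < m\<close>.  The oracle maps \<open>|i, b, w\<rangle>\<close> to \<open>|i, b XOR x\<^sub>i, w\<rangle>\<close> for \<open>i < n\<close>; on the
  extra value \<open>i = n\<close> it is the identity, as in the usual null query.
  An algorithm with \<open>k\<close> queries applies \<open>U\<^sub>0\<close>, then alternates oracle calls with \<open>U\<^sub>1, \<dots>, U\<^sub>k\<close>,
  starting from a fixed basis state, and measures in the basis; \<open>out\<close> relabels the outcome,
  \<^term>\<open>None\<close> meaning that no Boolean value is output.
\<close>

type_synonym qbasis = "nat \<times> bool \<times> nat"
type_synonym qstate = "qbasis \<Rightarrow> complex"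
type_synonym qop = "qbasis \<Rightarrow> qbasis \<Rightarrow> complex"

definition basis :: "nat \<Rightarrow> nat \<Rightarrow> qbasis set" where
  "basis n m = {..n} \<times> UNIV \<times> {..<m}"

definition unitary_on :: "qbasis set \<Rightarrow> qop \<Rightarrow> bool" where
  "unitary_on B U \<longleftrightarrow> (\<forall>r \<in> B. \<forall>s \<in> B. (\<Sum>t\<in>B. cnj (U t r) * U t s) = of_bool (r = s))"

definition apply_op :: "qbasis set \<Rightarrow> qop \<Rightarrow> qstate \<Rightarrow> qstate" where
  "apply_op B U \<psi> = (\<lambda>r. \<Sum>s\<in>B. U r s * \<psi> s)"

definition oracle_call :: "nat \<Rightarrow> bool list \<Rightarrow> qstate \<Rightarrow> qstate" where
  "oracle_call n x \<psi> = (\<lambda>(i, b, w). \<psi> (i, b \<noteq> (i < n \<and> x ! i), w))"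

definition init_state :: qstate where
  "init_state = (\<lambda>r. of_bool (r = (0, False, 0)))"

definition final_state :: "nat \<Rightarrow> nat \<Rightarrow> qop \<Rightarrow> qop list \<Rightarrow> bool list \<Rightarrow> qstate" where
  "final_state n m U0 Us x =
     fold (\<lambda>U \<psi>. apply_op (basis n m) U (oracle_call n x \<psi>)) Us
       (apply_op (basis n m) U0 init_state)"

definition quantum_algorithm :: "nat \<Rightarrow> nat \<Rightarrow> nat \<Rightarrow> qop \<Rightarrow> qop list \<Rightarrow> bool" where
  "quantum_algorithm n k m U0 Us \<longleftrightarrow>
     0 < m \<and> length Us = k \<and> (\<forall>U \<in> set (U0 # Us). unitary_on (basis n m) U)"

definition output_prob ::
  "nat \<Rightarrow> nat \<Rightarrow> qop \<Rightarrow> qop list \<Rightarrow> (qbasis \<Rightarrow> bool option) \<Rightarrow> bool list \<Rightarrow> bool option \<Rightarrow> real" where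
  "output_prob n m U0 Us out x v =
     (\<Sum>r | r \<in> basis n m \<and> out r = v. (cmod (final_state n m U0 Us x r))\<^sup>2)"

definition Q_query :: complexity_measure where
  "Q_query n f = real (LEAST k. \<exists>m U0 Us out. quantum_algorithm n k m U0 Us \<and>
     (\<forall>x \<in> dom f. output_prob n m U0 Us out x (f x) \<ge> 2 / 3))"

definition Q0_query :: complexity_measure where
  "Q0_query n f = real (LEAST k. \<exists>m U0 Us out. quantum_algorithm n k m U0 Us \<and>
     (\<forall>x \<in> dom f. output_prob n m U0 Us out x None \<le> 1 / 2 \<and>
                  output_prob n m U0 Us out x (bneg f x) = 0))"

definition QE_query :: complexity_measure where
  "QE_query n f = real (LEAST k. \<exists>m U0 Us out. quantum_algorithm n k m U0 Us \<and>
     (\<forall>x \<in> dom f. output_prob n m U0 Us out x (f x) = 1))"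


section \<open>Certificates\<close>

type_synonym passign = "nat \<rightharpoonup> bool"

definition passigns :: "nat \<Rightarrow> passign set" where
  "passigns n = {\<rho>. dom \<rho> \<subseteq> {..<n}}"

definition consistent :: "passign \<Rightarrow> bool list \<Rightarrow> bool" where
  "consistent \<rho> x \<longleftrightarrow> (\<forall>i \<in> dom \<rho>. \<rho> i = Some (x ! i))"

definition conflict :: "passign \<Rightarrow> passign \<Rightarrow> bool" where
  "conflict \<rho> \<tau> \<longleftrightarrow> (\<exists>i \<in> dom \<rho> \<inter> dom \<tau>. \<rho> i \<noteq> \<tau> i)"

definition certificate :: "nat \<Rightarrow> bfun \<Rightarrow> bool list \<Rightarrow> passign \<Rightarrow> bool" where
  "certificate n f x c \<longleftrightarrow> c \<in> passigns n \<and> consistent c x \<and>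
     (\<forall>z \<in> dom f. consistent c z \<longrightarrow> f z = f x)"

definition C_at :: "nat \<Rightarrow> bfun \<Rightarrow> bool list \<Rightarrow> nat" where
  "C_at n f x = Min {card (dom c) | c. certificate n f x c}"

text \<open>The maximum over an empty preimage \<open>f\<^sup>-\<^sup>1(b)\<close> is \<open>0\<close>, here and below.\<close>

definition C_side :: "bool \<Rightarrow> complexity_measure" where
  "C_side b n f = real (Max (insert 0 (C_at n f ` fiber f b)))"

definition C_meas :: complexity_measure where
  "C_meas n f = max (C_side False n f) (C_side True n f)"

definition unambiguous_family :: "nat \<Rightarrow> bfun \<Rightarrow> (bool list \<Rightarrow> passign) \<Rightarrow> bool" where
  "unambiguous_family n f c \<longleftrightarrow> (\<forall>x \<in> dom f. certificate n f x (c x)) \<and>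
     (\<forall>x \<in> dom f. \<forall>y \<in> dom f. c x = c y \<or> conflict (c x) (c y))"

definition UC_side :: "bool \<Rightarrow> complexity_measure" where
  "UC_side b n f = real (Min {Max (insert 0 ((\<lambda>x. card (dom (c x))) ` fiber f b)) | c.
     unambiguous_family n f c})"

definition UC_meas :: complexity_measure where
  "UC_meas n f = max (UC_side False n f) (UC_side True n f)"


section \<open>Weight programs\<close>

definition weight_scheme ::
  "nat \<Rightarrow> bfun \<Rightarrow> (real \<Rightarrow> real \<Rightarrow> real) \<Rightarrow> (bool list \<Rightarrow> nat \<Rightarrow> real) \<Rightarrow> bool" where
  "weight_scheme n f \<phi> w \<longleftrightarrow> (\<forall>x \<in> dom f. \<forall>i < n. 0 \<le> w x i) \<and>
     (\<forall>x \<in> dom f. \<forall>y \<in> dom f. f x \<noteq> f y \<longrightarrow> (\<Sum>i\<in>differing n x y. \<phi> (w x i) (w y i)) \<ge> 1)"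

definition min_weight ::
  "nat \<Rightarrow> bool list set \<Rightarrow> ((bool list \<Rightarrow> nat \<Rightarrow> real) \<Rightarrow> bool) \<Rightarrow> real" where
  "min_weight n S feasible = Inf {Max (insert 0 ((\<lambda>x. \<Sum>i<n. w x i) ` S)) | w. feasible w}"

definition EC_meas :: complexity_measure where
  "EC_meas n f = min_weight n (dom f)
     (\<lambda>w. weight_scheme n f (\<lambda>a b. a * b) w \<and> (\<forall>x \<in> dom f. \<forall>i < n. w x i \<le> 1))"

definition sqrt_CG :: complexity_measure where
  "sqrt_CG n f = min_weight n (dom f) (weight_scheme n f (\<lambda>a b. a * b))"

definition CG_meas :: complexity_measure where
  "CG_meas n f = (sqrt_CG n f)\<^sup>2"

definition MM_meas :: complexity_measure where
  "MM_meas n f = min_weight n (dom f) (weight_scheme n f (\<lambda>a b. sqrt (a * b)))"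

definition CAdv_meas :: complexity_measure where
  "CAdv_meas n f = min_weight n (dom f) (weight_scheme n f min)"

definition FC_side :: "bool \<Rightarrow> complexity_measure" where
  "FC_side b n f = min_weight n (fiber f b) (weight_scheme n f (\<lambda>a b. a))"

definition FC_meas :: complexity_measure where
  "FC_meas n f = max (FC_side False n f) (FC_side True n f)"


section \<open>Partition bound\<close>

definition Prt :: "real \<Rightarrow> complexity_measure" where
  "Prt \<epsilon> n f = Inf {\<Sum>b\<in>UNIV. \<Sum>A\<in>passigns n. w b A * 2 ^ card (dom A) | w :: bool \<Rightarrow> passign \<Rightarrow> real.
     (\<forall>b. \<forall>A \<in> passigns n. 0 \<le> w b A) \<and>
     (\<forall>x \<in> dom f. (\<Sum>A | A \<in> passigns n \<and> consistent A x. w (the (f x)) A) \<ge> 1 - \<epsilon>) \<and>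
     (\<forall>x. length x = n \<longrightarrow> (\<Sum>A | A \<in> passigns n \<and> consistent A x. \<Sum>b\<in>UNIV. w b A) = 1)}"

definition prt_eps :: "real \<Rightarrow> complexity_measure" where
  "prt_eps \<epsilon> n f = log 2 (Prt \<epsilon> n f)"


section \<open>Sabotage complexity\<close>

datatype sab = Bit bool | Star | Dagger

definition sab_inputs :: "nat \<Rightarrow> bfun \<Rightarrow> sab \<Rightarrow> sab list set" where
  "sab_inputs n f s = {\<rho>. length \<rho> = n \<and> set \<rho> \<subseteq> range Bit \<union> {s} \<and>
     (\<forall>b. \<exists>x \<in> fiber f b. \<forall>i < n. \<forall>v. \<rho> ! i = Bit v \<longrightarrow> x ! i = v)}"

definition sab_fun :: "nat \<Rightarrow> bfun \<Rightarrow> sab list \<rightharpoonup> bool" where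
  "sab_fun n f = (\<lambda>\<rho>. if \<rho> \<in> sab_inputs n f Star then Some False
                       else if \<rho> \<in> sab_inputs n f Dagger then Some True else None)"

definition RS_meas :: complexity_measure where
  "RS_meas n f = R0_query n (sab_fun n f)"


section \<open>Sensitivity measures\<close>

definition flip :: "nat \<Rightarrow> bool list \<Rightarrow> nat set \<Rightarrow> bool list" where
  "flip n x B = map (\<lambda>i. x ! i \<noteq> (i \<in> B)) [0..<n]"

definition sensitive_blocks :: "nat \<Rightarrow> bfun \<Rightarrow> bool list \<Rightarrow> nat set set" where
  "sensitive_blocks n f x = {B. B \<subseteq> {..<n} \<and> flip n x B \<in> dom f \<and> f (flip n x B) \<noteq> f x}"

definition s_meas :: complexity_measure where
  "s_meas n f = real (Max ((\<lambda>x. card {B \<in> sensitive_blocks n f x. card B = 1}) ` dom f))"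

definition spectral_norm :: "'a set \<Rightarrow> ('a \<Rightarrow> 'a \<Rightarrow> real) \<Rightarrow> real" where
  "spectral_norm S A = Sup {L2_set (\<lambda>x. \<Sum>y\<in>S. A x y * v y) S | v. L2_set v S \<le> 1}"

definition lambda_meas :: complexity_measure where
  "lambda_meas n f = spectral_norm (dom f)
     (\<lambda>x y. of_bool (f x \<noteq> f y \<and> card (differing n x y) = 1))"

definition bs_meas :: complexity_measure where
  "bs_meas n f = real (Max ((\<lambda>x. Max {card F | F.
     F \<subseteq> sensitive_blocks n f x \<and> disjoint F}) ` dom f))"

definition fbs_at :: "nat \<Rightarrow> bfun \<Rightarrow> bool list \<Rightarrow> real" where
  "fbs_at n f x = Sup {\<Sum>B\<in>sensitive_blocks n f x. w B | w.
     (\<forall>B \<in> sensitive_blocks n f x. 0 \<le> w B \<and> w B \<le> 1) \<and>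
     (\<forall>i < n. (\<Sum>B | B \<in> sensitive_blocks n f x \<and> i \<in> B. w B) \<le> 1)}"

definition fbs_meas :: complexity_measure where
  "fbs_meas n f = Max (fbs_at n f ` dom f)"

definition cfbs_meas :: complexity_measure where
  "cfbs_meas n f = Min {Max (fbs_at n g ` dom f) | g. dom g = {x. length x = n} \<and> f \<subseteq>\<^sub>m g}"


section \<open>Degree measures\<close>

type_synonym 'v rpoly = "('v \<Rightarrow>\<^sub>0 nat) \<Rightarrow>\<^sub>0 real"

definition peval :: "'v rpoly \<Rightarrow> ('v \<Rightarrow> real) \<Rightarrow> real" where
  "peval P x = (\<Sum>m\<in>Poly_Mapping.keys P.
     Poly_Mapping.lookup P m * (\<Prod>i\<in>Poly_Mapping.keys m. x i ^ Poly_Mapping.lookup m i))"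

text \<open>The zero polynomial has degree \<open>0\<close>.\<close>

definition total_degree :: "'v rpoly \<Rightarrow> nat" where
  "total_degree P = Max (insert 0
     ((\<lambda>m. \<Sum>i\<in>Poly_Mapping.keys m. Poly_Mapping.lookup m i) ` Poly_Mapping.keys P))"

definition poly_in :: "'v set \<Rightarrow> 'v rpoly \<Rightarrow> bool" where
  "poly_in V P \<longleftrightarrow> (\<forall>m \<in> Poly_Mapping.keys P. Poly_Mapping.keys m \<subseteq> V)"

definition multilinear :: "'v rpoly \<Rightarrow> bool" where
  "multilinear P \<longleftrightarrow> (\<forall>m \<in> Poly_Mapping.keys P. \<forall>i. Poly_Mapping.lookup m i \<le> 1)"

definition point :: "bool list \<Rightarrow> nat \<Rightarrow> real" where
  "point x i = of_bool (x ! i)"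

definition approx_degree :: "real \<Rightarrow> complexity_measure" where
  "approx_degree \<epsilon> n f = real (LEAST d. \<exists>P. total_degree P = d \<and> poly_in {..<n} P \<and> multilinear P \<and>
     (\<forall>x. length x = n \<longrightarrow> peval P (point x) \<in> {0..1}) \<and>
     (\<forall>x \<in> dom f. \<bar>peval P (point x) - bvalue f x\<bar> \<le> \<epsilon>))"

definition deg_meas :: complexity_measure where
  "deg_meas = approx_degree 0"

definition adeg_meas :: complexity_measure where
  "adeg_meas = approx_degree (1 / 3)"

definition ndeg_meas :: complexity_measure where
  "ndeg_meas n f = real (LEAST d. \<exists>P. total_degree P = d \<and> poly_in {..<n} P \<and>
     (\<forall>x \<in> fiber f False. peval P (point x) = 0) \<and>
     (\<forall>x \<in> fiber f True. peval P (point x) \<noteq> 0))"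

definition rdeg_meas :: complexity_measure where
  "rdeg_meas n f = real (LEAST d. \<exists>P Q. max (total_degree P) (total_degree Q) = d \<and>
     poly_in {..<n} P \<and> poly_in {..<n} Q \<and>
     (\<forall>x \<in> dom f. peval Q (point x) \<noteq> 0 \<and> peval P (point x) / peval Q (point x) = bvalue f x))"

text \<open>
  The variable \<open>(k, i)\<close> with \<open>k < d\<close> and \<open>i \<le> n\<close> is the \<open>i\<close>-th variable of the \<open>k\<close>-th block;
  \<open>blocks_point x\<close> puts \<open>(1, x\<^sub>1, \<dots>, x\<^sub>n)\<close>, with entries relabelled to \<open>\<plusminus>1\<close>, in every block.
  The bound \<open>\<bar>P z\<bar> \<le> 1\<close> off the diagonal is not preserved by \<open>P \<mapsto> 1 - P\<close>, so, unlike the other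
  approximate degrees, this measure need not be invariant under \<^term>\<open>bneg\<close>.
\<close>

definition block_multilinear :: "nat \<Rightarrow> nat \<Rightarrow> (nat \<times> nat) rpoly \<Rightarrow> bool" where
  "block_multilinear d n P \<longleftrightarrow> poly_in ({..<d} \<times> {..n}) P \<and>
     (\<forall>m \<in> Poly_Mapping.keys P. \<forall>k < d. (\<Sum>i\<le>n. Poly_Mapping.lookup m (k, i)) = 1)"

definition blocks_point :: "bool list \<Rightarrow> nat \<times> nat \<Rightarrow> real" where
  "blocks_point x = (\<lambda>(k, i). if i = 0 then 1 else 2 * point x (i - 1) - 1)"

definition bm_degree :: "real \<Rightarrow> complexity_measure" where
  "bm_degree \<epsilon> n f = real (LEAST d. \<exists>P. total_degree P = d \<and> block_multilinear d n P \<and>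
     (\<forall>x \<in> dom f. 0 \<le> peval P (blocks_point x) \<and> peval P (blocks_point x) \<le> 1 \<and>
                  \<bar>peval P (blocks_point x) - bvalue f x\<bar> \<le> \<epsilon>) \<and>
     (\<forall>z. (\<forall>v \<in> {..<d} \<times> {..n}. z v \<in> {-1, 1}) \<longrightarrow> \<bar>peval P z\<bar> \<le> 1))"


section \<open>The list of measures\<close>

definition listed_measures :: "complexity_measure set" where
  "listed_measures =
     {D_query, R_query, R0_query, Q_query, Q0_query, QE_query,
      C_side False, C_side True, C_meas, UC_side False, UC_side True, UC_meas,
      EC_meas, sqrt_CG, CG_meas, MM_meas, CAdv_meas, FC_side False, FC_side True, FC_meas,
      RS_meas, s_meas, lambda_meas, bs_meas, fbs_meas, cfbs_meas,
      deg_meas, adeg_meas, ndeg_meas, rdeg_meas}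
     \<union> {Prt \<epsilon> | \<epsilon>. 0 \<le> \<epsilon>} \<union> {prt_eps \<epsilon> | \<epsilon>. 0 \<le> \<epsilon>} \<union> {bm_degree \<epsilon> | \<epsilon>. 0 \<le> \<epsilon>}"

definition certification_easier :: "complexity_measure \<Rightarrow> bool" where
  "certification_easier M \<longleftrightarrow> (\<forall>n f. boolean_function n f \<longrightarrow> cert M n f \<le> M n f)"

definition certification_idempotent :: "complexity_measure \<Rightarrow> bool" where
  "certification_idempotent M \<longleftrightarrow>
     (\<forall>n f. boolean_function n f \<longrightarrow> cert (cert M) n f = cert M n f)"

definition sandwich :: "complexity_measure \<Rightarrow> bool" where
  "sandwich M \<longleftrightarrow> (\<forall>N. (\<forall>m g. boolean_function m g \<longrightarrow> cert M m g \<le> N m g \<and> N m g \<le> M m g) \<longrightarrow>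
     (\<forall>n f. boolean_function n f \<longrightarrow> cert M n f = cert N n f))"

text \<open>
  On a constant function \<open>f\<close> the certification problems have one-point domains, so the value of
  \<^term>\<open>cert M\<close> that can collapse is the one on non-constant functions.
\<close>

definition collapses :: "complexity_measure \<Rightarrow> bool" where
  "collapses M \<longleftrightarrow> (\<exists>c. \<forall>n f. boolean_function n f \<and> fiber f False \<noteq> {} \<and> fiber f True \<noteq> {} \<longrightarrow>
     cert M n f = c)"

end

theory Submission
  imports Defs
begin

text \<open>
  On \<open>{z} \<union> {y. f y \<noteq> f z}\<close> the function \<open>cert_fun f z\<close> coincides with \<open>f\<close> or with \<open>bneg f\<close>, so
  stability gives \<open>cert M \<le> M\<close>.  Since \<open>cert_fun (cert_fun f z) z = cert_fun f z\<close>, the inequality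
  \<open>cert M \<le> M\<close> alone already implies idempotence, and idempotence implies the sandwich property.
  Hence each listed measure only has to be tested against \<open>cert M \<le> M\<close>.

  The one-sided measures at value 1 fail because certifying the all-False input of an OR is harder
  than certifying its True inputs.  For the block-multilinear degree with \<open>\<epsilon> < 1/2\<close> the obstruction is
  that \<open>\<bar>P\<bar> \<le> 1\<close> is lost under \<open>P \<mapsto> 1 - P\<close>: take \<open>f\<close> to be False at weight \<open>0\<close> and True at the weights
  \<open>p < r\<close>.  A concave quadratic in the weight, equal to \<open>\<epsilon>\<close> at \<open>0\<close> and with its apex at \<open>r\<close>, may drop to
  \<open>-1\<close>, which it only does at a weight \<open>n \<approx> (1 + \<surd>2) r\<close>, whereas for the certification problem the
  values at \<open>0\<close>, \<open>p\<close>, \<open>r\<close> force the averages over the weight levels to exceed \<open>1\<close> at \<open>n\<close>.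
\<close>

section \<open>Certification of stable measures\<close>

text \<open>The gap in block-multilinear degree arises because the range \<open>[-1, 1]\<close> is
  used from its two ends. A quadratic with top value 1 may fall by 2, while its complement starts
  from the floor 0 and may rise only by 1. At weight \<open>n\<close> the decision quadratic has
  dropped by about \<open>2 * (1 - \<epsilon>)\<close>; the complement would have risen by as much,
  which exceeds 1 exactly when \<open>\<epsilon> < 1/2\<close>. The lower bound uses diagonal points
  only, so level averages suffice. The obstacle is the upper bound: the two blocks vary
  independently, and the polarized quadratic exceeds 1 when their weights lie on opposite sides of
  the apex. A multiple of the Hamming distance between the blocks repairs this and is invisible on
  the diagonal. The ideal parameters are irrational; the integers \<open>t\<close> and
  \<open>M\<close> are the greatest ones below them, and \<open>r\<close> is taken large enough for
  the main term to absorb the rounding errors. A \<open>LEAST\<close> or an infimum says nothing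
  over an empty set, so exact decision trees, an exact quantum algorithm and interpolating
  polynomials are built before measures are compared.\<close>

lemma dom_bneg [simp]: "dom (bneg f) = dom f"
  by (auto simp: bneg_def dom_def)

lemma bneg_bneg [simp]: "bneg (bneg f) = f"
  by (auto simp: bneg_def option.map_comp comp_def option.map_ident)

lemma bneg_eq_iff [simp]: "bneg f x = bneg f y \<longleftrightarrow> f x = f y"
  by (auto simp: bneg_def map_option_case split: option.splits)

lemma bneg_eq_Some_iff [simp]: "bneg f x = Some b \<longleftrightarrow> f x = Some (\<not> b)"
  by (auto simp: bneg_def)

lemma fiber_bneg [simp]: "fiber (bneg f) b = fiber f (\<not> b)"
  by (simp add: fiber_def)

lemma fiber_subset_dom: "fiber f b \<subseteq> dom f"
  by (auto simp: fiber_def)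

lemma fiber_mono: "g \<subseteq>\<^sub>m f \<Longrightarrow> fiber g b \<subseteq> fiber f b"
  by (auto simp: fiber_def map_le_def dom_def)

lemma map_leD_eq: "g \<subseteq>\<^sub>m f \<Longrightarrow> x \<in> dom g \<Longrightarrow> g x = f x"
  by (simp add: map_le_def)

lemma boolean_function_bneg [simp]: "boolean_function n (bneg f) \<longleftrightarrow> boolean_function n f"
  by (simp add: boolean_function_def)

lemma boolean_function_restrict:
  assumes "boolean_function n f" "D \<noteq> {}" "D \<subseteq> dom f"
  shows "boolean_function n (f |` D)"
proof -
  have "dom (f |` D) = D" using assms(3) by auto
  with assms show ?thesis unfolding boolean_function_def by (metis order_trans)
qed

lemma finite_bool_lists: "finite {x :: bool list. length x = n}"
  using finite_lists_length_eq[of "UNIV :: bool set" n] by simp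

lemma boolean_function_finite: "boolean_function n f \<Longrightarrow> finite (dom f)"
  unfolding boolean_function_def by (rule finite_subset[OF conjunct2 finite_bool_lists])

lemma boolean_function_fiber_finite: "boolean_function n f \<Longrightarrow> finite (fiber f b)"
  by (rule finite_subset[OF fiber_subset_dom boolean_function_finite])

lemma boolean_function_length: "boolean_function n f \<Longrightarrow> x \<in> dom f \<Longrightarrow> length x = n"
  unfolding boolean_function_def by blast

lemma dom_cert_fun: "z \<in> dom f \<Longrightarrow> dom (cert_fun f z) = {z} \<union> {y \<in> dom f. f y \<noteq> f z}"
  by (auto simp: cert_fun_def dom_def)

lemma cert_fun_self [simp]: "cert_fun f z z = Some True"
  by (simp add: cert_fun_def)

lemma boolean_function_cert_fun:
  assumes "boolean_function n f" "z \<in> dom f"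
  shows "boolean_function n (cert_fun f z)"
  using assms dom_cert_fun[OF assms(2)] unfolding boolean_function_def by auto

lemma cert_fun_map_le:
  assumes "z \<in> dom f"
  shows "cert_fun f z \<subseteq>\<^sub>m f \<or> cert_fun f z \<subseteq>\<^sub>m bneg f"
proof -
  from assms obtain b where b: "f z = Some b" by auto
  show ?thesis
    by (cases b) (use b in \<open>auto simp: map_le_def cert_fun_def dom_def bneg_def split: if_splits\<close>)
qed

lemma cert_fun_cert_fun_self [simp]: "cert_fun (cert_fun f z) z = cert_fun f z"
  by (auto simp: cert_fun_def fun_eq_iff dom_def)

lemma cert_ge:
  assumes "boolean_function n f" "z \<in> dom f"
  shows "M n (cert_fun f z) \<le> cert M n f"
  unfolding cert_def using boolean_function_finite[OF assms(1)] assms(2) by auto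

lemma cert_le_iff:
  assumes "boolean_function n f"
  shows "cert M n f \<le> c \<longleftrightarrow> (\<forall>z \<in> dom f. M n (cert_fun f z) \<le> c)"
  unfolding cert_def using boolean_function_finite[OF assms] assms
  by (subst Max_le_iff) (auto simp: boolean_function_def)

lemma cert_mono:
  assumes "boolean_function n f"
    and "\<And>m g. boolean_function m g \<Longrightarrow> M m g \<le> N m g"
  shows "cert M n f \<le> cert N n f"
  unfolding cert_le_iff[OF assms(1)]
  using assms boolean_function_cert_fun cert_ge order_trans by meson

lemma certification_easier_iff:
  "certification_easier M \<longleftrightarrow>
     (\<forall>n f. boolean_function n f \<longrightarrow> (\<forall>z \<in> dom f. M n (cert_fun f z) \<le> M n f))"
  unfolding certification_easier_def using cert_le_iff by blast

lemma certification_easier_imp_idempotent: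
  assumes "certification_easier M"
  shows "certification_idempotent M"
  unfolding certification_idempotent_def
proof (intro allI impI antisym)
  fix n f assume f: "boolean_function n f"
  show "cert (cert M) n f \<le> cert M n f"
    using f assms by (intro cert_mono) (auto simp: certification_easier_def)
  show "cert M n f \<le> cert (cert M) n f"
    unfolding cert_le_iff[OF f]
  proof
    fix z assume z: "z \<in> dom f"
    have "M n (cert_fun f z) = M n (cert_fun (cert_fun f z) z)" by simp
    also have "\<dots> \<le> cert M n (cert_fun f z)"
      by (intro cert_ge boolean_function_cert_fun f z) (auto simp: dom_cert_fun z)
    also have "\<dots> \<le> cert (cert M) n f" by (intro cert_ge f z)
    finally show "M n (cert_fun f z) \<le> cert (cert M) n f" .
  qed
qed

lemma certification_idempotent_imp_sandwich:
  assumes "certification_idempotent M"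
  shows "sandwich M"
  unfolding sandwich_def
proof (intro allI impI antisym)
  fix N n f
  assume N: "\<forall>m g. boolean_function m g \<longrightarrow> cert M m g \<le> N m g \<and> N m g \<le> M m g"
    and f: "boolean_function n f"
  have "cert M n f = cert (cert M) n f"
    using assms f by (simp add: certification_idempotent_def)
  also have "\<dots> \<le> cert N n f" using N f by (intro cert_mono) auto
  finally show "cert M n f \<le> cert N n f" .
  show "cert N n f \<le> cert M n f" using N f by (intro cert_mono) auto
qed

text \<open>Negation is an involution, so one inequality for every function gives the equality that
  stability asks for. Phrasing restriction through \<open>map_le\<close> lets witnesses be
  transferred pointwise.\<close>

lemma stable_measureI:
  assumes neg: "\<And>n f. boolean_function n f \<Longrightarrow> M n (bneg f) \<le> M n f"
    and mono: "\<And>n f g. boolean_function n f \<Longrightarrow> boolean_function n g \<Longrightarrow> g \<subseteq>\<^sub>m f \<Longrightarrow> M n g \<le> M n f"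
  shows "stable_measure M"
  unfolding stable_measure_def
proof (intro allI impI conjI)
  fix n f assume f: "boolean_function n f"
  show "M n f = M n (bneg f)" using neg[OF f] neg[of n "bneg f"] f by simp
  fix D' assume "D' \<noteq> {} \<and> D' \<subseteq> dom f"
  then show "M n (f |` D') \<le> M n f"
    using f by (intro mono boolean_function_restrict) (auto simp: map_le_def)
qed

lemma stable_measure_bneg: "stable_measure M \<Longrightarrow> boolean_function n f \<Longrightarrow> M n (bneg f) = M n f"
  unfolding stable_measure_def by metis

lemma stable_measure_mono:
  assumes "stable_measure M" "boolean_function n f" "boolean_function n g" "g \<subseteq>\<^sub>m f"
  shows "M n g \<le> M n f"
proof -
  have "g = f |` dom g"
    using assms(4) by (fastforce simp: map_le_def restrict_map_def fun_eq_iff)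
  moreover have "dom g \<noteq> {}" "dom g \<subseteq> dom f"
    using assms(3) map_le_implies_dom_le[OF assms(4)] by (simp_all add: boolean_function_def)
  ultimately show ?thesis using assms(1,2) unfolding stable_measure_def by metis
qed

lemma stable_measure_imp_easier:
  assumes "stable_measure M"
  shows "certification_easier M"
  unfolding certification_easier_iff
proof (intro allI impI ballI)
  fix n f z assume f: "boolean_function n f" and z: "z \<in> dom f"
  show "M n (cert_fun f z) \<le> M n f"
    using cert_fun_map_le[OF z] stable_measure_mono[OF assms _ boolean_function_cert_fun[OF f z]]
      stable_measure_bneg[OF assms f] f
    by (metis boolean_function_bneg)
qed

text \<open>Negation swaps the two sides and the maximum is symmetric in them.\<close>

lemma stable_measure_max_sides:
  assumes neg: "\<And>b n f. boolean_function n f \<Longrightarrow> S b n (bneg f) = S (\<not> b) n f"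
    and mono: "\<And>b n f g. boolean_function n f \<Longrightarrow> boolean_function n g \<Longrightarrow> g \<subseteq>\<^sub>m f \<Longrightarrow> S b n g \<le> S b n f"
  shows "stable_measure (\<lambda>n f. max (S False n f) (S True n f))"
proof (rule stable_measureI)
  fix n f assume "boolean_function n f"
  then show "max (S False n (bneg f)) (S True n (bneg f)) \<le> max (S False n f) (S True n f)"
    by (simp add: neg)
next
  fix n f g assume "boolean_function n f" "boolean_function n g" "g \<subseteq>\<^sub>m f"
  then show "max (S False n g) (S True n g) \<le> max (S False n f) (S True n f)"
    using mono[of n f g] by (intro max.mono) auto
qed

text \<open>
  If a one-sided measure at \<open>b\<close> were stable, it would agree with the one at \<open>\<not> b\<close>.
\<close>

lemma not_stable_side:
  assumes neg: "\<And>n f. boolean_function n f \<Longrightarrow> S False n (bneg f) = S True n f"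
    and bad: "\<not> certification_easier (S True)"
  shows "\<not> stable_measure (S False)"
proof
  assume st: "stable_measure (S False)"
  then have "S True n f = S False n f" if "boolean_function n f" for n f
    using neg[OF that] stable_measure_bneg[OF st that] by simp
  then have "certification_easier (S True)"
    using stable_measure_imp_easier[OF st] boolean_function_cert_fun
    unfolding certification_easier_iff by simp
  with bad show False ..
qed

text \<open>The existence premise is there because \<open>LEAST\<close> over an empty predicate is
  unspecified. The slack \<open>l\<le>k\<close> admits a transformed witness whose cost is only
  bounded above, such as a difference of polynomials.\<close>

lemma Least_le_LeastI:
  fixes P Q :: "nat \<Rightarrow> bool"
  assumes "\<exists>k. P k" "\<And>k. P k \<Longrightarrow> \<exists>l\<le>k. Q l"
  shows "real (LEAST k. Q k) \<le> real (LEAST k. P k)"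
  using assms by (metis LeastI_ex Least_le of_nat_mono order_trans)

section \<open>Classical query complexity\<close>

text \<open>The accumulator holds the answers read so far: its length is the next position to query,
  and at a leaf it is the whole input.\<close>

primrec full_tree :: "('a list \<Rightarrow> bool) \<Rightarrow> nat \<Rightarrow> 'a list \<Rightarrow> 'a dtree" where
  "full_tree g 0 xs = Leaf (g xs)"
| "full_tree g (Suc k) xs = Query (length xs) (\<lambda>a. full_tree g k (xs @ [a]))"

lemma tree_on_full_tree: "tree_on (length xs + k) (full_tree g k xs)"
  by (induction k arbitrary: xs) (auto, metis add_Suc length_append_singleton)

lemma num_queries_full_tree: "num_queries (full_tree g k xs) x = k"
  by (induction k arbitrary: xs) auto

lemma answer_full_tree:
  assumes "length x = length xs + k" "take (length xs) x = xs"
  shows "answer (full_tree g k xs) x = g x"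
  using assms
proof (induction k arbitrary: xs)
  case (Suc k)
  then have "take (length (xs @ [x ! length xs])) x = xs @ [x ! length xs]"
    by (simp add: take_Suc_conv_app_nth)
  with Suc show ?case by simp
qed auto

lemma exists_exact_tree:
  fixes f :: "'a list \<rightharpoonup> bool"
  assumes "dom f \<subseteq> {x. length x = n}"
  shows "\<exists>t. tree_on n t \<and> (\<forall>x \<in> dom f. f x = Some (answer t x) \<and> num_queries t x = n)"
proof (intro exI conjI ballI)
  let ?t = "full_tree (\<lambda>x. the (f x)) n []"
  show "tree_on n ?t" using tree_on_full_tree[of "[]" n] by simp
  fix x assume "x \<in> dom f"
  with assms show "f x = Some (answer ?t x)" by (subst answer_full_tree) auto
  show "num_queries ?t x = n" by (rule num_queries_full_tree)
qed

primrec neg_tree :: "'a dtree \<Rightarrow> 'a dtree" where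
  "neg_tree (Leaf b) = Leaf (\<not> b)"
| "neg_tree (Query i t) = Query i (\<lambda>a. neg_tree (t a))"

lemma answer_neg_tree [simp]: "answer (neg_tree t) x = (\<not> answer t x)"
  by (induction t) auto

lemma num_queries_neg_tree [simp]: "num_queries (neg_tree t) x = num_queries t x"
  by (induction t) auto

lemma tree_on_neg_tree [simp]: "tree_on n (neg_tree t) = tree_on n t"
  by (induction t) auto

lemma stable_D_query: "stable_measure D_query"
proof (rule stable_measureI)
  fix n :: nat and f :: bfun assume f: "boolean_function n f"
  have ex: "\<exists>k t. tree_on n t \<and> (\<forall>x\<in>dom f. f x = Some (answer t x) \<and> num_queries t x \<le> k)"
    using exists_exact_tree[of f n] f by (metis boolean_function_def order_refl)
  show "D_query n (bneg f) \<le> D_query n f"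
    unfolding D_query_def
  proof (rule Least_le_LeastI[OF ex])
    fix k assume "\<exists>t. tree_on n t \<and> (\<forall>x\<in>dom f. f x = Some (answer t x) \<and> num_queries t x \<le> k)"
    then obtain t where t: "tree_on n t"
      "\<And>x. x \<in> dom f \<Longrightarrow> f x = Some (answer t x) \<and> num_queries t x \<le> k" by blast
    have "bneg f x = Some (answer (neg_tree t) x) \<and> num_queries (neg_tree t) x \<le> k"
      if "x \<in> dom (bneg f)" for x
      using t(2)[of x] that by simp
    moreover have "tree_on n (neg_tree t)" using t(1) by simp
    ultimately show "\<exists>l\<le>k. \<exists>t. tree_on n t \<and>
        (\<forall>x\<in>dom (bneg f). bneg f x = Some (answer t x) \<and> num_queries t x \<le> l)"
      by blast
  qed
  fix g :: bfun assume g: "g \<subseteq>\<^sub>m f"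
  show "D_query n g \<le> D_query n f"
    unfolding D_query_def
  proof (rule Least_le_LeastI[OF ex])
    fix k assume "\<exists>t. tree_on n t \<and> (\<forall>x\<in>dom f. f x = Some (answer t x) \<and> num_queries t x \<le> k)"
    then obtain t where t: "tree_on n t"
      "\<And>x. x \<in> dom f \<Longrightarrow> f x = Some (answer t x) \<and> num_queries t x \<le> k" by blast
    have "g x = Some (answer t x) \<and> num_queries t x \<le> k" if "x \<in> dom g" for x
      using t(2)[of x] map_leD_eq[OF g that] subsetD[OF map_le_implies_dom_le[OF g] that] by simp
    with t(1) show "\<exists>l\<le>k. \<exists>t. tree_on n t \<and>
        (\<forall>x\<in>dom g. g x = Some (answer t x) \<and> num_queries t x \<le> l)"
      by blast
  qed
qed

lemma exists_exact_random:
  fixes f :: "'a list \<rightharpoonup> bool"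
  assumes "dom f \<subseteq> {x. length x = n}"
  shows "\<exists>p. randomized_algorithm n p \<and>
    (\<forall>x \<in> dom f. \<forall>t \<in> set_pmf p. f x = Some (answer t x) \<and> num_queries t x = n)"
proof -
  from exists_exact_tree[OF assms] obtain t where
    "tree_on n t" "\<forall>x \<in> dom f. f x = Some (answer t x) \<and> num_queries t x = n" by blast
  then show ?thesis
    by (intro exI[of _ "return_pmf t"]) (auto simp: randomized_algorithm_def)
qed

lemma randomized_algorithm_neg:
  "randomized_algorithm n p \<Longrightarrow> randomized_algorithm n (map_pmf neg_tree p)"
  by (auto simp: randomized_algorithm_def)

lemma stable_R_query: "stable_measure R_query"
proof (rule stable_measureI)
  fix n :: nat and f :: bfun assume f: "boolean_function n f"
  let ?P = "\<lambda>f p k. randomized_algorithm n p \<and>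
     (\<forall>x \<in> dom f. measure_pmf.prob p {t. f x \<noteq> Some (answer t x)} \<le> 1 / 3 \<and>
                  (\<forall>t \<in> set_pmf p. num_queries t x \<le> k))"
  have ex: "\<exists>k p. ?P f p k"
  proof -
    have "dom f \<subseteq> {x. length x = n}" using f by (simp add: boolean_function_def)
    from exists_exact_random[OF this] obtain p where p: "randomized_algorithm n p"
      "\<And>x t. x \<in> dom f \<Longrightarrow> t \<in> set_pmf p \<Longrightarrow> f x = Some (answer t x)"
      "\<And>x t. x \<in> dom f \<Longrightarrow> t \<in> set_pmf p \<Longrightarrow> num_queries t x = n" by blast
    have "measure_pmf.prob p {t. f x \<noteq> Some (answer t x)} \<le> 1 / 3" if "x \<in> dom f" for x
    proof -
      have "measure_pmf.prob p {t. f x \<noteq> Some (answer t x)} = 0"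
        unfolding measure_pmf_zero_iff using p(2)[OF that] by blast
      then show ?thesis by simp
    qed
    with p(1,3) have "?P f p n" by simp
    then show ?thesis by blast
  qed
  show "R_query n (bneg f) \<le> R_query n f"
    unfolding R_query_def
  proof (rule Least_le_LeastI[OF ex])
    fix k assume "\<exists>p. ?P f p k"
    then obtain p where p: "?P f p k" by blast
    have "?P (bneg f) (map_pmf neg_tree p) k"
      using p randomized_algorithm_neg[of n p]
      by (auto simp: measure_map_pmf vimage_def)
    then show "\<exists>l\<le>k. \<exists>p. ?P (bneg f) p l" by blast
  qed
  fix g :: bfun assume g: "g \<subseteq>\<^sub>m f"
  show "R_query n g \<le> R_query n f"
    unfolding R_query_def
  proof (rule Least_le_LeastI[OF ex])
    fix k assume "\<exists>p. ?P f p k"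
    then obtain p where p: "?P f p k" by blast
    have "?P g p k"
      using p map_leD_eq[OF g] subsetD[OF map_le_implies_dom_le[OF g]] by simp
    then show "\<exists>l\<le>k. \<exists>p. ?P g p l" by blast
  qed
qed

text \<open>A smaller domain imposes fewer constraints, so the infimum runs over a larger set; the
  tree that reads everything makes both sets nonempty. The alphabet is arbitrary and the domain may
  be empty because sabotage complexity applies this to \<open>sab_fun\<close>, whose domain is empty
  for constant \<open>f\<close>.\<close>

lemma R0_query_mono:
  fixes f g :: "'a list \<rightharpoonup> bool"
  assumes f: "dom f \<subseteq> {x. length x = n}" and g: "g \<subseteq>\<^sub>m f"
  shows "R0_query n g \<le> R0_query n f"
  unfolding R0_query_def
proof (rule cInf_superset_mono)
  let ?P = "\<lambda>f c. 0 \<le> c \<and> (\<exists>p. randomized_algorithm n p \<and>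
     (\<forall>x \<in> dom f. measure_pmf.prob p {t. f x = Some (answer t x)} = 1 \<and>
                  (\<integral>\<^sup>+ t. of_nat (num_queries t x) \<partial>measure_pmf p) \<le> ennreal c))"
  from exists_exact_random[OF f] obtain p where p: "randomized_algorithm n p"
    "\<And>x t. x \<in> dom f \<Longrightarrow> t \<in> set_pmf p \<Longrightarrow> f x = Some (answer t x)"
    "\<And>x t. x \<in> dom f \<Longrightarrow> t \<in> set_pmf p \<Longrightarrow> num_queries t x = n" by blast
  have "measure_pmf.prob p {t. f x = Some (answer t x)} = 1" if "x \<in> dom f" for x
    using p(2)[OF that] by (simp add: measure_pmf.prob_eq_1 AE_measure_pmf_iff)
  moreover have "(\<integral>\<^sup>+ t. of_nat (num_queries t x) \<partial>measure_pmf p) \<le> ennreal (real n)"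
    if "x \<in> dom f" for x
  proof -
    have "(\<integral>\<^sup>+ t. of_nat (num_queries t x) \<partial>measure_pmf p) = (\<integral>\<^sup>+ t. of_nat n \<partial>measure_pmf p)"
      using p(3)[OF that] by (intro nn_integral_cong_AE) (simp add: AE_measure_pmf_iff)
    then show ?thesis by (simp add: ennreal_of_nat_eq_real_of_nat)
  qed
  ultimately have "?P f (real n)" using p(1) by (simp add: exI[of _ p])
  then show "{c. ?P f c} \<noteq> {}" by blast
  show "bdd_below {c. ?P g c}" by (intro bdd_belowI[of _ 0]) auto
  have "?P g c" if "?P f c" for c
    using that map_leD_eq[OF g] subsetD[OF map_le_implies_dom_le[OF g]] by fastforce
  then show "{c. ?P f c} \<subseteq> {c. ?P g c}" by blast
qed

lemma stable_R0_query: "stable_measure R0_query"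
proof (rule stable_measureI)
  fix n :: nat and f :: bfun assume f: "boolean_function n f"
  show "R0_query n g \<le> R0_query n f" if "g \<subseteq>\<^sub>m f" for g
    using f that by (intro R0_query_mono) (auto simp: boolean_function_def)
  let ?P = "\<lambda>f c p. randomized_algorithm n p \<and>
     (\<forall>x \<in> dom f. measure_pmf.prob p {t. f x = Some (answer t x)} = 1 \<and>
                  (\<integral>\<^sup>+ t. of_nat (num_queries t x) \<partial>measure_pmf p) \<le> ennreal c)"
  have *: "\<exists>p. ?P (bneg h) c p" if "\<exists>p. ?P h c p" for h :: bfun and c
  proof -
    from that obtain p where "?P h c p" by blast
    then have "?P (bneg h) c (map_pmf neg_tree p)"
      using randomized_algorithm_neg[of n p] by (auto simp: measure_map_pmf vimage_def)
    then show ?thesis by blast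
  qed
  have "(\<exists>p. ?P (bneg f) c p) \<longleftrightarrow> (\<exists>p. ?P f c p)" for c
    using *[of f c] *[of "bneg f" c] unfolding bneg_bneg by blast
  then show "R0_query n (bneg f) \<le> R0_query n f"
    unfolding R0_query_def by simp
qed

section \<open>Sabotage complexity\<close>

lemma sab_inputs_bneg: "sab_inputs n (bneg f) s = sab_inputs n f s"
proof -
  have "(\<forall>b. P (\<not> b)) \<longleftrightarrow> (\<forall>b. P b)" for P :: "bool \<Rightarrow> bool"
    by (auto simp: all_bool_eq)
  note this[of "\<lambda>b. \<exists>x\<in>fiber f b. Q x" for Q]
  then show ?thesis unfolding sab_inputs_def fiber_bneg by (simp only:)
qed

lemma sab_inputs_mono: "g \<subseteq>\<^sub>m f \<Longrightarrow> sab_inputs n g s \<subseteq> sab_inputs n f s"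
  unfolding sab_inputs_def using fiber_mono[of g f] by fast

text \<open>An input in both sets contains neither \<open>Star\<close> nor \<open>Dagger\<close>, so
  it consists of bits and determines one Boolean input, which would have both values. Since
  \<open>sab_fun\<close> tests \<open>Star\<close> first, this is what preserves its values when
  \<open>f\<close> is extended.\<close>

lemma sab_inputs_disjoint:
  assumes "boolean_function n f"
  shows "sab_inputs n f Star \<inter> sab_inputs n f Dagger = {}"
proof -
  have False if \<rho>: "\<rho> \<in> sab_inputs n f Star" "\<rho> \<in> sab_inputs n f Dagger" for \<rho>
  proof -
    have "set \<rho> \<subseteq> range Bit" "length \<rho> = n" using \<rho> by (auto simp: sab_inputs_def)
    then have bit: "\<exists>v. \<rho> ! i = Bit v" if "i < n" for i
      using that nth_mem[of i \<rho>] by blast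
    have ex: "\<forall>b. \<exists>x \<in> fiber f b. \<forall>i<n. \<forall>v. \<rho> ! i = Bit v \<longrightarrow> x ! i = v"
      using \<rho>(1) unfolding sab_inputs_def by blast
    from ex[rule_format, of True] obtain x
      where x: "x \<in> fiber f True" "\<forall>i<n. \<forall>v. \<rho> ! i = Bit v \<longrightarrow> x ! i = v" by blast
    from ex[rule_format, of False] obtain y
      where y: "y \<in> fiber f False" "\<forall>i<n. \<forall>v. \<rho> ! i = Bit v \<longrightarrow> y ! i = v" by blast
    have "x ! i = y ! i" if "i < n" for i using x y bit[OF that] that by blast
    moreover have "length x = n" "length y = n"
      using x(1) y(1) boolean_function_length[OF assms] fiber_subset_dom by blast+
    ultimately have "x = y" by (simp add: nth_equalityI)
    with x(1) y(1) show False by (simp add: fiber_def)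
  qed
  then show ?thesis by blast
qed

lemma stable_RS_meas: "stable_measure RS_meas"
proof (rule stable_measureI)
  fix n :: nat and f :: bfun assume f: "boolean_function n f"
  show "RS_meas n (bneg f) \<le> RS_meas n f"
    unfolding RS_meas_def sab_fun_def sab_inputs_bneg ..
  fix g :: bfun assume g: "g \<subseteq>\<^sub>m f"
  have "sab_fun n g \<subseteq>\<^sub>m sab_fun n f"
    using sab_inputs_mono[OF g, of n Star] sab_inputs_mono[OF g, of n Dagger]
      sab_inputs_disjoint[OF f]
    by (auto simp: map_le_def sab_fun_def dom_def split: if_splits)
  moreover have "dom (sab_fun n f) \<subseteq> {x. length x = n}"
    by (auto simp: sab_fun_def sab_inputs_def dom_def split: if_splits)
  ultimately show "RS_meas n g \<le> RS_meas n f"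
    unfolding RS_meas_def by (intro R0_query_mono)
qed

section \<open>Certification problems: their fibers and separating positions\<close>

lemma fiber_cert_fun_True: "fiber (cert_fun f z) True = {z}"
  by (auto simp: fiber_def cert_fun_def split: if_splits)

lemma fiber_cert_fun_False: "z \<in> dom f \<Longrightarrow> fiber (cert_fun f z) False = {y \<in> dom f. f y \<noteq> f z}"
  by (auto simp: fiber_def cert_fun_def split: if_splits)

lemma cert_const:
  assumes "boolean_function n f" "\<And>z. z \<in> dom f \<Longrightarrow> M n (cert_fun f z) = c"
  shows "cert M n f = c"
proof -
  have "(\<lambda>z. M n (cert_fun f z)) ` dom f = (\<lambda>z. c) ` dom f"
    by (intro image_cong refl assms(2))
  also have "\<dots> = {c}" using assms(1) unfolding boolean_function_def by (metis image_constant_conv)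
  finally show ?thesis by (simp add: cert_def)
qed

lemma finite_differing [simp]: "finite (differing n x y)"
  by (simp add: differing_def)

lemma differing_nonempty:
  assumes "boolean_function n f" "x \<in> dom f" "y \<in> dom f" "x \<noteq> y"
  shows "differing n x y \<noteq> {}"
proof -
  have "length x = n" "length y = n"
    using assms boolean_function_length by blast+
  with assms(4) show ?thesis
    by (auto simp: differing_def list_eq_iff_nth_eq)
qed

lemma other_value:
  assumes "fiber f False \<noteq> {}" "fiber f True \<noteq> {}" "z \<in> dom f"
  shows "\<exists>y. y \<in> dom f \<and> f y \<noteq> f z"
proof -
  from assms(3) obtain b where b: "f z = Some b" by blast
  from assms(1,2) have "fiber f (\<not> b) \<noteq> {}" by (cases b) auto
  then obtain y where "f y = Some (\<not> b)" by (auto simp: fiber_def)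
  with b show ?thesis by (intro exI[of _ y]) auto
qed

lemma exists_fiber_pair:
  assumes "y \<in> dom f" "z \<in> dom f" "f y \<noteq> f z"
  obtains x x' where "x \<in> fiber f b" "x' \<in> dom f" "f x' \<noteq> f x"
proof -
  have "f y = Some b \<or> f z = Some b" using assms by auto
  then show thesis
  proof
    assume "f y = Some b"
    then show thesis using that[of y z] assms by (simp add: fiber_def)
  next
    assume "f z = Some b"
    then show thesis using that[of z y] assms by (simp add: fiber_def)
  qed
qed

section \<open>Certificates\<close>

definition full_assign :: "bool list \<Rightarrow> passign" where
  "full_assign x = (\<lambda>i. if i < length x then Some (x ! i) else None)"

lemma dom_full_assign [simp]: "dom (full_assign x) = {..<length x}"
  by (auto simp: full_assign_def split: if_splits)

lemma consistent_full_assign_iff: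
  "length z = length x \<Longrightarrow> consistent (full_assign x) z \<longleftrightarrow> z = x"
  by (auto simp: consistent_def list_eq_iff_nth_eq, auto simp: full_assign_def)

lemma full_assign_passigns: "length x = n \<Longrightarrow> full_assign x \<in> passigns n"
  by (simp add: passigns_def)

lemma finite_maps_bool:
  assumes "finite A"
  shows "finite {m :: 'a \<rightharpoonup> bool. dom m = A}"
  using finite_set_of_finite_maps[OF assms, of "UNIV :: bool set"] by simp

lemma finite_passigns [simp]: "finite (passigns n)"
proof -
  have "passigns n = (\<Union>A \<in> Pow {..<n}. {m. dom m = A})"
    by (auto simp: passigns_def)
  then show ?thesis by (simp add: finite_maps_bool finite_subset)
qed

lemma card_dom_passign:
  assumes "c \<in> passigns n"
  shows "card (dom c) \<le> n"
  using card_mono[of "{..<n}" "dom c"] assms by (simp add: passigns_def)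

lemma finite_dom_passign: "c \<in> passigns n \<Longrightarrow> finite (dom c)"
  using finite_subset by (auto simp: passigns_def)

lemma certificate_full_assign:
  assumes "boolean_function n f" "x \<in> dom f"
  shows "certificate n f x (full_assign x)"
  unfolding certificate_def
proof (intro conjI ballI impI)
  show "full_assign x \<in> passigns n"
    by (rule full_assign_passigns[OF boolean_function_length[OF assms]])
  show "consistent (full_assign x) x" by (simp add: consistent_full_assign_iff)
  fix z assume "z \<in> dom f" "consistent (full_assign x) z"
  then have "z = x"
    using consistent_full_assign_iff[of z x] boolean_function_length[OF assms(1)] assms(2) by simp
  then show "f z = f x" by simp
qed

lemma certificate_bneg [simp]: "certificate n (bneg f) x c \<longleftrightarrow> certificate n f x c"
  by (simp add: certificate_def)

lemma certificate_mono:
  assumes "certificate n f x c" "g \<subseteq>\<^sub>m f" "x \<in> dom g"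
  shows "certificate n g x c"
proof -
  have "g z = g x" if "z \<in> dom g" "consistent c z" for z
    using assms that map_leD_eq[OF assms(2)] subsetD[OF map_le_implies_dom_le[OF assms(2)]]
    unfolding certificate_def by metis
  with assms(1) show ?thesis by (simp add: certificate_def)
qed

lemma certificate_card_pos:
  assumes "certificate n f x c" "y \<in> dom f" "f x \<noteq> f y"
  shows "card (dom c) \<ge> 1"
proof -
  have "\<not> consistent c y" using assms unfolding certificate_def by metis
  then have "dom c \<noteq> {}" by (auto simp: consistent_def)
  moreover have "finite (dom c)" using assms(1) finite_dom_passign by (auto simp: certificate_def)
  ultimately show ?thesis by (simp add: Suc_le_eq card_gt_0_iff)
qed

lemma finite_certificate_sizes: "finite {card (dom c) | c. certificate n f x c}"
proof -
  have "{card (dom c) | c. certificate n f x c} \<subseteq> (\<lambda>c. card (dom c)) ` passigns n"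
    by (auto simp: certificate_def)
  then show ?thesis by (rule finite_subset) simp
qed

lemma C_at_le: "certificate n f x c \<Longrightarrow> C_at n f x \<le> card (dom c)"
  unfolding C_at_def by (rule Min_le[OF finite_certificate_sizes]) blast

lemma C_at_attained:
  assumes "boolean_function n f" "x \<in> dom f"
  obtains c where "certificate n f x c" "card (dom c) = C_at n f x"
proof -
  have "{card (dom c) | c. certificate n f x c} \<noteq> {}"
    using certificate_full_assign[OF assms] by blast
  from Min_in[OF finite_certificate_sizes this] show thesis
    using that unfolding C_at_def by force
qed

lemma C_at_bneg [simp]: "C_at n (bneg f) x = C_at n f x"
  by (simp add: C_at_def)

lemma C_at_mono:
  assumes "boolean_function n f" "g \<subseteq>\<^sub>m f" "x \<in> dom g"
  shows "C_at n g x \<le> C_at n f x"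
proof -
  have "x \<in> dom f" using assms map_le_implies_dom_le by blast
  from C_at_attained[OF assms(1) this] show ?thesis
    using C_at_le certificate_mono[OF _ assms(2,3)] by metis
qed

lemma C_side_bneg [simp]: "C_side b n (bneg f) = C_side (\<not> b) n f"
  by (simp add: C_side_def)

lemma C_side_le_iff:
  assumes "boolean_function n f"
  shows "C_side b n f \<le> real k \<longleftrightarrow> (\<forall>x \<in> fiber f b. C_at n f x \<le> k)"
  unfolding C_side_def using boolean_function_fiber_finite[OF assms, of b] by simp

lemma C_side_ge:
  assumes "boolean_function n f" "x \<in> fiber f b"
  shows "real (C_at n f x) \<le> C_side b n f"
  unfolding C_side_def using boolean_function_fiber_finite[OF assms(1), of b] assms(2)
  by (simp add: Max_ge)

lemma C_side_nonneg: "0 \<le> C_side b n f"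
  by (simp add: C_side_def)

lemma C_side_mono:
  assumes f: "boolean_function n f" and g: "boolean_function n g" "g \<subseteq>\<^sub>m f"
  shows "C_side b n g \<le> C_side b n f"
proof -
  have "real (C_at n g x) \<le> C_side b n f" if x: "x \<in> fiber g b" for x
  proof -
    have "x \<in> dom g" using x fiber_subset_dom by blast
    then have "C_at n g x \<le> C_at n f x" by (rule C_at_mono[OF f g(2)])
    also have "real (C_at n f x) \<le> C_side b n f"
      using x fiber_mono[OF g(2)] by (intro C_side_ge[OF f]) auto
    finally show ?thesis by simp
  qed
  moreover obtain k where k: "C_side b n f = real k" by (simp add: C_side_def)
  ultimately show ?thesis unfolding k C_side_le_iff[OF g(1)] by simp
qed

lemma stable_C_meas: "stable_measure C_meas"
  unfolding C_meas_def[abs_def]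
  by (rule stable_measure_max_sides) (auto intro: C_side_mono)

lemma C_side_pos:
  assumes f: "boolean_function n f" and x: "x \<in> fiber f b" "y \<in> dom f" "f y \<noteq> f x"
  shows "1 \<le> C_side b n f"
proof -
  have "x \<in> dom f" using x(1) fiber_subset_dom by blast
  from C_at_attained[OF f this] obtain c where c: "certificate n f x c" "card (dom c) = C_at n f x"
    by blast
  have "1 \<le> C_at n f x" using certificate_card_pos[OF c(1) x(2)] x(3) c(2) by simp
  then show ?thesis using C_side_ge[OF f x(1)] by simp
qed

text \<open>The only True input of \<open>cert_fun f z\<close> is \<open>z\<close>, so a single
  position where a False input differs from \<open>z\<close> already certifies it. This is the
  constant to which the measure collapses.\<close>

lemma C_side_False_cert_fun:
  assumes f: "boolean_function n f" and z: "z \<in> dom f" and y: "y \<in> dom f" "f y \<noteq> f z"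
  shows "C_side False n (cert_fun f z) = 1"
proof (rule antisym)
  let ?g = "cert_fun f z"
  have g: "boolean_function n ?g" by (rule boolean_function_cert_fun[OF f z])
  have dg: "dom ?g = {z} \<union> {y \<in> dom f. f y \<noteq> f z}" by (rule dom_cert_fun[OF z])
  have "C_at n ?g x \<le> 1" if x: "x \<in> fiber ?g False" for x
  proof -
    have x': "x \<in> dom f" "f x \<noteq> f z" using x fiber_cert_fun_False[OF z] by auto
    obtain i where i: "i < n" "x ! i \<noteq> z ! i"
      using differing_nonempty[OF f x'(1) z] x'(2) by (auto simp: differing_def)
    have "certificate n ?g x [i \<mapsto> x ! i]"
      unfolding certificate_def
    proof (intro conjI ballI impI)
      show "[i \<mapsto> x ! i] \<in> passigns n" using i by (simp add: passigns_def)
      show "consistent [i \<mapsto> x ! i] x" by (simp add: consistent_def)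
      fix u assume u: "u \<in> dom ?g" "consistent [i \<mapsto> x ! i] u"
      then have "u \<noteq> z" using i by (auto simp: consistent_def)
      then have "?g u = Some False" using u(1) by (auto simp: cert_fun_def split: if_splits)
      then show "?g u = ?g x" using x by (simp add: fiber_def)
    qed
    from C_at_le[OF this] show ?thesis by simp
  qed
  then show "C_side False n ?g \<le> 1"
    using C_side_le_iff[OF g, of False 1] by simp
  have "y \<in> fiber ?g False" using y fiber_cert_fun_False[OF z] by blast
  moreover from this have "?g y = Some False" by (simp add: fiber_def)
  ultimately show "1 \<le> C_side False n ?g" by (intro C_side_pos[OF g, of y _ z]) (auto simp: dg)
qed

lemma certification_easier_C_side_False: "certification_easier (C_side False)"
  unfolding certification_easier_iff
proof (intro allI impI ballI)
  fix n f z assume f: "boolean_function n f" and z: "z \<in> dom f"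
  show "C_side False n (cert_fun f z) \<le> C_side False n f"
  proof (cases "\<exists>y. y \<in> dom f \<and> f y \<noteq> f z")
    case True
    then obtain y where y: "y \<in> dom f" "f y \<noteq> f z" by blast
    obtain x x' where "x \<in> fiber f False" "x' \<in> dom f" "f x' \<noteq> f x"
      using exists_fiber_pair[OF y(1) z y(2)] .
    then have "1 \<le> C_side False n f" by (rule C_side_pos[OF f])
    then show ?thesis using C_side_False_cert_fun[OF f z y] by simp
  next
    \<comment> \<open>Here \<open>f\<close> is constant, and the maximum over the empty fiber is 0
      by convention.\<close>
    case False
    then have "fiber (cert_fun f z) False = {}" using fiber_cert_fun_False[OF z] by blast
    then show ?thesis using C_side_nonneg[of False n f] by (simp add: C_side_def)
  qed
qed

lemma collapses_C_side_False: "collapses (C_side False)"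
  unfolding collapses_def
  by (rule exI[of _ 1]) (metis cert_const other_value C_side_False_cert_fun)

lemma finite_unambiguous_sizes:
  assumes "boolean_function n f"
  shows "finite {Max (insert 0 ((\<lambda>x. card (dom (c x))) ` fiber f b)) | c. unambiguous_family n f c}"
proof (rule finite_subset[of _ "{..n}"])
  have "Max (insert 0 ((\<lambda>x. card (dom (c x))) ` fiber f b)) \<le> n" if "unambiguous_family n f c" for c
  proof -
    have "card (dom (c x)) \<le> n" if "x \<in> fiber f b" for x
      using \<open>unambiguous_family n f c\<close> that fiber_subset_dom[of f b] card_dom_passign
      unfolding unambiguous_family_def certificate_def by blast
    then show ?thesis using boolean_function_fiber_finite[OF assms, of b] by simp
  qed
  then show "{Max (insert 0 ((\<lambda>x. card (dom (c x))) ` fiber f b)) | c. unambiguous_family n f c} \<subseteq> {..n}"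
    by blast
qed simp

lemma unambiguous_family_full_assign:
  assumes "boolean_function n f"
  shows "unambiguous_family n f full_assign"
  unfolding unambiguous_family_def
proof (intro conjI ballI)
  fix x assume x: "x \<in> dom f"
  then show "certificate n f x (full_assign x)" by (rule certificate_full_assign[OF assms])
  fix y assume y: "y \<in> dom f"
  show "full_assign x = full_assign y \<or> conflict (full_assign x) (full_assign y)"
  proof (cases "x = y")
    case False
    then obtain i where "i < n" "x ! i \<noteq> y ! i"
      using differing_nonempty[OF assms x y] by (auto simp: differing_def)
    then have "conflict (full_assign x) (full_assign y)"
      using boolean_function_length[OF assms] x y unfolding conflict_def
      by (intro bexI[of _ i]) (auto simp: full_assign_def)
    then show ?thesis ..
  qed simp
qed

lemma UC_side_le_iff:
  assumes "boolean_function n f"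
  shows "UC_side b n f \<le> real k \<longleftrightarrow>
    (\<exists>c. unambiguous_family n f c \<and> (\<forall>x \<in> fiber f b. card (dom (c x)) \<le> k))"
proof -
  have "UC_side b n f \<le> real k \<longleftrightarrow>
    (\<exists>c. unambiguous_family n f c \<and> Max (insert 0 ((\<lambda>x. card (dom (c x))) ` fiber f b)) \<le> k)"
    unfolding UC_side_def of_nat_le_iff using unambiguous_family_full_assign[OF assms]
    by (subst Min_le_iff[OF finite_unambiguous_sizes[OF assms]]) blast+
  then show ?thesis using boolean_function_fiber_finite[OF assms, of b] by simp
qed

lemma UC_side_attained:
  assumes "boolean_function n f"
  obtains c k where "unambiguous_family n f c" "\<And>x. x \<in> fiber f b \<Longrightarrow> card (dom (c x)) \<le> k"
    "UC_side b n f = real k"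
proof -
  obtain k where k: "UC_side b n f = real k" by (simp add: UC_side_def)
  then have "UC_side b n f \<le> real k" by simp
  then show thesis using UC_side_le_iff[OF assms] that k by blast
qed

lemma UC_side_bneg [simp]: "UC_side b n (bneg f) = UC_side (\<not> b) n f"
  by (simp add: UC_side_def unambiguous_family_def)

lemma UC_side_mono:
  assumes f: "boolean_function n f" and g: "boolean_function n g" "g \<subseteq>\<^sub>m f"
  shows "UC_side b n g \<le> UC_side b n f"
proof -
  obtain c k where c: "unambiguous_family n f c" "\<And>x. x \<in> fiber f b \<Longrightarrow> card (dom (c x)) \<le> k"
    and k: "UC_side b n f = real k" by (rule UC_side_attained[OF f, of b]) blast
  have sub: "dom g \<subseteq> dom f" by (rule map_le_implies_dom_le[OF g(2)])
  have "unambiguous_family n g c"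
    unfolding unambiguous_family_def
  proof (intro conjI ballI)
    fix x assume x: "x \<in> dom g"
    with c(1) sub have "certificate n f x (c x)" by (auto simp: unambiguous_family_def)
    then show "certificate n g x (c x)" by (rule certificate_mono[OF _ g(2) x])
    fix y assume "y \<in> dom g"
    with x sub have "x \<in> dom f" "y \<in> dom f" by auto
    with c(1) show "c x = c y \<or> conflict (c x) (c y)" unfolding unambiguous_family_def by blast
  qed
  moreover have "\<forall>x \<in> fiber g b. card (dom (c x)) \<le> k" using c(2) fiber_mono[OF g(2)] by blast
  ultimately show ?thesis unfolding k UC_side_le_iff[OF g(1)] by blast
qed

lemma stable_UC_meas: "stable_measure UC_meas"
  unfolding UC_meas_def[abs_def]
  by (rule stable_measure_max_sides) (auto intro: UC_side_mono)

text \<open>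
  When \<open>f z = Some False\<close>, scan the positions of an unambiguous certificate of \<open>z\<close> in increasing
  order and stop at the first disagreement with \<open>z\<close>: the prefixes read in this way are pairwise
  equal or conflicting, and no longer than the certificate of \<open>z\<close>.
\<close>

lemma UC_side_False_cert_fun:
  assumes f: "boolean_function n f" and z: "f z = Some False"
  shows "UC_side False n (cert_fun f z) \<le> UC_side False n f"
proof -
  let ?g = "cert_fun f z"
  have zd: "z \<in> dom f" using z by blast
  have g: "boolean_function n ?g" by (rule boolean_function_cert_fun[OF f zd])
  have dg: "dom ?g = {z} \<union> {y \<in> dom f. f y \<noteq> f z}" by (rule dom_cert_fun[OF zd])
  obtain c k where c: "unambiguous_family n f c" "\<And>x. x \<in> fiber f False \<Longrightarrow> card (dom (c x)) \<le> k"
    and k: "UC_side False n f = real k" by (rule UC_side_attained[OF f, of False]) blast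
  define S where "S = dom (c z)"
  have cz: "certificate n f z (c z)" using c(1) zd by (simp add: unambiguous_family_def)
  have S: "finite S" "S \<subseteq> {..<n}"
    using cz finite_dom_passign by (auto simp: S_def certificate_def passigns_def)
  have card_S: "card S \<le> k" using c(2)[of z] z by (simp add: S_def fiber_def)
  define P where "P y i \<longleftrightarrow> i \<in> S \<and> y ! i \<noteq> z ! i" for y :: "bool list" and i
  define m where "m y = (LEAST i. P y i)" for y
  \<comment> \<open>Only the False side is measured, so the True input \<open>z\<close> may take its
    full assignment. It contains all of \<open>S\<close> and therefore conflicts with every other
    certificate at the stopping position.\<close>
  define c' where "c' y = (if y = z then full_assign z
     else (\<lambda>i. if i \<in> S \<and> i \<le> m y then Some (y ! i) else None))" for y
  have mP: "P y (m y)" if "y \<in> dom ?g" "y \<noteq> z" for y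
  proof -
    have "y \<in> dom f" "f y \<noteq> f z" using that dg by auto
    then have "\<not> consistent (c z) y" using cz by (auto simp: certificate_def)
    then obtain i where "i \<in> S" "c z i \<noteq> Some (y ! i)" by (auto simp: consistent_def S_def)
    moreover have "c z i = Some (z ! i)"
      using cz \<open>i \<in> S\<close> by (auto simp: certificate_def consistent_def S_def)
    ultimately have "P y i" by (auto simp: P_def)
    then show ?thesis unfolding m_def by (rule LeastI)
  qed
  have below: "y ! i = z ! i" if "i \<in> S" "i < m y" for y i
    using not_less_Least[of i "P y"] that by (auto simp: m_def P_def)
  have dom_c': "dom (c' y) = {i \<in> S. i \<le> m y}" if "y \<noteq> z" for y
    using that by (auto simp: c'_def split: if_splits)
  have confl_z: "conflict (c' y) (c' z)" "conflict (c' z) (c' y)"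
    if "y \<in> dom ?g" "y \<noteq> z" for y
  proof -
    have "m y \<in> dom (c' y) \<inter> dom (c' z)" "c' y (m y) \<noteq> c' z (m y)"
      using mP[OF that] S(2) that(2) boolean_function_length[OF f zd]
      by (auto simp: P_def c'_def full_assign_def)
    then show "conflict (c' y) (c' z)" "conflict (c' z) (c' y)"
      unfolding conflict_def by (blast, metis Int_commute)
  qed
  \<comment> \<open>Both certificates read position \<open>m y\<close>; there \<open>y\<close>
    already deviates from \<open>z\<close> while \<open>u\<close> still agrees with it.\<close>
  have confl_less: "conflict (c' y) (c' u) \<and> conflict (c' u) (c' y)"
    if "y \<in> dom ?g" "y \<noteq> z" "u \<noteq> z" "m y < m u" for y u
  proof -
    have "m y \<in> dom (c' y) \<inter> dom (c' u)" "c' y (m y) \<noteq> c' u (m y)"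
      using mP[OF that(1,2)] that below[of "m y" u] by (auto simp: P_def c'_def)
    then show ?thesis unfolding conflict_def by (metis Int_commute)
  qed
  \<comment> \<open>Up to the common stopping position both inputs agree with \<open>z\<close>, and
    at that position both carry the opposite bit: with a binary alphabet there is only one way to
    deviate.\<close>
  have eq: "c' y = c' u" if "y \<in> dom ?g" "y \<noteq> z" "u \<in> dom ?g" "u \<noteq> z" "m y = m u" for y u
  proof -
    have "y ! i = u ! i" if "i \<in> S" "i \<le> m y" for i
      using below[of i y] below[of i u] that mP[of y] mP[of u]
        \<open>y \<in> dom ?g\<close> \<open>y \<noteq> z\<close> \<open>u \<in> dom ?g\<close> \<open>u \<noteq> z\<close> \<open>m y = m u\<close>
      by (cases "i = m y") (auto simp: P_def)
    with that show ?thesis by (auto simp: c'_def)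
  qed
  have "unambiguous_family n ?g c'"
    unfolding unambiguous_family_def
  proof (intro conjI ballI)
    fix y assume y: "y \<in> dom ?g"
    show "certificate n ?g y (c' y)"
    proof (cases "y = z")
      case True
      then show ?thesis using certificate_full_assign[OF g y] by (simp add: c'_def)
    next
      case False
      have "c' y \<in> passigns n" using dom_c'[OF False] S(2) by (auto simp: passigns_def)
      moreover have "consistent (c' y) y"
        using False by (auto simp: consistent_def c'_def split: if_splits)
      moreover have "?g u = ?g y" if "u \<in> dom ?g" "consistent (c' y) u" for u
      proof -
        have "\<not> consistent (c' y) z"
          using mP[OF y False] dom_c'[OF False] False
          by (auto simp: consistent_def P_def c'_def)
        then have "u \<noteq> z" using that(2) by blast
        with that(1) y False show ?thesis by (auto simp: cert_fun_def split: if_splits)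
      qed
      ultimately show ?thesis by (simp add: certificate_def)
    qed
    fix u assume u: "u \<in> dom ?g"
    show "c' y = c' u \<or> conflict (c' y) (c' u)"
      using confl_z[OF y] confl_z[OF u] confl_less[of y u] confl_less[of u y] eq[of y u] y u
      by (metis linorder_neq_iff)
  qed
  moreover have "\<forall>y \<in> fiber ?g False. card (dom (c' y)) \<le> k"
  proof
    fix y assume "y \<in> fiber ?g False"
    then have "y \<noteq> z" by (auto simp: fiber_def)
    then have "card (dom (c' y)) \<le> card S"
      using dom_c' S(1) by (auto intro: card_mono)
    then show "card (dom (c' y)) \<le> k" using card_S by simp
  qed
  ultimately show ?thesis unfolding k UC_side_le_iff[OF g] by blast
qed

text \<open>For \<open>f z = Some True\<close> the certification problem is a restriction of
  \<open>f\<close> and monotonicity suffices. For \<open>f z = Some False\<close> the sides are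
  exchanged, and the scanning construction applies.\<close>

lemma certification_easier_UC_side_False: "certification_easier (UC_side False)"
  unfolding certification_easier_iff
proof (intro allI impI ballI)
  fix n f z assume f: "boolean_function n f" and z: "z \<in> dom f"
  show "UC_side False n (cert_fun f z) \<le> UC_side False n f"
  proof (cases "f z = Some False")
    case True
    then show ?thesis by (rule UC_side_False_cert_fun[OF f])
  next
    case False
    with z have "f z = Some True" by auto
    then have "cert_fun f z \<subseteq>\<^sub>m f" by (auto simp: map_le_def cert_fun_def dom_def)
    then show ?thesis by (rule UC_side_mono[OF f boolean_function_cert_fun[OF f z]])
  qed
qed

section \<open>Weight programs\<close>

lemma min_weight_le:
  assumes "finite S" "feasible w" "0 \<le> c" "\<And>x. x \<in> S \<Longrightarrow> (\<Sum>i<n. w x i) \<le> c"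
  shows "min_weight n S feasible \<le> c"
proof -
  have "min_weight n S feasible \<le> Max (insert 0 ((\<lambda>x. \<Sum>i<n. w x i) ` S))"
    unfolding min_weight_def using assms(1,2)
    by (intro cInf_lower bdd_belowI[of _ 0]) auto
  also have "\<dots> \<le> c" using assms by simp
  finally show ?thesis .
qed

lemma min_weight_ge:
  assumes "finite S" "feasible w0" "\<And>w. feasible w \<Longrightarrow> \<exists>x \<in> S. c \<le> (\<Sum>i<n. w x i)"
  shows "c \<le> min_weight n S feasible"
  unfolding min_weight_def
proof (rule cInf_greatest)
  show "{Max (insert 0 ((\<lambda>x. \<Sum>i<n. w x i) ` S)) | w. feasible w} \<noteq> {}"
    using assms(2) by blast
  fix a assume "a \<in> {Max (insert 0 ((\<lambda>x. \<Sum>i<n. w x i) ` S)) | w. feasible w}"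
  then obtain w where w: "feasible w" "a = Max (insert 0 ((\<lambda>x. \<Sum>i<n. w x i) ` S))" by blast
  from assms(3)[OF w(1)] obtain x where "x \<in> S" "c \<le> (\<Sum>i<n. w x i)" by blast
  then show "c \<le> a" unfolding w(2) using assms(1) by (subst Max_ge_iff) auto
qed

lemma min_weight_nonneg:
  assumes "finite S" "feasible w0"
  shows "0 \<le> min_weight n S feasible"
  unfolding min_weight_def using assms by (intro cInf_greatest) auto

lemma min_weight_mono:
  assumes "finite S" "S' \<subseteq> S" "feasible w0" "\<And>w. feasible w \<Longrightarrow> feasible' w"
  shows "min_weight n S' feasible' \<le> min_weight n S feasible"
  unfolding min_weight_def[of n S]
proof (rule cInf_greatest)
  show "{Max (insert 0 ((\<lambda>x. \<Sum>i<n. w x i) ` S)) | w. feasible w} \<noteq> {}"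
    using assms(3) by blast
  fix a assume "a \<in> {Max (insert 0 ((\<lambda>x. \<Sum>i<n. w x i) ` S)) | w. feasible w}"
  then obtain w where w: "feasible w" "a = Max (insert 0 ((\<lambda>x. \<Sum>i<n. w x i) ` S))" by blast
  have "finite S'" using assms(1,2) finite_subset by blast
  then show "min_weight n S' feasible' \<le> a"
    unfolding w(2) using assms w(1) by (intro min_weight_le[where w = w]) auto
qed

lemma weight_scheme_bneg [simp]: "weight_scheme n (bneg f) \<phi> = weight_scheme n f \<phi>"
  by (simp add: weight_scheme_def fun_eq_iff)

lemma weight_scheme_mono:
  assumes "weight_scheme n f \<phi> w" "g \<subseteq>\<^sub>m f"
  shows "weight_scheme n g \<phi> w"
  using assms(1) map_leD_eq[OF assms(2)] subsetD[OF map_le_implies_dom_le[OF assms(2)]]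
  unfolding weight_scheme_def by metis

lemma weight_scheme_one:
  assumes "boolean_function n f" "\<phi> 1 1 = 1"
  shows "weight_scheme n f \<phi> (\<lambda>x i. 1)"
proof -
  have "1 \<le> real (card (differing n x y))" if "x \<in> dom f" "y \<in> dom f" "f x \<noteq> f y" for x y
  proof -
    have "card (differing n x y) > 0"
      using differing_nonempty[OF assms(1) that(1,2)] that(3) by (auto simp: card_gt_0_iff)
    then show ?thesis by simp
  qed
  then show ?thesis using assms(2) by (auto simp: weight_scheme_def)
qed

text \<open>The constraints see \<open>f\<close> only through its domain and the pairs with
  different values; negation keeps these pairs and restriction removes some. \<open>B\<close>
  carries the extra bound of \<open>EC_meas\<close> and is trivial for the other programs. All-one
  weights are feasible because \<open>\<phi> 1 1 = 1\<close> and differing inputs disagree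
  somewhere.\<close>

lemma stable_weight_program:
  assumes \<phi>: "\<phi> 1 1 = 1"
    and B: "\<And>n S T w. B n S w \<Longrightarrow> T \<subseteq> S \<Longrightarrow> B n T w" "\<And>n S. B n S (\<lambda>x i. 1)"
  shows "stable_measure (\<lambda>n f. min_weight n (dom f) (\<lambda>w. weight_scheme n f \<phi> w \<and> B n (dom f) w))"
proof (rule stable_measureI)
  fix n f g assume fg: "boolean_function n f" "boolean_function n g" "g \<subseteq>\<^sub>m f"
  have sub: "dom g \<subseteq> dom f" by (rule map_le_implies_dom_le[OF fg(3)])
  show "min_weight n (dom g) (\<lambda>w. weight_scheme n g \<phi> w \<and> B n (dom g) w)
    \<le> min_weight n (dom f) (\<lambda>w. weight_scheme n f \<phi> w \<and> B n (dom f) w)"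
  proof (rule min_weight_mono[OF boolean_function_finite[OF fg(1)] sub])
    show "weight_scheme n f \<phi> (\<lambda>x i. 1) \<and> B n (dom f) (\<lambda>x i. 1)"
      using weight_scheme_one[OF fg(1), of \<phi>] \<phi> B(2) by simp
    fix w assume "weight_scheme n f \<phi> w \<and> B n (dom f) w"
    then show "weight_scheme n g \<phi> w \<and> B n (dom g) w"
      using B(1)[OF _ sub] weight_scheme_mono[OF _ fg(3)] by blast
  qed
qed simp

lemma stable_EC_meas: "stable_measure EC_meas"
  unfolding EC_meas_def[abs_def]
  by (rule stable_weight_program[where B = "\<lambda>n S w. \<forall>x \<in> S. \<forall>i < n. w x i \<le> 1"]) auto

lemma stable_sqrt_CG: "stable_measure sqrt_CG"
  using stable_weight_program[of "\<lambda>a b. a * b" "\<lambda>_ _ _. True"] by (simp add: sqrt_CG_def[abs_def])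

lemma stable_MM_meas: "stable_measure MM_meas"
  using stable_weight_program[of "\<lambda>a b. sqrt (a * b)" "\<lambda>_ _ _. True"] by (simp add: MM_meas_def[abs_def])

lemma stable_CAdv_meas: "stable_measure CAdv_meas"
  using stable_weight_program[of min "\<lambda>_ _ _. True"] by (simp add: CAdv_meas_def[abs_def])

lemma sqrt_CG_nonneg: "boolean_function n f \<Longrightarrow> 0 \<le> sqrt_CG n f"
  unfolding sqrt_CG_def
  by (rule min_weight_nonneg[where ?w0.0 = "\<lambda>x i. 1"])
    (auto intro: boolean_function_finite weight_scheme_one)

lemma stable_CG_meas: "stable_measure CG_meas"
proof (rule stable_measureI)
  fix n f assume f: "boolean_function n f"
  show "CG_meas n (bneg f) \<le> CG_meas n f"
    by (simp add: CG_meas_def stable_measure_bneg[OF stable_sqrt_CG f])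
  fix g assume "boolean_function n g" "g \<subseteq>\<^sub>m f"
  then show "CG_meas n g \<le> CG_meas n f"
    unfolding CG_meas_def using f
    by (intro power_mono stable_measure_mono[OF stable_sqrt_CG] sqrt_CG_nonneg)
qed

lemma FC_side_bneg [simp]: "FC_side b n (bneg f) = FC_side (\<not> b) n f"
  by (simp add: FC_side_def)

lemma FC_side_mono:
  assumes f: "boolean_function n f" and g: "boolean_function n g" "g \<subseteq>\<^sub>m f"
  shows "FC_side b n g \<le> FC_side b n f"
  unfolding FC_side_def
  using weight_scheme_one[OF f] weight_scheme_mono[OF _ g(2)] boolean_function_fiber_finite[OF f]
    fiber_mono[OF g(2)]
  by (intro min_weight_mono[where ?w0.0 = "\<lambda>x i. 1"]) auto

lemma stable_FC_meas: "stable_measure FC_meas"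
  unfolding FC_meas_def[abs_def]
  by (rule stable_measure_max_sides) (auto intro: FC_side_mono)

lemma FC_side_nonneg: "boolean_function n f \<Longrightarrow> 0 \<le> FC_side b n f"
  unfolding FC_side_def
  by (rule min_weight_nonneg[where ?w0.0 = "\<lambda>x i. 1"])
    (auto intro: boolean_function_fiber_finite weight_scheme_one)

lemma FC_side_pos:
  assumes f: "boolean_function n f" and x: "x \<in> fiber f b" "y \<in> dom f" "f y \<noteq> f x"
  shows "1 \<le> FC_side b n f"
  unfolding FC_side_def
proof (rule min_weight_ge[where ?w0.0 = "\<lambda>x i. 1"])
  show "finite (fiber f b)" by (rule boolean_function_fiber_finite[OF f])
  show "weight_scheme n f (\<lambda>a b. a) (\<lambda>x i. 1)" by (rule weight_scheme_one[OF f]) simp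
  fix w assume w: "weight_scheme n f (\<lambda>a b. a) w"
  have xd: "x \<in> dom f" using x(1) fiber_subset_dom by blast
  have "1 \<le> (\<Sum>i\<in>differing n x y. w x i)"
    using w xd x(2,3) unfolding weight_scheme_def by metis
  also have "\<dots> \<le> (\<Sum>i<n. w x i)"
    using w xd by (intro sum_mono2) (auto simp: differing_def weight_scheme_def)
  finally show "\<exists>x\<in>fiber f b. 1 \<le> (\<Sum>i<n. w x i)" using x(1) by blast
qed

text \<open>Fractional form of the one-position certificate: a False input puts its whole weight on
  one position where it differs from \<open>z\<close>, and \<open>z\<close> takes weight 1
  everywhere, which is charged to the True side. The empty fiber is separated because its maximum is
  0.\<close>

lemma FC_side_False_cert_fun_le:
  assumes f: "boolean_function n f" and z: "z \<in> dom f"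
  shows "FC_side False n (cert_fun f z) \<le> (if fiber (cert_fun f z) False = {} then 0 else 1)"
proof -
  let ?g = "cert_fun f z"
  have g: "boolean_function n ?g" by (rule boolean_function_cert_fun[OF f z])
  have dg: "dom ?g = {z} \<union> {y \<in> dom f. f y \<noteq> f z}" by (rule dom_cert_fun[OF z])
  define d where "d y = (SOME i. i \<in> differing n y z)" for y
  have d: "d y \<in> differing n y z" if "y \<in> dom ?g" "y \<noteq> z" for y
    unfolding d_def using differing_nonempty[OF g that(1)] that(2) dg by (simp add: some_in_eq)
  define w where "w y i = (if y = z \<or> i = d y then 1 else 0 :: real)" for y i
  have "weight_scheme n ?g (\<lambda>a b. a) w"
    unfolding weight_scheme_def
  proof (intro conjI ballI impI allI)
    fix x y assume xy: "x \<in> dom ?g" "y \<in> dom ?g" "?g x \<noteq> ?g y"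
    show "1 \<le> (\<Sum>i\<in>differing n x y. w x i)"
    proof (cases "x = z")
      case True
      have "x \<noteq> y" using xy(3) by blast
      then have "card (differing n x y) > 0"
        using differing_nonempty[OF g xy(1,2)] by (simp add: card_gt_0_iff)
      then show ?thesis by (simp add: w_def True)
    next
      case False
      then have "y = z" using xy by (auto simp: cert_fun_def split: if_splits)
      then show ?thesis using False d[OF xy(1) False] by (simp add: w_def)
    qed
  qed (simp add: w_def)
  moreover have "(\<Sum>i<n. w y i) \<le> 1" if "y \<in> fiber ?g False" for y
  proof -
    have "y \<noteq> z" using that by (auto simp: fiber_def)
    then have "(\<Sum>i<n. w y i) = (\<Sum>i<n. if i = d y then 1 else 0)" by (simp add: w_def)
    also have "\<dots> \<le> 1" by simp
    finally show ?thesis .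
  qed
  ultimately show ?thesis
    unfolding FC_side_def using boolean_function_fiber_finite[OF g]
    by (intro min_weight_le[where w = w]) auto
qed

lemma FC_side_False_cert_fun:
  assumes f: "boolean_function n f" and z: "z \<in> dom f" and y: "y \<in> dom f" "f y \<noteq> f z"
  shows "FC_side False n (cert_fun f z) = 1"
proof (rule antisym)
  let ?g = "cert_fun f z"
  have yf: "y \<in> fiber ?g False" using y fiber_cert_fun_False[OF z] by blast
  then have "fiber ?g False \<noteq> {}" by blast
  then show "FC_side False n ?g \<le> 1"
    using FC_side_False_cert_fun_le[OF f z] by (simp only: if_False)
  from yf have "?g y = Some False" by (simp add: fiber_def)
  with yf show "1 \<le> FC_side False n ?g"
    by (intro FC_side_pos[OF boolean_function_cert_fun[OF f z], of y _ z]) (auto simp: dom_cert_fun[OF z])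
qed

lemma certification_easier_FC_side_False: "certification_easier (FC_side False)"
  unfolding certification_easier_iff
proof (intro allI impI ballI)
  fix n f z assume f: "boolean_function n f" and z: "z \<in> dom f"
  show "FC_side False n (cert_fun f z) \<le> FC_side False n f"
  proof (cases "\<exists>y. y \<in> dom f \<and> f y \<noteq> f z")
    case True
    then obtain y where y: "y \<in> dom f" "f y \<noteq> f z" by blast
    obtain x x' where "x \<in> fiber f False" "x' \<in> dom f" "f x' \<noteq> f x"
      using exists_fiber_pair[OF y(1) z y(2)] .
    then have "1 \<le> FC_side False n f" by (rule FC_side_pos[OF f])
    then show ?thesis using FC_side_False_cert_fun[OF f z y] by simp
  next
    case False
    then have "fiber (cert_fun f z) False = {}" using fiber_cert_fun_False[OF z] by blast
    then show ?thesis
      using FC_side_False_cert_fun_le[OF f z] FC_side_nonneg[OF f, of False] by simp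
  qed
qed

lemma collapses_FC_side_False: "collapses (FC_side False)"
  unfolding collapses_def
  by (rule exI[of _ 1]) (metis cert_const other_value FC_side_False_cert_fun)

section \<open>One-sided measures at the value 1\<close>

abbreviation "zero3 \<equiv> [False, False, False]"
abbreviation "unit1 \<equiv> [True, False, False]"
abbreviation "unit2 \<equiv> [False, True, False]"
abbreviation "unit3 \<equiv> [False, False, True]"

text \<open>Only weights 0 and 1 are kept, so that \<open>zero3\<close> must exclude each unit
  vector at that vector's own position. Three variables leave a gap for \<open>UC_side\<close> as
  well: pairwise conflicting certificates of the unit vectors take two positions each, which would
  be no saving with two variables.\<close>

definition part_or :: bfun where
  "part_or = [zero3 \<mapsto> False, unit1 \<mapsto> True,
     unit2 \<mapsto> True, unit3 \<mapsto> True]"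

lemma boolean_function_part_or: "boolean_function 3 part_or"
  by (auto simp: boolean_function_def part_or_def)

lemma fiber_part_or_True:
  "fiber part_or True = {unit1, unit2, unit3}"
  by (auto simp: fiber_def part_or_def split: if_splits)

lemma dom_part_or:
  "dom part_or = insert zero3
     {unit1, unit2, unit3}"
  by (auto simp: part_or_def)

abbreviation "part_nor \<equiv> cert_fun part_or zero3"

lemma boolean_function_part_nor: "boolean_function 3 part_nor"
  by (rule boolean_function_cert_fun[OF boolean_function_part_or]) (simp add: dom_part_or)

lemma part_nor_simps:
  "part_nor zero3 = Some True"
  "part_nor unit1 = Some False"
  "part_nor unit2 = Some False"
  "part_nor unit3 = Some False"
  by (simp_all add: cert_fun_def dom_part_or, simp_all add: part_or_def)

text \<open>Each unit vector differs from \<open>zero3\<close> at a single position, so a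
  certificate that leaves this position free is consistent with that vector.\<close>

lemma part_nor_certificate:
  assumes "certificate 3 part_nor zero3 c"
  shows "3 \<le> card (dom c)"
proof -
  have c: "c \<in> passigns 3" "consistent c zero3"
    "\<And>u. u \<in> dom part_nor \<Longrightarrow> consistent c u \<Longrightarrow> part_nor u = Some True"
    using assms by (auto simp: certificate_def)
  have incons: "\<not> consistent c unit1" "\<not> consistent c unit2"
    "\<not> consistent c unit3"
    using c(3)[of "unit1"] c(3)[of "unit2"]
      c(3)[of "unit3"] part_nor_simps by auto
  have less: "i < 3" if "i \<in> dom c" for i using c(1) that by (auto simp: passigns_def)
  have cF: "c i = Some (zero3 ! i)" if "i \<in> dom c" for i
    using c(2) that by (auto simp: consistent_def)
  have "0 \<in> dom c"
  proof (rule ccontr)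
    assume "0 \<notin> dom c"
    then have "consistent c unit1"
      unfolding consistent_def using cF by (metis nth_Cons_pos not_gr_zero)
    with incons show False by blast
  qed
  moreover have "1 \<in> dom c"
  proof (rule ccontr)
    assume "1 \<notin> dom c"
    then have "zero3 ! i = unit2 ! i" if "i \<in> dom c" for i
      using less[OF that] that by (cases "i = 0"; cases "i = 1") (auto simp: numeral_3_eq_3 less_Suc_eq)
    then have "consistent c unit2" unfolding consistent_def using cF by simp
    with incons show False by blast
  qed
  moreover have "2 \<in> dom c"
  proof (rule ccontr)
    assume "2 \<notin> dom c"
    then have "zero3 ! i = unit3 ! i" if "i \<in> dom c" for i
      using less[OF that] that
      by (cases "i = 0"; cases "i = 1") (auto simp: numeral_2_eq_2 numeral_3_eq_3 less_Suc_eq)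
    then have "consistent c unit3" unfolding consistent_def using cF by simp
    with incons show False by blast
  qed
  ultimately have "{0, 1, 2} \<subseteq> dom c" by blast
  from card_mono[OF finite_dom_passign[OF c(1)] this] show ?thesis by simp
qed

lemma not_easier_part_or:
  assumes "M 3 part_or < M 3 part_nor"
  shows "\<not> certification_easier M"
proof
  assume "certification_easier M"
  moreover have "zero3 \<in> dom part_or" by (simp add: dom_part_or)
  ultimately have "M 3 part_nor \<le> M 3 part_or"
    unfolding certification_easier_iff using boolean_function_part_or by blast
  with assms show False by simp
qed

lemma not_easier_C_side_True: "\<not> certification_easier (C_side True)"
proof (rule not_easier_part_or)
  have "C_at 3 part_or x \<le> 1" if x: "x \<in> fiber part_or True" for x
  proof -
    from x obtain i where i: "i < 3" "x ! i" "\<not> zero3 ! i"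
      unfolding fiber_part_or_True
      by (elim insertE emptyE) (rule that[of 0] that[of 1] that[of 2]; simp)+
    \<comment> \<open>The only False input of \<open>part_or\<close> is \<open>zero3\<close>, and
      any True bit rules it out.\<close>
    have "certificate 3 part_or x [i \<mapsto> True]"
      using x i by (auto simp: certificate_def passigns_def consistent_def part_or_def fiber_def
          split: if_splits)
    from C_at_le[OF this] show ?thesis by simp
  qed
  then have le: "C_side True 3 part_or \<le> 1"
    using C_side_le_iff[OF boolean_function_part_or, of True 1] by simp
  obtain c where c: "certificate 3 part_nor zero3 c"
      "card (dom c) = C_at 3 part_nor zero3"
    by (rule C_at_attained[OF boolean_function_part_nor, of "zero3"])
      (auto simp: part_nor_simps)
  have "3 \<le> real (C_at 3 part_nor zero3)"
    using part_nor_certificate[OF c(1)] c(2) by simp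
  also have "\<dots> \<le> C_side True 3 part_nor"
    by (rule C_side_ge[OF boolean_function_part_nor]) (simp add: fiber_cert_fun_True)
  finally show "C_side True 3 part_or < C_side True 3 part_nor" using le by simp
qed

text \<open>
  Reading each position together with its cyclic successor makes the certificates of the
  three unit vectors conflict pairwise with only two positions each.
\<close>

lemma not_easier_UC_side_True: "\<not> certification_easier (UC_side True)"
proof (rule not_easier_part_or)
  define c :: "bool list \<Rightarrow> passign" where
    "c x = (if x = unit1 then [0 \<mapsto> True, 1 \<mapsto> False]
       else if x = unit2 then [1 \<mapsto> True, 2 \<mapsto> False]
       else if x = unit3 then [2 \<mapsto> True, 0 \<mapsto> False]
       else [0 \<mapsto> False, 1 \<mapsto> False, 2 \<mapsto> False])" for x
  have "certificate 3 part_or x (c x)" if "x \<in> dom part_or" for x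
    using that unfolding dom_part_or certificate_def
    by (auto simp: c_def passigns_def consistent_def part_or_def)
  moreover have "c x = c y \<or> conflict (c x) (c y)" if "x \<in> dom part_or" "y \<in> dom part_or" for x y
    using that unfolding dom_part_or conflict_def by (auto simp: c_def)
  moreover have "card (dom (c x)) \<le> 2" if "x \<in> fiber part_or True" for x
    using that unfolding fiber_part_or_True by (auto simp: c_def card_insert_if)
  ultimately have le: "UC_side True 3 part_or \<le> real 2"
    unfolding UC_side_le_iff[OF boolean_function_part_or] unambiguous_family_def by blast
  have "\<not> UC_side True 3 part_nor \<le> real 2"
  proof
    assume "UC_side True 3 part_nor \<le> real 2"
    then obtain c where c: "unambiguous_family 3 part_nor c"
        "\<forall>x \<in> fiber part_nor True. card (dom (c x)) \<le> 2"
      unfolding UC_side_le_iff[OF boolean_function_part_nor] by blast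
    have "certificate 3 part_nor zero3 (c zero3)"
      using c(1) part_nor_simps unfolding unambiguous_family_def by blast
    from part_nor_certificate[OF this] c(2) show False by (simp add: fiber_cert_fun_True)
  qed
  with le show "UC_side True 3 part_or < UC_side True 3 part_nor" by simp
qed

lemma not_easier_FC_side_True: "\<not> certification_easier (FC_side True)"
proof (rule not_easier_part_or)
  \<comment> \<open>Each unit vector pays only for its True bit; \<open>zero3\<close> is a False
    input of \<open>part_or\<close>, so its larger total is not charged here.\<close>
  define w :: "bool list \<Rightarrow> nat \<Rightarrow> real"
    where "w x i = (if x = zero3 \<or> x ! i then 1 else 0)" for x i
  have diff: "differing 3 x y = set (filter (\<lambda>i. x ! i \<noteq> y ! i) [0, 1, 2])" for x y :: "bool list"
    by (auto simp: differing_def numeral_3_eq_3 numeral_2_eq_2 less_Suc_eq)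
  have sum3: "(\<Sum>i<3. h i) = h 0 + h 1 + h 2" for h :: "nat \<Rightarrow> real"
    by (simp add: numeral_3_eq_3 numeral_2_eq_2)
  have "weight_scheme 3 part_or (\<lambda>a b. a) w"
    unfolding weight_scheme_def dom_part_or by (auto simp: w_def diff part_or_def)
  then have "FC_side True 3 part_or \<le> 1"
    unfolding FC_side_def
    by (rule min_weight_le[rotated]) (auto simp: fiber_part_or_True w_def sum3)
  moreover have "3 \<le> FC_side True 3 part_nor"
    unfolding FC_side_def
  proof (rule min_weight_ge[where ?w0.0 = "\<lambda>x i. 1"])
    show "finite (fiber part_nor True)"
      by (rule boolean_function_fiber_finite[OF boolean_function_part_nor])
    show "weight_scheme 3 part_nor (\<lambda>a b. a) (\<lambda>x i. 1)"
      by (rule weight_scheme_one[OF boolean_function_part_nor]) simp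
    fix w assume w: "weight_scheme 3 part_nor (\<lambda>a b. a) w"
    let ?z = "zero3"
    have *: "1 \<le> (\<Sum>i\<in>differing 3 ?z y. w ?z i)" if "part_nor y = Some False" for y
    proof -
      have "y \<in> dom part_nor" "?z \<in> dom part_nor" "part_nor ?z \<noteq> part_nor y"
        using that part_nor_simps by auto
      with w show ?thesis unfolding weight_scheme_def by blast
    qed
    \<comment> \<open>The set of positions where \<open>zero3\<close> differs from a unit vector is
      a singleton, so each constraint bounds one single weight.\<close>
    have "1 \<le> w ?z 0" "1 \<le> w ?z 1" "1 \<le> w ?z 2"
      using *[OF part_nor_simps(2)] *[OF part_nor_simps(3)] *[OF part_nor_simps(4)]
      by (simp_all add: diff)
    then show "\<exists>x\<in>fiber part_nor True. 3 \<le> (\<Sum>i<3. w x i)"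
      by (simp add: fiber_cert_fun_True sum3)
  qed
  ultimately show "FC_side True 3 part_or < FC_side True 3 part_nor" by simp
qed

section \<open>The partition bound\<close>

definition partition_weights :: "real \<Rightarrow> nat \<Rightarrow> bfun \<Rightarrow> (bool \<Rightarrow> passign \<Rightarrow> real) \<Rightarrow> bool" where
  "partition_weights \<epsilon> n f w \<longleftrightarrow> (\<forall>b. \<forall>A \<in> passigns n. 0 \<le> w b A) \<and>
     (\<forall>x \<in> dom f. (\<Sum>A | A \<in> passigns n \<and> consistent A x. w (the (f x)) A) \<ge> 1 - \<epsilon>) \<and>
     (\<forall>x. length x = n \<longrightarrow> (\<Sum>A | A \<in> passigns n \<and> consistent A x. \<Sum>b\<in>UNIV. w b A) = 1)"

abbreviation partition_cost :: "nat \<Rightarrow> (bool \<Rightarrow> passign \<Rightarrow> real) \<Rightarrow> real" where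
  "partition_cost n w \<equiv> (\<Sum>b\<in>UNIV. \<Sum>A\<in>passigns n. w b A * 2 ^ card (dom A))"

lemma Prt_eq: "Prt \<epsilon> n f = Inf {partition_cost n w | w. partition_weights \<epsilon> n f w}"
  by (simp add: Prt_def partition_weights_def)

text \<open>Normalization at one input already gives total weight at least 1, and every factor
  \<open>2 ^ card (dom A)\<close> is at least 1. This bounds the infimum below and keeps
  \<open>prt_eps\<close> inside the range where the logarithm is monotone.\<close>

lemma partition_cost_ge_1:
  assumes "partition_weights \<epsilon> n f w"
  shows "1 \<le> partition_cost n w"
proof -
  let ?x = "replicate n False"
  have nonneg: "0 \<le> w b A" if "A \<in> passigns n" for b A
    using assms that by (simp add: partition_weights_def)
  have "1 = (\<Sum>A | A \<in> passigns n \<and> consistent A ?x. \<Sum>b\<in>UNIV. w b A)"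
    using assms by (simp add: partition_weights_def)
  also have "\<dots> \<le> (\<Sum>A\<in>passigns n. \<Sum>b\<in>UNIV. w b A)"
    using nonneg by (intro sum_mono2) (auto intro: sum_nonneg)
  also have "\<dots> \<le> (\<Sum>A\<in>passigns n. \<Sum>b\<in>UNIV. w b A * 2 ^ card (dom A))"
  proof (intro sum_mono)
    fix A :: passign and b assume A: "A \<in> passigns n"
    have "w b A * 1 \<le> w b A * 2 ^ card (dom A)"
      by (intro mult_left_mono nonneg[OF A]) simp
    then show "w b A \<le> w b A * 2 ^ card (dom A)" by simp
  qed
  also have "\<dots> = partition_cost n w" by (rule sum.swap)
  finally show ?thesis .
qed

text \<open>Weight 1 goes to every full assignment, labelled by the value of \<open>f\<close>.
  Outside the domain the label \<open>the (f x)\<close> is some fixed Boolean, which is enough for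
  the normalization there.\<close>

lemma exists_partition_weights:
  assumes f: "boolean_function n f" and \<epsilon>: "0 \<le> \<epsilon>"
  shows "\<exists>w. partition_weights \<epsilon> n f w"
proof -
  define val where "val A = the (f (map (\<lambda>i. the (A i)) [0..<n]))" for A :: passign
  define w :: "bool \<Rightarrow> passign \<Rightarrow> real"
    where "w b A = of_bool (dom A = {..<n} \<and> b = val A)" for b A
  have full: "{A \<in> passigns n. consistent A x} \<inter> {A. dom A = {..<n}} = {full_assign x}"
    if "length x = n" for x
  proof -
    have "A = full_assign x" if A: "consistent A x" "dom A = {..<n}" for A
    proof
      fix i
      show "A i = full_assign x i"
        using A \<open>length x = n\<close>
        by (cases "i < n") (auto simp: consistent_def full_assign_def domIff)
    qed
    then show ?thesis
      using that full_assign_passigns[OF that] dom_full_assign[of x]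
      by (auto simp: consistent_full_assign_iff simp del: dom_full_assign)
  qed
  have val: "val (full_assign x) = the (f x)" if "length x = n" for x
  proof -
    have "map (\<lambda>i. the (full_assign x i)) [0..<n] = x"
      using that by (intro nth_equalityI) (auto simp: full_assign_def)
    then show ?thesis by (simp add: val_def)
  qed
  have sum: "(\<Sum>A | A \<in> passigns n \<and> consistent A x. of_bool (dom A = {..<n}) * h A) = h (full_assign x)"
    if "length x = n" for x and h :: "passign \<Rightarrow> real"
  proof -
    have "(\<Sum>A | A \<in> passigns n \<and> consistent A x. of_bool (dom A = {..<n}) * h A)
      = (\<Sum>A \<in> {A \<in> passigns n. consistent A x} \<inter> {A. dom A = {..<n}}. h A)"
      by (intro sum.mono_neutral_cong_right) auto
    then show ?thesis unfolding full[OF that] by simp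
  qed
  have "partition_weights \<epsilon> n f w"
    unfolding partition_weights_def
  proof (intro conjI allI ballI impI)
    fix x assume "x \<in> dom f"
    then have x: "length x = n" by (rule boolean_function_length[OF f])
    have "(\<Sum>A | A \<in> passigns n \<and> consistent A x. w (the (f x)) A) = 1"
      using sum[OF x, of "\<lambda>A. of_bool (the (f x) = val A)"] val[OF x]
      by (simp add: w_def of_bool_conj)
    with \<epsilon> show "1 - \<epsilon> \<le> (\<Sum>A | A \<in> passigns n \<and> consistent A x. w (the (f x)) A)" by simp
  next
    fix x :: "bool list" assume x: "length x = n"
    have "(\<Sum>b\<in>UNIV. w b A) = of_bool (dom A = {..<n}) * 1" for A
      by (simp add: w_def UNIV_bool)
    then show "(\<Sum>A | A \<in> passigns n \<and> consistent A x. \<Sum>b\<in>UNIV. w b A) = 1"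
      using sum[OF x, of "\<lambda>A. 1"] by simp
  qed (simp add: w_def)
  then show ?thesis by blast
qed

lemma partition_weights_mono:
  assumes "partition_weights \<epsilon> n f w" "g \<subseteq>\<^sub>m f"
  shows "partition_weights \<epsilon> n g w"
proof -
  have "(\<Sum>A | A \<in> passigns n \<and> consistent A x. w (the (g x)) A) \<ge> 1 - \<epsilon>" if x: "x \<in> dom g" for x
  proof -
    have "x \<in> dom f" using map_le_implies_dom_le[OF assms(2)] x by blast
    with assms(1) show ?thesis
      unfolding partition_weights_def map_leD_eq[OF assms(2) x] by blast
  qed
  with assms(1) show ?thesis unfolding partition_weights_def by blast
qed

lemma partition_weights_bneg:
  assumes "partition_weights \<epsilon> n f w"
  shows "partition_weights \<epsilon> n (bneg f) (\<lambda>b. w (\<not> b))"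
proof -
  have "the (bneg f x) = (\<not> the (f x))" if "x \<in> dom f" for x
    using that by (auto simp: bneg_def)
  moreover have "(\<Sum>b\<in>UNIV. w (\<not> b) A) = (\<Sum>b\<in>UNIV. w b A)" for A
    by (simp add: UNIV_bool)
  ultimately show ?thesis
    using assms unfolding partition_weights_def by simp
qed

lemma Prt_mono:
  assumes "boolean_function n f" "0 \<le> \<epsilon>"
    and "\<And>w. partition_weights \<epsilon> n f w \<Longrightarrow>
      \<exists>w'. partition_weights \<epsilon> n g w' \<and> partition_cost n w' = partition_cost n w"
  shows "Prt \<epsilon> n g \<le> Prt \<epsilon> n f"
  unfolding Prt_eq
proof (rule cInf_superset_mono)
  show "{partition_cost n w | w. partition_weights \<epsilon> n f w} \<noteq> {}"
    using exists_partition_weights[OF assms(1,2)] by blast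
  show "bdd_below {partition_cost n w | w. partition_weights \<epsilon> n g w}"
    using partition_cost_ge_1 by (intro bdd_belowI[of _ 1]) auto
  show "{partition_cost n w | w. partition_weights \<epsilon> n f w}
    \<subseteq> {partition_cost n w | w. partition_weights \<epsilon> n g w}"
    using assms(3) by (smt (verit) Collect_mono)
qed

lemma stable_Prt:
  assumes \<epsilon>: "0 \<le> \<epsilon>"
  shows "stable_measure (Prt \<epsilon>)"
proof (rule stable_measureI)
  fix n f assume f: "boolean_function n f"
  have "partition_cost n (\<lambda>b. w (\<not> b)) = partition_cost n w" for w
    by (simp add: UNIV_bool)
  then show "Prt \<epsilon> n (bneg f) \<le> Prt \<epsilon> n f"
    using partition_weights_bneg by (intro Prt_mono[OF f \<epsilon>]) blast
  fix g assume "g \<subseteq>\<^sub>m f"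
  then show "Prt \<epsilon> n g \<le> Prt \<epsilon> n f"
    using partition_weights_mono by (intro Prt_mono[OF f \<epsilon>]) blast
qed

lemma Prt_ge_1:
  assumes "boolean_function n f" "0 \<le> \<epsilon>"
  shows "1 \<le> Prt \<epsilon> n f"
  unfolding Prt_eq using exists_partition_weights[OF assms] partition_cost_ge_1
  by (intro cInf_greatest) auto

lemma stable_prt_eps:
  assumes \<epsilon>: "0 \<le> \<epsilon>"
  shows "stable_measure (prt_eps \<epsilon>)"
proof (rule stable_measureI)
  fix n f assume f: "boolean_function n f"
  show "prt_eps \<epsilon> n (bneg f) \<le> prt_eps \<epsilon> n f"
    by (simp add: prt_eps_def stable_measure_bneg[OF stable_Prt[OF \<epsilon>] f])
  fix g assume g: "boolean_function n g" "g \<subseteq>\<^sub>m f"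
  have "Prt \<epsilon> n g \<le> Prt \<epsilon> n f" by (rule stable_measure_mono[OF stable_Prt[OF \<epsilon>] f g])
  then show "prt_eps \<epsilon> n g \<le> prt_eps \<epsilon> n f"
    unfolding prt_eps_def using Prt_ge_1[OF g(1) \<epsilon>] by simp
qed

section \<open>Sensitivity measures\<close>

lemma finite_sensitive_blocks [simp]: "finite (sensitive_blocks n f x)"
  by (rule finite_subset[of _ "Pow {..<n}"]) (auto simp: sensitive_blocks_def)

lemma sensitive_blocks_bneg [simp]: "sensitive_blocks n (bneg f) x = sensitive_blocks n f x"
  by (simp add: sensitive_blocks_def)

lemma sensitive_blocks_mono:
  assumes "g \<subseteq>\<^sub>m f" "x \<in> dom g"
  shows "sensitive_blocks n g x \<subseteq> sensitive_blocks n f x"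
proof
  fix B assume B: "B \<in> sensitive_blocks n g x"
  then have d: "flip n x B \<in> dom g" unfolding sensitive_blocks_def by blast
  have "flip n x B \<in> dom f" using map_le_implies_dom_le[OF assms(1)] d by blast
  then show "B \<in> sensitive_blocks n f x"
    using B unfolding sensitive_blocks_def map_leD_eq[OF assms] mem_Collect_eq
      map_leD_eq[OF assms(1) d] by blast
qed

text \<open>Common pattern of \<open>s_meas\<close>, \<open>bs_meas\<close> and
  \<open>fbs_meas\<close>: a local quantity that ignores negation and grows with the function. The
  wrapper \<open>r\<close> is the cast \<open>real\<close> or the identity.\<close>

lemma stable_Max_local:
  fixes L :: "nat \<Rightarrow> bfun \<Rightarrow> bool list \<Rightarrow> 'a :: linorder"
  assumes r: "mono r"
    and neg: "\<And>n f x. L n (bneg f) x = L n f x"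
    and mono: "\<And>n f g x. boolean_function n f \<Longrightarrow> g \<subseteq>\<^sub>m f \<Longrightarrow> x \<in> dom g \<Longrightarrow> L n g x \<le> L n f x"
  shows "stable_measure (\<lambda>n f. r (Max (L n f ` dom f)))"
proof (rule stable_measureI)
  fix n f assume f: "boolean_function n f"
  have "L n (bneg f) = L n f" by (simp add: neg fun_eq_iff)
  then show "r (Max (L n (bneg f) ` dom (bneg f))) \<le> r (Max (L n f ` dom f))" by simp
  fix g assume g: "boolean_function n g" "g \<subseteq>\<^sub>m f"
  have "L n g x \<le> Max (L n f ` dom f)" if x: "x \<in> dom g" for x
  proof -
    have "x \<in> dom f" using x map_le_implies_dom_le[OF g(2)] by blast
    then have "L n f x \<le> Max (L n f ` dom f)" using boolean_function_finite[OF f] by simp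
    with mono[OF f g(2) x] show ?thesis by (rule order_trans)
  qed
  moreover have "finite (dom g)" "dom g \<noteq> {}"
    using boolean_function_finite g(1) by (auto simp: boolean_function_def)
  ultimately have "Max (L n g ` dom g) \<le> Max (L n f ` dom f)" by (simp del: dom_eq_empty_conv)
  then show "r (Max (L n g ` dom g)) \<le> r (Max (L n f ` dom f))" by (rule monoD[OF r])
qed

lemma stable_s_meas: "stable_measure s_meas"
  unfolding s_meas_def[abs_def]
proof (rule stable_Max_local)
  fix n and f g :: bfun and x assume "g \<subseteq>\<^sub>m f" "x \<in> dom g"
  from sensitive_blocks_mono[OF this]
  show "card {B \<in> sensitive_blocks n g x. card B = 1} \<le> card {B \<in> sensitive_blocks n f x. card B = 1}"
    by (intro card_mono) auto
qed (auto simp: mono_def)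

lemma stable_bs_meas: "stable_measure bs_meas"
  unfolding bs_meas_def[abs_def]
proof (rule stable_Max_local)
  fix n and f g :: bfun and x assume gf: "g \<subseteq>\<^sub>m f" "x \<in> dom g"
  have fin: "finite {card F | F. F \<subseteq> sensitive_blocks n h x \<and> disjoint F}" for h
    by (rule finite_subset[of _ "card ` Pow (sensitive_blocks n h x)"]) auto
  show "Max {card F | F. F \<subseteq> sensitive_blocks n g x \<and> disjoint F}
    \<le> Max {card F | F. F \<subseteq> sensitive_blocks n f x \<and> disjoint F}"
  proof (rule Max_mono[OF _ _ fin])
    have "disjoint ({} :: nat set set)" by (simp add: pairwise_def)
    then show "{card F | F. F \<subseteq> sensitive_blocks n g x \<and> disjoint F} \<noteq> {}" by blast
    show "{card F | F. F \<subseteq> sensitive_blocks n g x \<and> disjoint F}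
      \<subseteq> {card F | F. F \<subseteq> sensitive_blocks n f x \<and> disjoint F}"
      using sensitive_blocks_mono[OF gf, of n] by blast
  qed
qed (auto simp: mono_def)

lemma fbs_at_bneg [simp]: "fbs_at n (bneg f) x = fbs_at n f x"
  by (simp add: fbs_at_def)

lemma fbs_at_mono:
  assumes "g \<subseteq>\<^sub>m f" "x \<in> dom g"
  shows "fbs_at n g x \<le> fbs_at n f x"
proof -
  let ?S = "\<lambda>h. sensitive_blocks n h x"
  let ?ok = "\<lambda>h w. (\<forall>B \<in> ?S h. 0 \<le> w B \<and> w B \<le> 1) \<and>
     (\<forall>i < n. (\<Sum>B | B \<in> ?S h \<and> i \<in> B. w B) \<le> 1)"
  have sub: "?S g \<subseteq> ?S f" by (rule sensitive_blocks_mono[OF assms])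
  show ?thesis
    unfolding fbs_at_def
  proof (rule cSup_subset_mono)
    have "?ok g (\<lambda>_. 0 :: real)" by simp
    then have "(\<Sum>B\<in>?S g. 0 :: real) \<in> {\<Sum>B\<in>?S g. w B | w :: _ \<Rightarrow> real. ?ok g w}"
      by (intro CollectI exI[of _ "\<lambda>_. 0"] conjI refl) blast+
    then show "{\<Sum>B\<in>?S g. w B | w :: _ \<Rightarrow> real. ?ok g w} \<noteq> {}" by blast
    have "(\<Sum>B\<in>?S f. w B) \<le> real (card (?S f))" if "?ok f w" for w :: "_ \<Rightarrow> real"
      using sum_bounded_above[of "?S f" w 1] that by simp
    then show "bdd_above {\<Sum>B\<in>?S f. w B | w :: _ \<Rightarrow> real. ?ok f w}"
      by (intro bdd_aboveI[of _ "real (card (?S f))"]) blast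
    show "{\<Sum>B\<in>?S g. w B | w :: _ \<Rightarrow> real. ?ok g w} \<subseteq> {\<Sum>B\<in>?S f. w B | w :: _ \<Rightarrow> real. ?ok f w}"
    proof
      fix a assume "a \<in> {\<Sum>B\<in>?S g. w B | w :: _ \<Rightarrow> real. ?ok g w}"
      then obtain w :: "_ \<Rightarrow> real" where w: "a = (\<Sum>B\<in>?S g. w B)" "?ok g w" by blast
      \<comment> \<open>Blocks that are sensitive only for \<open>f\<close> receive weight 0, which
        changes none of the sums.\<close>
      define v where "v B = (if B \<in> ?S g then w B else 0)" for B
      have "(\<Sum>B\<in>?S f. v B) = (\<Sum>B\<in>?S g. w B)"
        unfolding v_def using sub by (intro sum.mono_neutral_cong_right) auto
      moreover have "(\<Sum>B | B \<in> ?S f \<and> i \<in> B. v B) = (\<Sum>B | B \<in> ?S g \<and> i \<in> B. w B)" for i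
        unfolding v_def using sub by (intro sum.mono_neutral_cong_right) auto
      moreover have "0 \<le> v B \<and> v B \<le> 1" for B using w(2) by (simp add: v_def)
      ultimately have "a = (\<Sum>B\<in>?S f. v B) \<and> ?ok f v" using w by simp
      then show "a \<in> {\<Sum>B\<in>?S f. w B | w :: _ \<Rightarrow> real. ?ok f w}"
        by (intro CollectI exI[of _ v])
    qed
  qed
qed

lemma stable_fbs_meas: "stable_measure fbs_meas"
  unfolding fbs_meas_def[abs_def]
  by (rule stable_Max_local[where r = "\<lambda>x. x" and L = fbs_at]) (auto simp: mono_def fbs_at_mono)

abbreviation completions :: "nat \<Rightarrow> bfun \<Rightarrow> bfun set" where
  "completions n f \<equiv> {g. dom g = {x. length x = n} \<and> f \<subseteq>\<^sub>m g}"

lemma finite_completions: "finite (completions n f)"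
  using finite_maps_bool[OF finite_bool_lists, of n] by (rule rev_finite_subset) auto

lemma completions_nonempty:
  assumes "boolean_function n f"
  shows "completions n f \<noteq> {}"
proof -
  let ?g = "\<lambda>x. if length x = n then Some (f x = Some True) else None"
  have "dom ?g = {x. length x = n}" by (auto split: if_splits)
  moreover have "f \<subseteq>\<^sub>m ?g"
    using boolean_function_length[OF assms] by (auto simp: map_le_def)
  ultimately show ?thesis by blast
qed

lemma cfbs_meas_eq: "cfbs_meas n f = Min ((\<lambda>g. Max (fbs_at n g ` dom f)) ` completions n f)"
  unfolding cfbs_meas_def by (rule arg_cong[where f = Min]) blast

lemma cfbs_meas_leI:
  assumes f: "boolean_function n f"
    and "\<And>h. h \<in> completions n f \<Longrightarrow>
      \<exists>h' \<in> completions n g. Max (fbs_at n h' ` dom g) \<le> Max (fbs_at n h ` dom f)"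
  shows "cfbs_meas n g \<le> cfbs_meas n f"
proof -
  have "cfbs_meas n f \<in> (\<lambda>h. Max (fbs_at n h ` dom f)) ` completions n f"
    unfolding cfbs_meas_eq using finite_completions completions_nonempty[OF f]
    by (intro Min_in) auto
  then obtain h where h: "h \<in> completions n f" "cfbs_meas n f = Max (fbs_at n h ` dom f)" by blast
  from assms(2)[OF h(1)] obtain h' where h': "h' \<in> completions n g"
    "Max (fbs_at n h' ` dom g) \<le> Max (fbs_at n h ` dom f)" by blast
  have "cfbs_meas n g \<le> Max (fbs_at n h' ` dom g)"
    unfolding cfbs_meas_eq using finite_completions h'(1) by (intro Min_le) auto
  with h'(2) h(2) show ?thesis by simp
qed

text \<open>A completion of \<open>f\<close> also completes every restriction of \<open>f\<close>,
  and the maximum then runs over fewer inputs; negating a completion changes no sensitive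
  block.\<close>

lemma stable_cfbs_meas: "stable_measure cfbs_meas"
proof (rule stable_measureI)
  fix n f assume f: "boolean_function n f"
  show "cfbs_meas n (bneg f) \<le> cfbs_meas n f"
  proof (rule cfbs_meas_leI[OF f])
    fix h assume h: "h \<in> completions n f"
    have "bneg f \<subseteq>\<^sub>m bneg h" using h unfolding map_le_def dom_bneg by (simp add: bneg_def)
    then have "bneg h \<in> completions n (bneg f)" using h by simp
    moreover have "fbs_at n (bneg h) = fbs_at n h" by (simp add: fun_eq_iff)
    ultimately show "\<exists>h' \<in> completions n (bneg f).
        Max (fbs_at n h' ` dom (bneg f)) \<le> Max (fbs_at n h ` dom f)"
      by (intro bexI[of _ "bneg h"]) auto
  qed
  fix g assume g: "boolean_function n g" "g \<subseteq>\<^sub>m f"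
  show "cfbs_meas n g \<le> cfbs_meas n f"
  proof (rule cfbs_meas_leI[OF f])
    fix h assume h: "h \<in> completions n f"
    have "Max (fbs_at n h ` dom g) \<le> Max (fbs_at n h ` dom f)"
      using boolean_function_finite[OF f] g map_le_implies_dom_le[OF g(2)]
      by (intro Max_mono image_mono) (auto simp: boolean_function_def)
    moreover have "h \<in> completions n g" using h g(2) map_le_trans by blast
    ultimately show "\<exists>h' \<in> completions n g.
        Max (fbs_at n h' ` dom g) \<le> Max (fbs_at n h ` dom f)" by blast
  qed
qed

text \<open>A vector on \<open>S'\<close> padded with zeros keeps its norm, and cutting its image
  down to \<open>S'\<close> can only shorten it. The crude bound by the sum of absolute entries
  serves to bound the set whose \<open>Sup\<close> is the larger norm.\<close>

lemma spectral_norm_mono: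
  assumes S: "finite S" "S' \<subseteq> S" and A: "\<And>x y. x \<in> S' \<Longrightarrow> y \<in> S' \<Longrightarrow> A' x y = A x y"
  shows "spectral_norm S' A' \<le> spectral_norm S A"
proof -
  have bound: "L2_set (\<lambda>x. \<Sum>y\<in>S. A x y * v y) S \<le> (\<Sum>x\<in>S. \<Sum>y\<in>S. \<bar>A x y\<bar>)"
    if v: "L2_set v S \<le> 1" for v
  proof -
    have "L2_set (\<lambda>y. \<bar>v y\<bar>) S = L2_set v S" by (simp add: L2_set_def)
    then have "\<bar>v y\<bar> \<le> 1" if "y \<in> S" for y
      using member_le_L2_set[OF S(1) that, of "\<lambda>y. \<bar>v y\<bar>"] v by linarith
    then have "\<bar>\<Sum>y\<in>S. A x y * v y\<bar> \<le> (\<Sum>y\<in>S. \<bar>A x y\<bar>)" for x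
      by (intro order_trans[OF sum_abs sum_mono]) (simp add: abs_mult mult_left_le)
    then show ?thesis
      by (intro order_trans[OF L2_set_le_sum_abs] sum_mono)
  qed
  show ?thesis
    unfolding spectral_norm_def[of S']
  proof (rule cSup_least)
    have "L2_set (\<lambda>_. 0 :: real) S' \<le> 1" by (simp add: L2_set_def)
    then show "{L2_set (\<lambda>x. \<Sum>y\<in>S'. A' x y * v y) S' | v. L2_set v S' \<le> 1} \<noteq> {}" by blast
    fix a assume "a \<in> {L2_set (\<lambda>x. \<Sum>y\<in>S'. A' x y * v y) S' | v. L2_set v S' \<le> 1}"
    then obtain v where v: "L2_set v S' \<le> 1" "a = L2_set (\<lambda>x. \<Sum>y\<in>S'. A' x y * v y) S'" by blast
    define u where "u y = (if y \<in> S' then v y else 0)" for y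
    have "L2_set u S = L2_set v S'"
      unfolding L2_set_def u_def using S
      by (intro arg_cong[where f = sqrt] sum.mono_neutral_cong_right) auto
    then have u: "L2_set u S \<le> 1" using v(1) by simp
    have "(\<Sum>y\<in>S. A x y * u y) = (\<Sum>y\<in>S'. A' x y * v y)" if "x \<in> S'" for x
      unfolding u_def using S A[OF that] by (intro sum.mono_neutral_cong_right) auto
    then have "a = L2_set (\<lambda>x. \<Sum>y\<in>S. A x y * u y) S'"
      unfolding v(2) by (intro L2_set_cong) auto
    also have "\<dots> \<le> L2_set (\<lambda>x. \<Sum>y\<in>S. A x y * u y) S"
      unfolding L2_set_def using S by (intro real_sqrt_le_mono sum_mono2) auto
    also have "\<dots> \<le> spectral_norm S A"
      unfolding spectral_norm_def
    proof (rule cSup_upper)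
      show "bdd_above {L2_set (\<lambda>x. \<Sum>y\<in>S. A x y * v y) S | v. L2_set v S \<le> 1}"
        using bound by (intro bdd_aboveI[of _ "\<Sum>x\<in>S. \<Sum>y\<in>S. \<bar>A x y\<bar>"]) blast
    qed (use u in blast)
    finally show "a \<le> spectral_norm S A" .
  qed
qed

lemma stable_lambda_meas: "stable_measure lambda_meas"
proof (rule stable_measureI)
  fix n f assume f: "boolean_function n f"
  show "lambda_meas n (bneg f) \<le> lambda_meas n f" by (simp add: lambda_meas_def)
  fix g assume g: "boolean_function n g" "g \<subseteq>\<^sub>m f"
  show "lambda_meas n g \<le> lambda_meas n f"
    unfolding lambda_meas_def
    by (rule spectral_norm_mono[OF boolean_function_finite[OF f] map_le_implies_dom_le[OF g(2)]])
      (simp add: map_leD_eq[OF g(2)])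
qed

section \<open>Quantum query complexity\<close>

definition basis_vector :: "qbasis \<Rightarrow> qstate" where
  "basis_vector s = (\<lambda>r. of_bool (r = s))"

definition perm_op :: "(qbasis \<Rightarrow> qbasis) \<Rightarrow> qop" where
  "perm_op \<pi> r s = of_bool (r = \<pi> s)"

lemma finite_basis [simp]: "finite (basis n m)"
  by (simp add: basis_def)

lemma unitary_on_perm_op:
  assumes "finite B" "inj_on \<pi> B" "\<pi> ` B \<subseteq> B"
  shows "unitary_on B (perm_op \<pi>)"
  unfolding unitary_on_def
proof (intro ballI)
  fix r s assume rs: "r \<in> B" "s \<in> B"
  have "(\<Sum>t\<in>B. cnj (perm_op \<pi> t r) * perm_op \<pi> t s)
    = (\<Sum>t\<in>B. if t = \<pi> r then of_bool (\<pi> r = \<pi> s) else 0)"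
    by (intro sum.cong) (auto simp: perm_op_def)
  also have "\<dots> = of_bool (\<pi> r = \<pi> s)" using assms rs by (subst sum.delta) auto
  finally show "(\<Sum>t\<in>B. cnj (perm_op \<pi> t r) * perm_op \<pi> t s) = of_bool (r = s)"
    using assms(2) rs by (simp add: inj_on_eq_iff)
qed

lemma apply_op_perm_op:
  assumes "finite B" "s \<in> B"
  shows "apply_op B (perm_op \<pi>) (basis_vector s) = basis_vector (\<pi> s)"
proof
  fix r
  have "apply_op B (perm_op \<pi>) (basis_vector s) r
    = (\<Sum>t\<in>B. if t = s then of_bool (r = \<pi> s) else 0)"
    unfolding apply_op_def by (intro sum.cong) (auto simp: perm_op_def basis_vector_def)
  then show "apply_op B (perm_op \<pi>) (basis_vector s) r = basis_vector (\<pi> s) r"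
    using assms by (simp add: basis_vector_def)
qed

lemma oracle_call_basis_vector:
  "oracle_call n x (basis_vector (i, b, w)) = basis_vector (i, b \<noteq> (i < n \<and> x ! i), w)"
  by (auto simp: oracle_call_def basis_vector_def fun_eq_iff)

definition write_bit :: "nat \<Rightarrow> bool \<Rightarrow> nat \<Rightarrow> nat" where
  "write_bit i b w = (if b then set_bit i w else unset_bit i w)"

lemma bit_write_bit: "bit (write_bit i b w) j \<longleftrightarrow> (if j = i then b else bit w j)"
  by (auto simp: write_bit_def bit_set_bit_iff bit_unset_bit_iff)

lemma less_power2_iff_bit: "w < 2 ^ k \<longleftrightarrow> (\<forall>j\<ge>k. \<not> bit w j)" for w :: nat
proof -
  have "w < 2 ^ k \<longleftrightarrow> take_bit k w = w" by (simp add: take_bit_nat_eq_self_iff)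
  also have "\<dots> \<longleftrightarrow> (\<forall>j\<ge>k. \<not> bit w j)"
    unfolding bit_eq_iff[of "take_bit k w" w] bit_take_bit_iff
    by (simp, meson not_le)
  finally show ?thesis .
qed

text \<open>
  Swapping the answer bit with the \<open>i\<close>-th workspace bit and moving on to index \<open>i + 1\<close> permutes
  the basis, and after \<open>n\<close> queries the workspace holds the whole input.
\<close>

definition swap_step :: "nat \<Rightarrow> qbasis \<Rightarrow> qbasis" where
  "swap_step n = (\<lambda>(i, b, w). (if i = n then 0 else Suc i, bit w i, write_bit i b w))"

lemma swap_step_basis: "s \<in> basis n (2 ^ Suc n) \<Longrightarrow> swap_step n s \<in> basis n (2 ^ Suc n)"
  unfolding basis_def swap_step_def
  by (auto simp: less_power2_iff_bit bit_write_bit simp del: power_Suc)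

lemma inj_on_swap_step: "inj_on (swap_step n) (basis n m)"
proof (rule inj_onI)
  fix r s assume rs: "r \<in> basis n m" "s \<in> basis n m" "swap_step n r = swap_step n s"
  obtain i b w where r: "r = (i, b, w)" by (metis prod_cases3)
  obtain j c v where s: "s = (j, c, v)" by (metis prod_cases3)
  have ij: "i = j" using rs by (auto simp: r s swap_step_def basis_def split: if_splits)
  have bits: "bit w i = bit v i" "write_bit i b w = write_bit i c v"
    using rs(3) by (simp_all add: r s swap_step_def ij)
  have eq: "(if k = i then b else bit w k) = (if k = i then c else bit v k)" for k
    using bits(2) bit_write_bit by metis
  have "b = c" using eq[of i] by simp
  moreover have "w = v"
  proof (rule bit_eqI)
    fix k show "bit w k = bit v k" using eq[of k] bits(1) by (cases "k = i") auto
  qed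
  ultimately show "r = s" by (simp add: r s ij)
qed

primrec read_bits :: "bool list \<Rightarrow> nat \<Rightarrow> nat" where
  "read_bits x 0 = 0"
| "read_bits x (Suc k) = write_bit k (x ! k) (read_bits x k)"

lemma bit_read_bits: "bit (read_bits x k) j \<longleftrightarrow> j < k \<and> x ! j"
  by (induction k) (auto simp: bit_write_bit less_Suc_eq)

lemma final_state_read_bits:
  assumes "k \<le> n"
  shows "final_state n (2 ^ Suc n) (perm_op (\<lambda>s. s)) (replicate k (perm_op (swap_step n))) x
    = basis_vector (k, False, read_bits x k)"
  using assms
proof (induction k)
  case 0
  have init: "init_state = basis_vector (0, False, 0)"
    by (simp add: init_state_def basis_vector_def fun_eq_iff)
  have "(0, False, 0) \<in> basis n (2 ^ Suc n)" by (simp add: basis_def)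
  from apply_op_perm_op[OF finite_basis this, of "\<lambda>s. s"] show ?case
    by (simp add: final_state_def init del: power_Suc)
next
  case (Suc k)
  let ?B = "basis n (2 ^ Suc n)"
  have "read_bits x k < 2 ^ Suc n"
    using Suc.prems by (auto simp: less_power2_iff_bit bit_read_bits simp del: power_Suc)
  then have mem: "(k, x ! k, read_bits x k) \<in> ?B"
    using Suc.prems by (simp add: basis_def del: power_Suc)
  have "final_state n (2 ^ Suc n) (perm_op (\<lambda>s. s)) (replicate (Suc k) (perm_op (swap_step n))) x
    = apply_op ?B (perm_op (swap_step n)) (oracle_call n x
        (final_state n (2 ^ Suc n) (perm_op (\<lambda>s. s)) (replicate k (perm_op (swap_step n))) x))"
    by (simp add: final_state_def replicate_append_same[symmetric] del: power_Suc replicate.simps)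
  also have "\<dots> = apply_op ?B (perm_op (swap_step n)) (basis_vector (k, x ! k, read_bits x k))"
    using Suc by (simp add: oracle_call_basis_vector del: power_Suc)
  also have "\<dots> = basis_vector (swap_step n (k, x ! k, read_bits x k))"
    using mem by (simp add: apply_op_perm_op del: power_Suc)
  \<comment> \<open>Bit \<open>k\<close> of \<open>read_bits x k\<close> is still 0, so the swap
    returns a clean answer register for the next query.\<close>
  finally show ?case
    using Suc.prems by (simp add: swap_step_def bit_read_bits)
qed

lemma exists_exact_quantum:
  assumes f: "boolean_function n f"
  shows "\<exists>m U0 Us out. quantum_algorithm n n m U0 Us \<and>
    (\<forall>x \<in> dom f. \<forall>v. output_prob n m U0 Us out x v = of_bool (f x = v))"
proof (intro exI conjI ballI allI)
  let ?m = "2 ^ Suc n :: nat"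
  let ?Us = "replicate n (perm_op (swap_step n))"
  define out where "out = (\<lambda>(i :: nat, b :: bool, w :: nat). f (map (bit w) [0..<n]))"
  have "unitary_on (basis n ?m) (perm_op (\<lambda>s. s))"
    by (rule unitary_on_perm_op) auto
  moreover have "unitary_on (basis n ?m) (perm_op (swap_step n))"
    by (intro unitary_on_perm_op inj_on_swap_step finite_basis image_subsetI swap_step_basis)
  ultimately show "quantum_algorithm n n ?m (perm_op (\<lambda>s. s)) ?Us"
    by (simp add: quantum_algorithm_def del: power_Suc)
  fix x v assume x: "x \<in> dom f"
  let ?s = "(n, False, read_bits x n)"
  have len: "length x = n" by (rule boolean_function_length[OF f x])
  have "map (bit (read_bits x n)) [0..<n] = x"
    using len by (intro nth_equalityI) (auto simp: bit_read_bits)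
  then have out: "out ?s = f x" by (simp add: out_def)
  have s: "?s \<in> basis n ?m"
    by (auto simp: basis_def less_power2_iff_bit bit_read_bits simp del: power_Suc)
  have "output_prob n ?m (perm_op (\<lambda>s. s)) ?Us out x v
    = (\<Sum>r | r \<in> basis n ?m \<and> out r = v. if r = ?s then 1 else 0)"
    unfolding output_prob_def final_state_read_bits[OF order_refl]
    by (intro sum.cong) (auto simp: basis_vector_def)
  also have "\<dots> = of_bool (f x = v)" using s out by simp
  finally show "output_prob n ?m (perm_op (\<lambda>s. s)) ?Us out x v = of_bool (f x = v)" .
qed

lemma output_prob_neg:
  "output_prob n m U0 Us (map_option Not \<circ> out) x (map_option Not v) = output_prob n m U0 Us out x v"
proof -
  have "map_option Not a = map_option Not v \<longleftrightarrow> a = v" for a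
    by (cases a; cases v) auto
  then show ?thesis by (simp add: output_prob_def)
qed

text \<open>\<open>ok\<close> abstracts the success condition as a property of the output
  distribution and the correct value. Negation only relabels outcomes and leaves the unitaries
  alone; the exact algorithm with \<open>n\<close> queries satisfies every such condition and makes
  the \<open>LEAST\<close> meaningful.\<close>

lemma stable_quantum_measure:
  fixes ok :: "(bool option \<Rightarrow> real) \<Rightarrow> bool option \<Rightarrow> bool"
  assumes exact: "\<And>b. ok (\<lambda>v. of_bool (Some b = v)) (Some b)"
    and neg: "\<And>P P' b. ok P (Some b) \<Longrightarrow> (\<And>v. P' (map_option Not v) = P v) \<Longrightarrow> ok P' (Some (\<not> b))"
  shows "stable_measure (\<lambda>n f. real (LEAST k. \<exists>m U0 Us out. quantum_algorithm n k m U0 Us \<and>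
     (\<forall>x \<in> dom f. ok (output_prob n m U0 Us out x) (f x))))"
proof (rule stable_measureI)
  fix n f assume f: "boolean_function n f"
  let ?Q = "\<lambda>f k. \<exists>m U0 Us out. quantum_algorithm n k m U0 Us \<and>
     (\<forall>x \<in> dom f. ok (output_prob n m U0 Us out x) (f x))"
  obtain m U0 Us out where A: "quantum_algorithm n n m U0 Us"
    "\<And>x v. x \<in> dom f \<Longrightarrow> output_prob n m U0 Us out x v = of_bool (f x = v)"
    using exists_exact_quantum[OF f] by blast
  have "ok (output_prob n m U0 Us out x) (f x)" if "x \<in> dom f" for x
  proof -
    from that obtain b where b: "f x = Some b" by blast
    have "output_prob n m U0 Us out x = (\<lambda>v. of_bool (Some b = v))"
      using A(2)[OF that] by (simp add: b fun_eq_iff)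
    then show ?thesis using exact by (simp add: b)
  qed
  with A(1) have ex: "\<exists>k. ?Q f k" by blast
  show "real (LEAST k. ?Q (bneg f) k) \<le> real (LEAST k. ?Q f k)"
  proof (rule Least_le_LeastI[OF ex])
    fix k assume "?Q f k"
    then obtain m U0 Us out where A: "quantum_algorithm n k m U0 Us"
      "\<And>x. x \<in> dom f \<Longrightarrow> ok (output_prob n m U0 Us out x) (f x)" by blast
    have "ok (output_prob n m U0 Us (map_option Not \<circ> out) x) (bneg f x)" if "x \<in> dom (bneg f)" for x
    proof -
      have "x \<in> dom f" using that by simp
      moreover from this obtain b where b: "f x = Some b" by blast
      ultimately have "ok (output_prob n m U0 Us out x) (Some b)" using A(2)[of x] by simp
      from neg[OF this output_prob_neg] show ?thesis unfolding bneg_def b option.map .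
    qed
    with A(1) show "\<exists>l\<le>k. ?Q (bneg f) l" by blast
  qed
  fix g :: bfun assume g: "g \<subseteq>\<^sub>m f"
  show "real (LEAST k. ?Q g k) \<le> real (LEAST k. ?Q f k)"
  proof (rule Least_le_LeastI[OF ex])
    fix k assume "?Q f k"
    then obtain m U0 Us out where A: "quantum_algorithm n k m U0 Us"
      "\<And>x. x \<in> dom f \<Longrightarrow> ok (output_prob n m U0 Us out x) (f x)" by blast
    have "ok (output_prob n m U0 Us out x) (g x)" if x: "x \<in> dom g" for x
      using A(2)[OF subsetD[OF map_le_implies_dom_le[OF g] x]] map_leD_eq[OF g x] by simp
    with A(1) show "\<exists>l\<le>k. ?Q g l" by blast
  qed
qed

lemma stable_Q_query: "stable_measure Q_query"
  unfolding Q_query_def[abs_def]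
proof (rule stable_quantum_measure[where ok = "\<lambda>P v. 2 / 3 \<le> P v"])
  fix P P' :: "bool option \<Rightarrow> real" and b
  assume "2 / 3 \<le> P (Some b)" "\<And>v. P' (map_option Not v) = P v"
  from this(1) this(2)[of "Some b"] show "2 / 3 \<le> P' (Some (\<not> b))" by simp
qed simp

lemma stable_QE_query: "stable_measure QE_query"
  unfolding QE_query_def[abs_def]
proof (rule stable_quantum_measure[where ok = "\<lambda>P v. P v = 1"])
  fix P P' :: "bool option \<Rightarrow> real" and b
  assume "P (Some b) = 1" "\<And>v. P' (map_option Not v) = P v"
  from this(1) this(2)[of "Some b"] show "P' (Some (\<not> b)) = 1" by simp
qed simp

lemma stable_Q0_query: "stable_measure Q0_query"
proof -
  have "stable_measure (\<lambda>n f. real (LEAST k. \<exists>m U0 Us out. quantum_algorithm n k m U0 Us \<and>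
     (\<forall>x \<in> dom f. output_prob n m U0 Us out x None \<le> 1 / 2 \<and>
        output_prob n m U0 Us out x (map_option Not (f x)) = 0)))"
  proof (rule stable_quantum_measure[where ok = "\<lambda>P v. P None \<le> 1 / 2 \<and> P (map_option Not v) = 0"])
    fix P P' :: "bool option \<Rightarrow> real" and b
    assume "P None \<le> 1 / 2 \<and> P (map_option Not (Some b)) = 0" "\<And>v. P' (map_option Not v) = P v"
    from this(1) this(2)[of None] this(2)[of "Some (\<not> b)"]
    show "P' None \<le> 1 / 2 \<and> P' (map_option Not (Some (\<not> b))) = 0" by simp
  qed simp
  then show ?thesis by (simp add: Q0_query_def[abs_def] bneg_def)
qed

section \<open>Degree measures\<close>

abbreviation pkeys :: "('a \<Rightarrow>\<^sub>0 'b :: zero) \<Rightarrow> 'a set" where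
  "pkeys \<equiv> Poly_Mapping.keys"

abbreviation coef :: "('a \<Rightarrow>\<^sub>0 'b :: zero) \<Rightarrow> 'a \<Rightarrow> 'b" where
  "coef \<equiv> Poly_Mapping.lookup"

abbreviation mterm :: "'a \<Rightarrow> 'b \<Rightarrow> ('a \<Rightarrow>\<^sub>0 'b :: zero)" where
  "mterm \<equiv> Poly_Mapping.single"

abbreviation meval :: "('v \<Rightarrow>\<^sub>0 nat) \<Rightarrow> ('v \<Rightarrow> real) \<Rightarrow> real" where
  "meval m x \<equiv> \<Prod>i\<in>pkeys m. x i ^ coef m i"

abbreviation mdeg :: "('v \<Rightarrow>\<^sub>0 nat) \<Rightarrow> nat" where
  "mdeg m \<equiv> \<Sum>i\<in>pkeys m. coef m i"

text \<open>Addition may cancel monomials, so polynomials are compared over a common finite set of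
  keys, where missing ones contribute 0.\<close>

lemma peval_superset:
  assumes "finite K" "pkeys P \<subseteq> K"
  shows "peval P x = (\<Sum>m\<in>K. coef P m * meval m x)"
  unfolding peval_def using assms by (intro sum.mono_neutral_left) (auto simp: in_keys_iff)

lemma peval_zero [simp]: "peval 0 x = 0"
  by (simp add: peval_def)

lemma peval_single [simp]: "peval (mterm m c) x = c * meval m x"
  by (subst peval_superset[of "{m}"]) auto

lemma peval_add: "peval (P + Q) x = peval P x + peval Q x"
proof -
  let ?K = "pkeys P \<union> pkeys Q"
  have "peval R x = (\<Sum>m\<in>?K. coef R m * meval m x)"
    if "pkeys R \<subseteq> ?K" for R
    using that by (intro peval_superset) auto
  then show ?thesis
    using keys_add[of P Q] by (simp add: lookup_add distrib_right sum.distrib)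
qed

lemma peval_diff: "peval (P - Q) x = peval P x - peval Q x"
  using peval_add[of "P - Q" Q x] by simp

lemma peval_sum: "peval (\<Sum>i\<in>I. P i) x = (\<Sum>i\<in>I. peval (P i) x)"
  by (induction I rule: infinite_finite_induct) (auto simp: peval_add)

lemma keys_sum_single:
  "pkeys (\<Sum>i\<in>I. mterm (mm i) (c i)) \<subseteq> mm ` I"
  by (rule order_trans[OF keys_sum]) auto

lemma total_degree_le_iff: "total_degree P \<le> d \<longleftrightarrow> (\<forall>m \<in> pkeys P. mdeg m \<le> d)"
  unfolding total_degree_def by (subst Max_le_iff) auto

lemma keys_diff_subset:
  "pkeys (P - Q) \<subseteq> pkeys P \<union> pkeys (Q :: 'v rpoly)"
  by (rule keys_diff)

lemma total_degree_diff: "total_degree (P - Q) \<le> max (total_degree P) (total_degree Q)"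
  unfolding total_degree_le_iff using keys_diff_subset[of P Q]
    total_degree_le_iff[of P "total_degree P"] total_degree_le_iff[of Q "total_degree Q"]
  by (fastforce simp: le_max_iff_disj)

lemma poly_in_diff: "poly_in V P \<Longrightarrow> poly_in V Q \<Longrightarrow> poly_in V (P - Q)"
  unfolding poly_in_def using keys_diff_subset[of P Q] by blast

lemma multilinear_diff: "multilinear P \<Longrightarrow> multilinear Q \<Longrightarrow> multilinear (P - Q)"
  unfolding multilinear_def using keys_diff_subset[of P Q] by blast

lemma peval_one [simp]: "peval 1 x = 1"
  by (simp add: peval_def)

lemma total_degree_one [simp]: "total_degree 1 = 0"
  by (simp add: total_degree_def)

lemma poly_in_one [simp]: "poly_in V 1"
  by (simp add: poly_in_def)

lemma multilinear_one [simp]: "multilinear 1"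
  by (simp add: multilinear_def)

definition vmono :: "'v set \<Rightarrow> ('v \<Rightarrow>\<^sub>0 nat)" where
  "vmono V = (\<Sum>v\<in>V. mterm v 1)"

lemma lookup_vmono: "finite V \<Longrightarrow> coef (vmono V) v = of_bool (v \<in> V)"
  by (simp add: vmono_def lookup_sum lookup_single when_def)

lemma keys_vmono: "finite V \<Longrightarrow> pkeys (vmono V) = V"
  by (auto simp: in_keys_iff lookup_vmono)

lemma meval_vmono: "finite V \<Longrightarrow> meval (vmono V) x = (\<Prod>v\<in>V. x v)"
  by (simp add: keys_vmono lookup_vmono)

lemma mdeg_vmono: "finite V \<Longrightarrow> mdeg (vmono V) = card V"
  by (simp add: keys_vmono lookup_vmono)

text \<open>Moebius inversion on the subset lattice, by induction on the ground set: coefficients of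
  sets containing the new element \<open>a\<close> come from the difference of \<open>h\<close> with
  and without \<open>a\<close>.\<close>

lemma exists_subset_sum_coefficients:
  fixes h :: "'a set \<Rightarrow> real"
  assumes "finite A"
  shows "\<exists>c. \<forall>T\<subseteq>A. h T = (\<Sum>S\<in>Pow T. c S)"
  using assms
proof (induction A arbitrary: h)
  case empty
  then show ?case by (intro exI[of _ h]) simp
next
  case (insert a A)
  obtain c0 where c0: "\<And>T. T \<subseteq> A \<Longrightarrow> h T = (\<Sum>S\<in>Pow T. c0 S)" using insert.IH by blast
  obtain c1 where c1: "\<And>T. T \<subseteq> A \<Longrightarrow> h (insert a T) = (\<Sum>S\<in>Pow T. c1 S)"
    using insert.IH[of "\<lambda>T. h (insert a T)"] by blast
  define c where "c S = (if a \<in> S then c1 (S - {a}) - c0 (S - {a}) else c0 S)" for S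
  have low: "(\<Sum>S\<in>Pow T. c S) = (\<Sum>S\<in>Pow T. c0 S)" if "T \<subseteq> A" for T
    using that insert.hyps by (intro sum.cong) (auto simp: c_def)
  have "h T = (\<Sum>S\<in>Pow T. c S)" if T: "T \<subseteq> insert a A" for T
  proof (cases "a \<in> T")
    case False
    with T have "T \<subseteq> A" by blast
    with low c0 show ?thesis by simp
  next
    case True
    define U where "U = T - {a}"
    have U: "T = insert a U" "a \<notin> U" "U \<subseteq> A" using T True by (auto simp: U_def)
    have finU: "finite U" using U(3) insert.hyps finite_subset by blast
    have "(\<Sum>S\<in>Pow T. c S) = (\<Sum>S\<in>Pow U. c S) + (\<Sum>S\<in>insert a ` Pow U. c S)"
      unfolding U(1) Pow_insert using U(2) finU by (intro sum.union_disjoint) auto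
    also have "(\<Sum>S\<in>insert a ` Pow U. c S) = (\<Sum>S\<in>Pow U. c (insert a S))"
      using U(2) by (subst sum.reindex) (auto simp: inj_on_def)
    also have "\<dots> = (\<Sum>S\<in>Pow U. c1 S - c0 S)"
    proof (intro sum.cong refl)
      fix S assume "S \<in> Pow U"
      then have "a \<notin> S" using U(2) by blast
      then show "c (insert a S) = c1 S - c0 S" by (simp add: c_def)
    qed
    finally show ?thesis using low[OF U(3)] c1[OF U(3)] U(1) by (simp add: sum_subtractf)
  qed
  then show ?case by blast
qed

text \<open>At a 0/1 point with support \<open>T\<close> the squarefree monomial on \<open>S\<close>
  is the indicator of \<open>S \<subseteq> T\<close>, so evaluation is a sum over subsets of
  \<open>T\<close> and Moebius inversion supplies the coefficients.\<close>

lemma exists_interpolation_poly: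
  fixes h :: "bool list \<Rightarrow> real"
  shows "\<exists>P. poly_in {..<n} P \<and> multilinear P \<and> (\<forall>x. length x = n \<longrightarrow> peval P (point x) = h x)"
proof -
  obtain c where c: "\<And>T. T \<subseteq> {..<n} \<Longrightarrow> h (map (\<lambda>i. i \<in> T) [0..<n]) = (\<Sum>S\<in>Pow T. c S)"
    using exists_subset_sum_coefficients[of "{..<n}" "\<lambda>T. h (map (\<lambda>i. i \<in> T) [0..<n])"] by blast
  define P where "P = (\<Sum>S\<in>Pow {..<n}. mterm (vmono S) (c S))"
  have keys: "pkeys P \<subseteq> vmono ` Pow {..<n}"
    unfolding P_def by (rule keys_sum_single)
  have fin: "finite S" if "S \<subseteq> {..<n}" for S using that finite_subset by blast
  have "peval P (point x) = h x" if x: "length x = n" for x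
  proof -
    define T where "T = {i. i < n \<and> x ! i}"
    have T: "T \<subseteq> {..<n}" "map (\<lambda>i. i \<in> T) [0..<n] = x"
      using x by (auto simp: T_def intro: nth_equalityI)
    have "(\<Prod>v\<in>S. point x v) = of_bool (S \<subseteq> T)" if S: "S \<subseteq> {..<n}" for S
    proof (cases "S \<subseteq> T")
      case True
      then have "(\<Prod>v\<in>S. point x v) = (\<Prod>v\<in>S. 1)"
        by (intro prod.cong refl) (auto simp: point_def T_def)
      with True show ?thesis by simp
    next
      case False
      then show ?thesis using fin[OF S] S by (auto simp: point_def T_def prod_zero_iff)
    qed
    then have "peval P (point x) = (\<Sum>S\<in>Pow {..<n}. c S * of_bool (S \<subseteq> T))"
      unfolding P_def peval_sum by (intro sum.cong refl) (simp add: meval_vmono fin)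
    also have "\<dots> = (\<Sum>S\<in>Pow T. c S)"
      using T(1) by (intro sum.mono_neutral_cong_right) auto
    finally show ?thesis using c[OF T(1)] T(2) by simp
  qed
  moreover have "pkeys m \<subseteq> {..<n}" "coef m i \<le> 1"
    if m: "m \<in> pkeys P" for m i
  proof -
    obtain S where "S \<subseteq> {..<n}" "m = vmono S" using keys m by blast
    then show "pkeys m \<subseteq> {..<n}" "coef m i \<le> 1"
      using fin[of S] by (simp_all add: keys_vmono lookup_vmono)
  qed
  then have "poly_in {..<n} P" "multilinear P" by (simp_all add: poly_in_def multilinear_def)
  ultimately show ?thesis by blast
qed

lemma bvalue_bneg: "x \<in> dom f \<Longrightarrow> bvalue (bneg f) x = 1 - bvalue f x"
  by (auto simp: bvalue_def)

lemma bvalue_map_le: "g \<subseteq>\<^sub>m f \<Longrightarrow> x \<in> dom g \<Longrightarrow> bvalue g x = bvalue f x"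
  by (simp add: bvalue_def map_leD_eq)

text \<open>Negation is realized by \<open>1 - P\<close>, which stays in \<open>[0, 1]\<close>; the
  range \<open>[-1, 1]\<close> of the block-multilinear measure lacks this symmetry.\<close>

lemma stable_approx_degree:
  assumes \<epsilon>: "0 \<le> \<epsilon>"
  shows "stable_measure (approx_degree \<epsilon>)"
proof (rule stable_measureI)
  fix n f assume f: "boolean_function n f"
  let ?ok = "\<lambda>f P. poly_in {..<n} P \<and> multilinear P \<and>
     (\<forall>x. length x = n \<longrightarrow> peval P (point x) \<in> {0..1}) \<and>
     (\<forall>x \<in> dom f. \<bar>peval P (point x) - bvalue f x\<bar> \<le> \<epsilon>)"
  obtain P where P: "poly_in {..<n} P" "multilinear P"
    "\<And>x. length x = n \<Longrightarrow> peval P (point x) = bvalue f x"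
    using exists_interpolation_poly by blast
  have "?ok f P"
    using P \<epsilon> boolean_function_length[OF f] by (auto simp: bvalue_def)
  then have ex: "\<exists>d P. total_degree P = d \<and> ?ok f P" by blast
  show "approx_degree \<epsilon> n (bneg f) \<le> approx_degree \<epsilon> n f"
    unfolding approx_degree_def
  proof (rule Least_le_LeastI[OF ex])
    fix d assume "\<exists>P. total_degree P = d \<and> ?ok f P"
    then obtain P where P: "total_degree P = d" "?ok f P" by blast
    let ?P = "1 - P"
    have ev: "peval ?P x = 1 - peval P x" for x by (simp add: peval_diff)
    have "\<bar>1 - peval P (point x) - bvalue (bneg f) x\<bar> \<le> \<epsilon>" if "x \<in> dom f" for x
    proof -
      have "\<bar>peval P (point x) - bvalue f x\<bar> \<le> \<epsilon>" using P(2) that by blast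
      then show ?thesis unfolding bvalue_bneg[OF that] by linarith
    qed
    then have "?ok (bneg f) ?P"
      using P(2) by (auto simp: ev poly_in_diff multilinear_diff)
    moreover have "total_degree ?P \<le> d"
      using total_degree_diff[of "1" P] P(1) by simp
    ultimately show "\<exists>l\<le>d. \<exists>P. total_degree P = l \<and> ?ok (bneg f) P" by blast
  qed
  fix g :: bfun assume g: "g \<subseteq>\<^sub>m f"
  show "approx_degree \<epsilon> n g \<le> approx_degree \<epsilon> n f"
    unfolding approx_degree_def
  proof (rule Least_le_LeastI[OF ex])
    fix d assume "\<exists>P. total_degree P = d \<and> ?ok f P"
    then obtain P where P: "total_degree P = d" "?ok f P" by blast
    have "\<bar>peval P (point x) - bvalue g x\<bar> \<le> \<epsilon>" if x: "x \<in> dom g" for x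
      using P(2) subsetD[OF map_le_implies_dom_le[OF g] x] bvalue_map_le[OF g x] by simp
    with P(2) have "?ok g P" by simp
    with P(1) show "\<exists>l\<le>d. \<exists>P. total_degree P = l \<and> ?ok g P" by blast
  qed
qed

text \<open>Since \<open>1 - P / Q = (Q - P) / Q\<close>, negation keeps the denominator and does
  not raise the maximum of the degrees.\<close>

lemma stable_rdeg_meas: "stable_measure rdeg_meas"
proof (rule stable_measureI)
  fix n f assume f: "boolean_function n f"
  let ?ok = "\<lambda>f P Q. poly_in {..<n} P \<and> poly_in {..<n} Q \<and>
     (\<forall>x \<in> dom f. peval Q (point x) \<noteq> 0 \<and> peval P (point x) / peval Q (point x) = bvalue f x)"
  obtain P where P: "poly_in {..<n} P"
    "\<And>x. length x = n \<Longrightarrow> peval P (point x) = bvalue f x"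
    using exists_interpolation_poly by blast
  have "?ok f P (1)"
    using P boolean_function_length[OF f] by simp
  then have ex: "\<exists>d P Q. max (total_degree P) (total_degree Q) = d \<and> ?ok f P Q" by blast
  show "rdeg_meas n (bneg f) \<le> rdeg_meas n f"
    unfolding rdeg_meas_def
  proof (rule Least_le_LeastI[OF ex])
    fix d assume "\<exists>P Q. max (total_degree P) (total_degree Q) = d \<and> ?ok f P Q"
    then obtain P Q where P: "max (total_degree P) (total_degree Q) = d" "?ok f P Q" by blast
    have "peval (Q - P) (point x) / peval Q (point x) = bvalue (bneg f) x" if "x \<in> dom f" for x
    proof -
      have "peval Q (point x) \<noteq> 0" "peval P (point x) / peval Q (point x) = bvalue f x"
        using P(2) that by blast+
      then show ?thesis unfolding bvalue_bneg[OF that] by (simp add: peval_diff diff_divide_distrib)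
    qed
    then have "?ok (bneg f) (Q - P) Q"
      using P(2) poly_in_diff[of "{..<n}" Q P] by simp
    moreover have "max (total_degree (Q - P)) (total_degree Q) \<le> d"
      using total_degree_diff[of Q P] P(1) by linarith
    ultimately show "\<exists>l\<le>d. \<exists>P Q. max (total_degree P) (total_degree Q) = l \<and> ?ok (bneg f) P Q"
      by blast
  qed
  fix g :: bfun assume g: "g \<subseteq>\<^sub>m f"
  show "rdeg_meas n g \<le> rdeg_meas n f"
    unfolding rdeg_meas_def
  proof (rule Least_le_LeastI[OF ex])
    fix d assume "\<exists>P Q. max (total_degree P) (total_degree Q) = d \<and> ?ok f P Q"
    then obtain P Q where P: "max (total_degree P) (total_degree Q) = d" "?ok f P Q" by blast
    have "peval Q (point x) \<noteq> 0 \<and> peval P (point x) / peval Q (point x) = bvalue g x"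
      if x: "x \<in> dom g" for x
      using P(2) subsetD[OF map_le_implies_dom_le[OF g] x] bvalue_map_le[OF g x] by simp
    with P(2) have "?ok g P Q" by blast
    with P(1) show "\<exists>l\<le>d. \<exists>P Q. max (total_degree P) (total_degree Q) = l \<and> ?ok g P Q" by blast
  qed
qed

lemma mdeg_le_1_cases:
  assumes "mdeg m \<le> 1"
  obtains "pkeys m = {}"
  | i where "pkeys m = {i}" "coef m i = 1"
proof (cases "pkeys m = {}")
  case False
  then obtain i where i: "i \<in> pkeys m" by blast
  have pos: "1 \<le> coef m j" if "j \<in> pkeys m" for j
    using that by (simp add: in_keys_iff Suc_le_eq)
  have split: "mdeg m = coef m i + (\<Sum>j\<in>pkeys m - {i}. coef m j)"
    using i by (simp add: sum.remove)
  then have "coef m i = 1" "(\<Sum>j\<in>pkeys m - {i}. coef m j) = 0"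
    using assms pos[OF i] by linarith+
  moreover from this(2) have "pkeys m = {i}"
    using i pos by (fastforce simp: sum_eq_0_iff)
  ultimately show ?thesis using that(2) by blast
qed (use that(1) in blast)

definition or2 :: bfun where
  "or2 = (\<lambda>x. if length x = 2 then Some (x ! 0 \<or> x ! 1) else None)"

text \<open>On two bits the sum of the variables vanishes only at the all-False point, so OR has
  nondeterministic degree at most 1. An affine polynomial has equal sums over the two diagonals of
  the square, so one that vanishes at three corners also vanishes at the fourth.\<close>

lemma not_easier_ndeg_meas: "\<not> certification_easier ndeg_meas"
proof
  let ?g = "cert_fun or2 [False, False]"
  assume "certification_easier ndeg_meas"
  moreover have "boolean_function 2 or2" "[False, False] \<in> dom or2"
    by (auto simp: boolean_function_def or2_def dom_def intro: exI[of _ "[False, False]"])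
  ultimately have le: "ndeg_meas 2 ?g \<le> ndeg_meas 2 or2"
    unfolding certification_easier_iff by blast
  have two: "length x = 2 \<longleftrightarrow> (\<exists>a b. x = [a, b])" for x :: "bool list"
    by (auto simp: numeral_2_eq_2 length_Suc_conv)
  have fib: "fiber or2 False = {[False, False]}"
    "fiber or2 True = {[True, False], [False, True], [True, True]}"
    by (auto simp: fiber_def or2_def two)
  have fibg: "fiber ?g True = {[False, False]}"
    "fiber ?g False = {[True, False], [False, True], [True, True]}"
    by (auto simp: fiber_def or2_def cert_fun_def two dom_def split: if_splits)
  have fin: "finite {i}" for i :: nat by simp
  define X :: "nat \<Rightarrow> nat rpoly" where "X i = mterm (vmono {i}) 1" for i
  have X: "peval (X i) x = x i" for i x by (simp add: X_def meval_vmono)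
  have "pkeys (X 0 + X 1) \<subseteq> {vmono {0}, vmono {1}}"
    by (rule order_trans[OF keys_add]) (auto simp: X_def)
  then have keysX: "mdeg m \<le> 1 \<and> pkeys m \<subseteq> {..<2}"
    if "m \<in> pkeys (X 0 + X 1)" for m
    using that by (auto simp: keys_vmono lookup_vmono)
  have "ndeg_meas 2 or2 \<le> 1"
  proof -
    have "total_degree (X 0 + X 1) \<le> 1"
      unfolding total_degree_le_iff using keysX by blast
    moreover have "poly_in {..<2} (X 0 + X 1)"
      unfolding poly_in_def using keysX by blast
    moreover have "\<forall>x \<in> fiber or2 False. peval (X 0 + X 1) (point x) = 0"
      "\<forall>x \<in> fiber or2 True. peval (X 0 + X 1) (point x) \<noteq> 0"
      by (auto simp: fib peval_add X point_def)
    ultimately have "(LEAST d. \<exists>P. total_degree P = d \<and> poly_in {..<2} P \<and>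
       (\<forall>x \<in> fiber or2 False. peval P (point x) = 0) \<and>
       (\<forall>x \<in> fiber or2 True. peval P (point x) \<noteq> 0)) \<le> 1"
      by (intro order_trans[OF Least_le]) blast+
    then show ?thesis by (simp add: ndeg_meas_def)
  qed
  with le have le1: "ndeg_meas 2 ?g \<le> 1" by simp
  let ?ok = "\<lambda>d. \<exists>P. total_degree P = d \<and> poly_in {..<2} P \<and>
       (\<forall>x \<in> fiber ?g False. peval P (point x) = 0) \<and>
       (\<forall>x \<in> fiber ?g True. peval P (point x) \<noteq> 0)"
  obtain P0 :: "nat rpoly" where P0: "poly_in {..<2} P0"
    "\<And>x. length x = 2 \<Longrightarrow> peval P0 (point x) = of_bool (x = [False, False])"
    \<comment> \<open>Some polynomial must exist for the \<open>LEAST\<close> to be attained; its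
      degree is irrelevant to the contradiction.\<close>
    using exists_interpolation_poly[of 2 "\<lambda>x. of_bool (x = [False, False])"] by blast
  then have "?ok (total_degree P0)" by (intro exI[of _ P0]) (auto simp: fibg)
  then have "?ok (LEAST d. ?ok d)" by (rule LeastI)
  then obtain P where P: "total_degree P = (LEAST d. ?ok d)" "poly_in {..<2} P"
    "\<forall>x \<in> fiber ?g False. peval P (point x) = 0" "\<forall>x \<in> fiber ?g True. peval P (point x) \<noteq> 0"
    by blast
  have deg: "total_degree P \<le> 1" using le1 unfolding ndeg_meas_def P(1)[symmetric] by simp
  have mono: "meval m (point [False, False]) + meval m (point [True, True])
    = meval m (point [True, False]) + meval m (point [False, True])" if m: "m \<in> pkeys P" for m
  proof -
    have "mdeg m \<le> 1" using deg m unfolding total_degree_le_iff by blast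
    then show ?thesis
    proof (cases rule: mdeg_le_1_cases)
      case (2 i)
      have "pkeys m \<subseteq> {..<2}" using P(2) m unfolding poly_in_def by blast
      then have "i = 0 \<or> i = 1" unfolding 2(1) by auto
      then show ?thesis by (elim disjE) (simp_all add: 2 point_def)
    qed simp
  qed
  have "peval P (point [False, False]) + peval P (point [True, True])
    = peval P (point [True, False]) + peval P (point [False, True])"
    unfolding peval_def sum.distrib[symmetric] distrib_left[symmetric] using mono by simp
  with P(3,4) show False by (simp add: fibg)
qed

section \<open>Block-multilinear degree\<close>

abbreviation block_vars :: "nat \<Rightarrow> (nat \<Rightarrow> nat) \<Rightarrow> (nat \<times> nat) set" where
  "block_vars d \<sigma> \<equiv> (\<lambda>k. (k, \<sigma> k)) ` {..<d}"

definition block_poly :: "nat \<Rightarrow> 'i set \<Rightarrow> ('i \<Rightarrow> nat \<Rightarrow> nat) \<Rightarrow> ('i \<Rightarrow> real) \<Rightarrow> (nat \<times> nat) rpoly" where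
  "block_poly d I \<sigma> c = (\<Sum>i\<in>I. mterm (vmono (block_vars d (\<sigma> i))) (c i))"

lemma prod_block_vars: "(\<Prod>v\<in>block_vars d \<sigma>. x v) = (\<Prod>k<d. x (k, \<sigma> k))"
  by (subst prod.reindex) (auto simp: inj_on_def)

lemma peval_block_poly: "peval (block_poly d I \<sigma> c) x = (\<Sum>i\<in>I. c i * (\<Prod>k<d. x (k, \<sigma> i k)))"
  unfolding block_poly_def peval_sum peval_single
  by (intro sum.cong refl) (subst meval_vmono, simp, subst prod_block_vars, simp)

lemma block_multilinear_block_poly:
  assumes "\<And>i k. i \<in> I \<Longrightarrow> k < d \<Longrightarrow> \<sigma> i k \<le> n"
  shows "block_multilinear d n (block_poly d I \<sigma> c)"
proof -
  have "pkeys m \<subseteq> {..<d} \<times> {..n} \<and> (\<forall>k<d. (\<Sum>i\<le>n. coef m (k, i)) = 1)"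
    if "m \<in> pkeys (block_poly d I \<sigma> c)" for m
  proof -
    from that have "m \<in> (\<lambda>i. vmono (block_vars d (\<sigma> i))) ` I"
      unfolding block_poly_def by (rule subsetD[OF keys_sum_single])
    then obtain i where i: "i \<in> I" "m = vmono (block_vars d (\<sigma> i))" by blast
    have "(\<Sum>j\<le>n. coef m (k, j)) = 1" if "k < d" for k
    proof -
      have "(\<Sum>j\<le>n. coef m (k, j)) = (\<Sum>j\<le>n. if j = \<sigma> i k then 1 else 0)"
        unfolding i(2) using that by (intro sum.cong refl) (auto simp: lookup_vmono)
      then show ?thesis using assms[OF i(1) that] by simp
    qed
    moreover have "pkeys m \<subseteq> {..<d} \<times> {..n}"
      unfolding i(2) using assms[OF i(1)] by (auto simp: keys_vmono)
    ultimately show ?thesis by blast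
  qed
  then show ?thesis unfolding block_multilinear_def poly_in_def by blast
qed

text \<open>Natural-number exponents with sum 1 in a block consist of one 1 and zeros, so the
  monomial amounts to a choice function over the blocks.\<close>

lemma block_multilinear_monomial:
  assumes P: "block_multilinear d n P" and m: "m \<in> pkeys P"
  obtains \<sigma> where "\<And>k. k < d \<Longrightarrow> \<sigma> k \<le> n" "m = vmono (block_vars d \<sigma>)"
proof -
  have sub: "pkeys m \<subseteq> {..<d} \<times> {..n}"
    and one: "\<And>k. k < d \<Longrightarrow> (\<Sum>i\<le>n. coef m (k, i)) = 1"
    using P m by (auto simp: block_multilinear_def poly_in_def)
  have "\<exists>i\<le>n. coef m (k, i) = 1 \<and> (\<forall>j\<le>n. j \<noteq> i \<longrightarrow> coef m (k, j) = 0)"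
    if "k < d" for k
    using one[OF that] sum_eq_1_iff[of "{..n}" "\<lambda>i. coef m (k, i)"] by auto
  then obtain \<sigma> where \<sigma>: "\<And>k. k < d \<Longrightarrow> \<sigma> k \<le> n"
    "\<And>k. k < d \<Longrightarrow> coef m (k, \<sigma> k) = 1"
    "\<And>k j. k < d \<Longrightarrow> j \<le> n \<Longrightarrow> j \<noteq> \<sigma> k \<Longrightarrow> coef m (k, j) = 0" by metis
  have "m = vmono (block_vars d \<sigma>)"
  proof (rule poly_mapping_eqI)
    fix v :: "nat \<times> nat"
    obtain k i where v: "v = (k, i)" by fastforce
    show "coef m v = coef (vmono (block_vars d \<sigma>)) v"
    proof (cases "k < d \<and> i \<le> n")
      case True
      then show ?thesis using \<sigma>(2,3)[of k] by (cases "i = \<sigma> k") (auto simp: v lookup_vmono)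
    next
      case False
      then have "(k, i) \<notin> pkeys m" using sub by blast
      then show ?thesis using False \<sigma>(1) by (auto simp: v lookup_vmono in_keys_iff)
    qed
  qed
  with \<sigma>(1) that show thesis by blast
qed

text \<open>Every monomial takes exactly one variable from each block, so the polynomial is
  homogeneous. The zero polynomial is excluded because its degree is 0 by convention, whatever
  \<open>d\<close> is.\<close>

lemma total_degree_block_multilinear:
  assumes P: "block_multilinear d n P" and "P \<noteq> 0"
  shows "total_degree P = d"
proof -
  have "mdeg m = d" if "m \<in> pkeys P" for m
  proof -
    obtain \<sigma> where "m = vmono (block_vars d \<sigma>)" using block_multilinear_monomial[OF P \<open>m \<in> _\<close>] by blast
    then have "mdeg m = card (block_vars d \<sigma>)" by (simp only: mdeg_vmono finite_imageI finite_lessThan)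
    also have "\<dots> = d" by (subst card_image) (auto simp: inj_on_def)
    finally show ?thesis .
  qed
  then have "mdeg ` pkeys P = (\<lambda>_. d) ` pkeys P" by (intro image_cong) auto
  also have "\<dots> = {d}" using \<open>P \<noteq> 0\<close> by (simp add: image_constant_conv)
  finally show ?thesis by (simp add: total_degree_def)
qed

definition bm_witness :: "real \<Rightarrow> nat \<Rightarrow> bfun \<Rightarrow> nat \<Rightarrow> (nat \<times> nat) rpoly \<Rightarrow> bool" where
  "bm_witness \<epsilon> n f d P \<longleftrightarrow> block_multilinear d n P \<and>
     (\<forall>x \<in> dom f. 0 \<le> peval P (blocks_point x) \<and> peval P (blocks_point x) \<le> 1 \<and>
                  \<bar>peval P (blocks_point x) - bvalue f x\<bar> \<le> \<epsilon>) \<and>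
     (\<forall>z. (\<forall>v \<in> {..<d} \<times> {..n}. z v \<in> {-1, 1}) \<longrightarrow> \<bar>peval P z\<bar> \<le> 1)"

lemma bm_degree_eq: "bm_degree \<epsilon> n f = real (LEAST d. \<exists>P. total_degree P = d \<and> bm_witness \<epsilon> n f d P)"
  by (simp add: bm_degree_def bm_witness_def)

lemma bm_degree_le:
  assumes "bm_witness \<epsilon> n f d P" "P \<noteq> 0"
  shows "bm_degree \<epsilon> n f \<le> real d"
proof -
  have "total_degree P = d"
    using assms total_degree_block_multilinear by (auto simp: bm_witness_def)
  with assms(1) show ?thesis unfolding bm_degree_eq of_nat_le_iff by (intro Least_le) blast
qed

lemma bm_degree_attained:
  assumes "bm_witness \<epsilon> n f d P" "P \<noteq> 0"
  obtains P' d' where "bm_degree \<epsilon> n f = real d'" "bm_witness \<epsilon> n f d' P'"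
proof -
  let ?Q = "\<lambda>d. \<exists>P. total_degree P = d \<and> bm_witness \<epsilon> n f d P"
  have "total_degree P = d"
    using assms total_degree_block_multilinear by (auto simp: bm_witness_def)
  with assms(1) have "?Q d" by blast
  then have "?Q (LEAST d. ?Q d)" by (rule LeastI)
  with that bm_degree_eq show thesis by blast
qed

text \<open>With no blocks the empty product is the only monomial, and the constant
  \<open>1 / 2\<close> is within \<open>\<epsilon>\<close> of both values. This is where the
  threshold \<open>1 / 2\<close> becomes sharp.\<close>

lemma bm_degree_0:
  assumes "1 / 2 \<le> \<epsilon>"
  shows "bm_degree \<epsilon> n f = 0"
proof -
  define P where "P = block_poly 0 {()} (\<lambda>_ _. 0) (\<lambda>_. 1 / 2)"
  have ev: "peval P x = 1 / 2" for x by (simp add: P_def peval_block_poly)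
  have "block_multilinear 0 n P" unfolding P_def by (rule block_multilinear_block_poly) simp
  moreover have "\<bar>1 / 2 - bvalue f x\<bar> \<le> \<epsilon>" for x using assms by (simp add: bvalue_def)
  ultimately have "bm_witness \<epsilon> n f 0 P" by (simp add: bm_witness_def ev)
  moreover have "P \<noteq> 0" using ev[of "\<lambda>_. 0"] by auto
  ultimately have "bm_degree \<epsilon> n f \<le> real 0" by (rule bm_degree_le)
  then show ?thesis by (simp add: bm_degree_eq)
qed

lemma certification_easier_bm_degree:
  "1 / 2 \<le> \<epsilon> \<Longrightarrow> certification_easier (bm_degree \<epsilon>)"
  by (simp add: certification_easier_iff bm_degree_0)

text \<open>The product of all \<open>(x\<^sub>k\<^sub>,\<^sub>0 - x\<^sub>k\<^sub>,\<^sub>k\<^sub>+\<^sub>1) / 2\<close> recognizes the all-False input.\<close>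

lemma exists_bm_witness_all_False:
  assumes \<epsilon>: "0 \<le> \<epsilon>" and f: "boolean_function n f"
    and val: "\<And>x. x \<in> dom f \<Longrightarrow> f x = Some (x = replicate n False)"
    and z: "replicate n False \<in> dom f"
  shows "\<exists>P. bm_witness \<epsilon> n f n P \<and> P \<noteq> 0"
proof -
  \<comment> \<open>\<open>S\<close> collects the blocks that contribute their constant coordinate
    when the product is expanded.\<close>
  define \<sigma> where "\<sigma> S k = (if k \<in> S then 0 else Suc k)" for S :: "nat set" and k
  define P where "P = block_poly n (Pow {..<n}) \<sigma> (\<lambda>S. (1 / 2) ^ n * (-1) ^ card ({..<n} - S))"
  have ev: "peval P x = (\<Prod>k<n. (x (k, 0) - x (k, Suc k)) / 2)" for x
  proof -
    have "(\<Prod>k<n. (x (k, 0) - x (k, Suc k)) / 2) = (1 / 2) ^ n * (\<Prod>k<n. x (k, 0) + - x (k, Suc k))"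
      by (simp add: prod_dividef power_divide)
    also have "\<dots> = (\<Sum>S\<in>Pow {..<n}. (1 / 2) ^ n * ((\<Prod>k\<in>S. x (k, 0)) * (\<Prod>k\<in>{..<n} - S. - x (k, Suc k))))"
      by (subst prod_add) (simp_all add: sum_distrib_left)
    also have "\<dots> = peval P x"
      unfolding P_def peval_block_poly
    proof (intro sum.cong refl)
      fix S assume S: "S \<in> Pow {..<n}"
      have "(\<Prod>k<n. x (k, \<sigma> S k)) = (\<Prod>k\<in>{..<n} - S. x (k, \<sigma> S k)) * (\<Prod>k\<in>S. x (k, \<sigma> S k))"
        using S by (intro prod.subset_diff) auto
      also have "\<dots> = (\<Prod>k\<in>{..<n} - S. x (k, Suc k)) * (\<Prod>k\<in>S. x (k, 0))"
        by (intro arg_cong2[where f = times] prod.cong) (auto simp: \<sigma>_def)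
      finally show "(1 / 2) ^ n * ((\<Prod>k\<in>S. x (k, 0)) * (\<Prod>k\<in>{..<n} - S. - x (k, Suc k)))
        = (1 / 2) ^ n * (-1) ^ card ({..<n} - S) * (\<Prod>k<n. x (k, \<sigma> S k))"
        by (simp add: prod_uminus)
    qed
    finally show ?thesis by simp
  qed
  have evx: "peval P (blocks_point x) = bvalue f x" if x: "x \<in> dom f" for x
  proof -
    have len: "length x = n" by (rule boolean_function_length[OF f x])
    have "peval P (blocks_point x) = (\<Prod>k<n. 1 - of_bool (x ! k))"
      unfolding ev by (intro prod.cong) (auto simp: blocks_point_def point_def)
    also have "\<dots> = of_bool (x = replicate n False)"
    proof (cases "x = replicate n False")
      case False
      then obtain k where "k < n" "x ! k" using len by (auto simp: list_eq_iff_nth_eq)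
      then show ?thesis using False by (auto simp: prod_zero_iff)
    qed simp
    finally show ?thesis using val[OF x] by (simp add: bvalue_def)
  qed
  have "\<bar>peval P z\<bar> \<le> 1" if z: "\<forall>v \<in> {..<n} \<times> {..n}. z v \<in> {-1, 1}" for z
  proof -
    have "\<bar>peval P z\<bar> = (\<Prod>k<n. \<bar>(z (k, 0) - z (k, Suc k)) / 2\<bar>)" by (simp add: ev abs_prod)
    also have "\<dots> \<le> (\<Prod>k<n. 1)"
    proof (intro prod_mono conjI)
      fix k assume "k \<in> {..<n}"
      then have "z (k, 0) \<in> {-1, 1}" "z (k, Suc k) \<in> {-1, 1}" using z by auto
      then show "\<bar>(z (k, 0) - z (k, Suc k)) / 2\<bar> \<le> 1" by auto
    qed simp
    finally show ?thesis by simp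
  qed
  moreover have "block_multilinear n n P"
    unfolding P_def by (rule block_multilinear_block_poly) (simp add: \<sigma>_def)
  ultimately have "bm_witness \<epsilon> n f n P"
    using \<epsilon> by (simp add: bm_witness_def evx) (simp add: bvalue_def)
  moreover have "P \<noteq> 0" using evx[OF z] val[OF z] by (auto simp: bvalue_def)
  ultimately show ?thesis by blast
qed

section \<open>Averaging over the inputs of a fixed weight\<close>

definition weight_inputs :: "nat \<Rightarrow> nat \<Rightarrow> bool list set" where
  "weight_inputs n k = (\<lambda>T. map (\<lambda>i. i \<in> T) [0..<n]) ` {T. T \<subseteq> {..<n} \<and> card T = k}"

lemma sum_weight_inputs:
  "(\<Sum>x\<in>weight_inputs n k. h x) = (\<Sum>T | T \<subseteq> {..<n} \<and> card T = k. h (map (\<lambda>i. i \<in> T) [0..<n]))"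
proof -
  have "inj_on (\<lambda>T. map (\<lambda>i. i \<in> T) [0..<n]) {T. T \<subseteq> {..<n} \<and> card T = k}"
    by (auto simp: inj_on_def)
  then show ?thesis unfolding weight_inputs_def by (simp add: sum.reindex)
qed

lemma card_weight_inputs: "card (weight_inputs n k) = n choose k"
  using sum_weight_inputs[of "\<lambda>_. 1 :: nat" n k] n_subsets[of "{..<n}" k] by simp

lemma card_supersets:
  assumes "S \<subseteq> {..<n}" "card S \<le> k"
  shows "card {T. T \<subseteq> {..<n} \<and> card T = k \<and> S \<subseteq> T} = (n - card S) choose (k - card S)"
proof -
  have fin: "finite U" if "U \<subseteq> {..<n}" for U using that finite_subset by blast
  have "{T. T \<subseteq> {..<n} \<and> card T = k \<and> S \<subseteq> T}
    = (\<lambda>U. U \<union> S) ` {U. U \<subseteq> {..<n} - S \<and> card U = k - card S}" (is "?L = ?R")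
  proof (intro equalityI subsetI)
    fix T assume "T \<in> ?L"
    then have "T = (T - S) \<union> S" "T - S \<subseteq> {..<n} - S" "card (T - S) = k - card S"
      using fin assms by (auto simp: card_Diff_subset)
    then show "T \<in> ?R" by blast
  next
    fix T assume "T \<in> ?R"
    then obtain U where U: "T = U \<union> S" "U \<subseteq> {..<n} - S" "card U = k - card S" by blast
    then have "card T = k" using fin assms by (subst U(1), subst card_Un_disjoint) auto
    then show "T \<in> ?L" using U assms by auto
  qed
  moreover have "inj_on (\<lambda>U. U \<union> S) {U. U \<subseteq> {..<n} - S \<and> card U = k - card S}"
    by (auto simp: inj_on_def)
  ultimately show ?thesis
    using n_subsets[of "{..<n} - S" "k - card S"] fin[OF assms(1)] assms(1)
    by (simp add: card_image card_Diff_subset)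
qed

lemma sum_subset_indicator:
  fixes n k :: nat
  assumes "S \<subseteq> {..<n}"
  shows "(\<Sum>T | T \<subseteq> {..<n} \<and> card T = k. of_bool (S \<subseteq> T))
    = real (card {T. T \<subseteq> {..<n} \<and> card T = k \<and> S \<subseteq> T})"
proof -
  have "finite {T. T \<subseteq> {..<n} \<and> card T = k}"
    by (rule finite_subset[of _ "Pow {..<n}"]) auto
  then have "(\<Sum>T | T \<subseteq> {..<n} \<and> card T = k. of_bool (S \<subseteq> T))
    = real (card ({T. T \<subseteq> {..<n} \<and> card T = k} \<inter> {T. S \<subseteq> T}))"
    by (simp add: sum.If_cases of_bool_def)
  then show ?thesis by (simp add: Int_def conj_assoc)
qed

lemma average_indicator_1:
  assumes "i < n" "k \<le> n"
  shows "(\<Sum>T | T \<subseteq> {..<n} \<and> card T = k. of_bool (i \<in> T)) = real (n choose k) * (real k / real n)"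
proof (cases "k = 0")
  case True
  then show ?thesis by (auto simp: card_eq_0_iff intro!: sum.neutral dest: finite_subset)
next
  case False
  have "(\<Sum>T | T \<subseteq> {..<n} \<and> card T = k. of_bool (i \<in> T)) = real ((n - 1) choose (k - 1))"
    using sum_subset_indicator[of "{i}" n k] card_supersets[of "{i}" n k] assms False by simp
  moreover have "k * (n choose k) = n * ((n - 1) choose (k - 1))"
    using False times_binomial_minus1_eq[of k n] by simp
  then have "real k * real (n choose k) = real n * real ((n - 1) choose (k - 1))"
    by (metis of_nat_mult)
  ultimately show ?thesis using assms by (simp add: field_simps)
qed

lemma average_indicator_2:
  assumes "i < n" "j < n" "i \<noteq> j" "k \<le> n"
  shows "(\<Sum>T | T \<subseteq> {..<n} \<and> card T = k. of_bool (i \<in> T \<and> j \<in> T))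
    = real (n choose k) * (real k * (real k - 1) / (real n * (real n - 1)))"
proof (cases "k \<ge> 2")
  case False
  have "\<not> (i \<in> T \<and> j \<in> T)" if "T \<subseteq> {..<n}" "card T = k" for T
  proof
    assume "i \<in> T \<and> j \<in> T"
    then have "card {i, j} \<le> card T" using that finite_subset by (intro card_mono) auto
    with assms False that show False by simp
  qed
  then have "(\<Sum>T | T \<subseteq> {..<n} \<and> card T = k. of_bool (i \<in> T \<and> j \<in> T) :: real) = 0"
    by (intro sum.neutral) auto
  moreover have "k = 0 \<or> k = 1" using False by linarith
  ultimately show ?thesis by auto
next
  case True
  have "(\<Sum>T | T \<subseteq> {..<n} \<and> card T = k. of_bool (i \<in> T \<and> j \<in> T)) = real ((n - 2) choose (k - 2))"
    using sum_subset_indicator[of "{i, j}" n k] card_supersets[of "{i, j}" n k] assms True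
    by (simp add: numeral_2_eq_2)
  moreover have "real k * real (n choose k) = real n * real ((n - 1) choose (k - 1))"
    using True times_binomial_minus1_eq[of k n] by (metis of_nat_mult not_numeral_le_zero gr0I)
  moreover have "real (k - 1) * real ((n - 1) choose (k - 1)) = real (n - 1) * real ((n - 1 - 1) choose (k - 1 - 1))"
    using True times_binomial_minus1_eq[of "k - 1" "n - 1"] by (metis of_nat_mult Suc_1 Suc_le_lessD zero_less_diff)
  moreover have "n - 1 - 1 = n - 2" "k - 1 - 1 = k - 2" "real (k - 1) = real k - 1" "real (n - 1) = real n - 1"
    using True assms by auto
  ultimately have "real k * (real k - 1) * real (n choose k)
      = real n * (real n - 1) * (\<Sum>T | T \<subseteq> {..<n} \<and> card T = k. of_bool (i \<in> T \<and> j \<in> T))"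
    by (simp add: mult_ac) (metis mult.left_commute mult.commute)
  moreover have "real n * (real n - 1) \<noteq> 0" using assms True by auto
  ultimately show ?thesis by (simp add: field_simps)
qed

text \<open>Symmetrization in the manner of Minsky and Papert, in degree two: the average over a
  weight level is a quadratic in the weight. Keeping the binomial as a factor avoids
  division.\<close>

definition quadratic_average :: "nat \<Rightarrow> (bool list \<Rightarrow> real) \<Rightarrow> bool" where
  "quadratic_average n h \<longleftrightarrow> (\<exists>a b c. \<forall>k\<le>n.
     (\<Sum>x\<in>weight_inputs n k. h x) = real (n choose k) * (a + b * real k + c * (real k)\<^sup>2))"

lemma quadratic_averageI:
  assumes "\<And>k. k \<le> n \<Longrightarrow>
    (\<Sum>x\<in>weight_inputs n k. h x) = real (n choose k) * (a + b * real k + c * (real k)\<^sup>2)"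
  shows "quadratic_average n h"
  using assms unfolding quadratic_average_def by blast

lemma quadratic_average_linear:
  assumes "finite I" "\<And>i. i \<in> I \<Longrightarrow> quadratic_average n (h i)"
  shows "quadratic_average n (\<lambda>x. \<Sum>i\<in>I. s i * h i x)"
proof -
  from assms(2) obtain a b c where abc: "\<And>i k. i \<in> I \<Longrightarrow> k \<le> n \<Longrightarrow>
    (\<Sum>x\<in>weight_inputs n k. h i x) = real (n choose k) * (a i + b i * real k + c i * (real k)\<^sup>2)"
    unfolding quadratic_average_def by metis
  show ?thesis
  proof (rule quadratic_averageI)
    fix k assume k: "k \<le> n"
    have "(\<Sum>x\<in>weight_inputs n k. \<Sum>i\<in>I. s i * h i x) = (\<Sum>i\<in>I. s i * (\<Sum>x\<in>weight_inputs n k. h i x))"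
      by (subst sum.swap) (simp add: sum_distrib_left)
    also have "\<dots> = (\<Sum>i\<in>I. real (n choose k) * (s i * a i + s i * b i * real k + s i * c i * (real k)\<^sup>2))"
      using abc k by (intro sum.cong refl) (simp add: algebra_simps)
    also have "\<dots> = real (n choose k) * ((\<Sum>i\<in>I. s i * a i) + (\<Sum>i\<in>I. s i * b i) * real k
        + (\<Sum>i\<in>I. s i * c i) * (real k)\<^sup>2)"
      by (simp add: sum_distrib_left sum_distrib_right sum.distrib distrib_left)
    finally show "(\<Sum>x\<in>weight_inputs n k. \<Sum>i\<in>I. s i * h i x) = \<dots>" .
  qed
qed

lemma card_subsets: "card {T. T \<subseteq> {..<n} \<and> card T = k} = n choose k"
  using n_subsets[of "{..<n}" k] by simp

lemma quadratic_average_products: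
  assumes "i \<le> n" "j \<le> n"
  shows "quadratic_average n (\<lambda>x. blocks_point x (0, i) * blocks_point x (1, j))"
proof -
  have pt: "blocks_point (map (\<lambda>i. i \<in> T) [0..<n]) (k, i) = (if i = 0 then 1 else 2 * of_bool (i - 1 \<in> T) - 1)"
    if "i \<le> n" for T k i
    using that by (auto simp: blocks_point_def point_def)
  let ?ind = "\<lambda>T i. of_bool (i - 1 \<in> T) :: real"
  \<comment> \<open>Both blocks carry the same point here, so equal indices give the square of a
    sign, which is 1. An index 0 contributes the constant 1 and leaves a linear average.\<close>
  consider "i = 0 \<and> j = 0 \<or> i = j" | "i = 0" "j > 0" | "i > 0" "j = 0" | "i > 0" "j > 0" "i \<noteq> j"
    by linarith
  then show ?thesis
  proof cases
    case 1
    have "(\<Sum>x\<in>weight_inputs n k. blocks_point x (0, i) * blocks_point x (1, j)) = real (n choose k)" for k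
      unfolding sum_weight_inputs pt[OF assms(1)] pt[OF assms(2)]
      using 1 by (subst sum.cong[OF refl, where h = "\<lambda>_. 1"]) (auto simp: card_subsets)
    then show ?thesis by (intro quadratic_averageI[where a = 1 and b = 0 and c = 0]) simp
  next
    case 2
    have "(\<Sum>x\<in>weight_inputs n k. blocks_point x (0, i) * blocks_point x (1, j))
      = real (n choose k) * (-1 + 2 / real n * real k)" if "k \<le> n" for k
      unfolding sum_weight_inputs pt[OF assms(1)] pt[OF assms(2)]
      using 2 average_indicator_1[of "j - 1" n k] assms that
      by (simp add: sum_subtractf card_subsets sum_distrib_left[symmetric] algebra_simps del: sum_of_bool_eq)
    then show ?thesis
      by (intro quadratic_averageI[where a = "-1" and b = "2 / real n" and c = 0]) simp
  next
    case 3
    have "(\<Sum>x\<in>weight_inputs n k. blocks_point x (0, i) * blocks_point x (1, j))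
      = real (n choose k) * (-1 + 2 / real n * real k)" if "k \<le> n" for k
      unfolding sum_weight_inputs pt[OF assms(1)] pt[OF assms(2)]
      using 3 average_indicator_1[of "i - 1" n k] assms that
      by (simp add: sum_subtractf card_subsets sum_distrib_left[symmetric] algebra_simps del: sum_of_bool_eq)
    then show ?thesis
      by (intro quadratic_averageI[where a = "-1" and b = "2 / real n" and c = 0]) simp
  next
    case 4
    define c where "c = 4 / (real n * (real n - 1))"
    have "(\<Sum>x\<in>weight_inputs n k. blocks_point x (0, i) * blocks_point x (1, j))
      = real (n choose k) * (1 + (- c - 4 / real n) * real k + c * (real k)\<^sup>2)" if k: "k \<le> n" for k
    proof -
      let ?S = "{T. T \<subseteq> {..<n} \<and> card T = k}"
      have "(\<Sum>x\<in>weight_inputs n k. blocks_point x (0, i) * blocks_point x (1, j))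
        = (\<Sum>T\<in>?S. 4 * of_bool (i - 1 \<in> T \<and> j - 1 \<in> T) - 2 * ?ind T i - 2 * ?ind T j + 1)"
        unfolding sum_weight_inputs pt[OF assms(1)] pt[OF assms(2)]
        using 4 by (intro sum.cong refl) auto
      also have "\<dots> = 4 * (\<Sum>T\<in>?S. of_bool (i - 1 \<in> T \<and> j - 1 \<in> T)) - 2 * (\<Sum>T\<in>?S. ?ind T i)
          - 2 * (\<Sum>T\<in>?S. ?ind T j) + real (n choose k)"
        by (simp only: sum.distrib sum_subtractf sum_distrib_left sum_constant card_subsets mult_1_right)
      also have "\<dots> = real (n choose k) * (c * (real k * (real k - 1)) - 4 * (real k / real n) + 1)"
        using 4 assms k average_indicator_1[of "i - 1" n k] average_indicator_1[of "j - 1" n k]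
          average_indicator_2[of "i - 1" n "j - 1" k]
        by (simp only: c_def) (auto simp: algebra_simps)
      finally show ?thesis by (simp add: algebra_simps power2_eq_square)
    qed
    then show ?thesis by (rule quadratic_averageI)
  qed
qed

lemma quadratic_average_block_poly:
  assumes P: "block_multilinear d n P" and d: "d \<le> 2"
  shows "quadratic_average n (\<lambda>x. peval P (blocks_point x))"
  unfolding peval_def
proof (rule quadratic_average_linear)
  fix m assume m: "m \<in> pkeys P"
  obtain \<sigma> where \<sigma>: "\<And>k. k < d \<Longrightarrow> \<sigma> k \<le> n" "m = vmono (block_vars d \<sigma>)"
    using block_multilinear_monomial[OF P m] by blast
  \<comment> \<open>For \<open>d < 2\<close> the missing factors are padded with index 0, whose
    coordinate is 1, so that only products of two coordinates need treatment.\<close>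
  define \<tau> where "\<tau> k = (if k < d then \<sigma> k else 0)" for k
  have "meval m (blocks_point x) = blocks_point x (0, \<tau> 0) * blocks_point x (1, \<tau> 1)" for x
  proof -
    have "meval m (blocks_point x) = (\<Prod>k<d. blocks_point x (k, \<sigma> k))"
      unfolding \<sigma>(2) by (subst meval_vmono) (simp_all only: prod_block_vars finite_imageI finite_lessThan)
    moreover have "d = 0 \<or> d = 1 \<or> d = 2" using d by linarith
    ultimately show ?thesis by (auto simp: \<tau>_def blocks_point_def numeral_2_eq_2)
  qed
  moreover have "quadratic_average n (\<lambda>x. blocks_point x (0, \<tau> 0) * blocks_point x (1, \<tau> 1))"
    using \<sigma>(1) by (intro quadratic_average_products) (auto simp: \<tau>_def)
  ultimately show "quadratic_average n (\<lambda>x. meval m (blocks_point x))" by simp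
qed simp

section \<open>The function with two accepted weights and the lower bound for certifying its
  rejection\<close>

definition two_weights :: "nat \<Rightarrow> nat \<Rightarrow> nat \<Rightarrow> bfun" where
  "two_weights n p r = (\<lambda>x. if x \<in> weight_inputs n 0 then Some False
     else if x \<in> weight_inputs n p \<union> weight_inputs n r then Some True else None)"

lemma weight_inputs_disjoint: "k \<noteq> l \<Longrightarrow> weight_inputs n k \<inter> weight_inputs n l = {}"
proof -
  have "T = T'" if "T \<subseteq> {..<n}" "T' \<subseteq> {..<n}"
    "map (\<lambda>i. i \<in> T) [0..<n] = map (\<lambda>i. i \<in> T') [0..<n]" for T T'
    using that by auto
  then show "k \<noteq> l \<Longrightarrow> weight_inputs n k \<inter> weight_inputs n l = {}"
    unfolding weight_inputs_def by blast
qed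

lemma weight_inputs_0: "weight_inputs n 0 = {replicate n False}"
proof -
  have "{T. T \<subseteq> {..<n} \<and> card T = 0} = {{}}"
    by (auto dest: finite_subset)
  then show ?thesis by (simp add: weight_inputs_def map_replicate_const)
qed

lemma length_weight_inputs: "x \<in> weight_inputs n k \<Longrightarrow> length x = n"
  by (auto simp: weight_inputs_def)

lemma weight_inputs_nonempty: "k \<le> n \<Longrightarrow> weight_inputs n k \<noteq> {}"
  using card_weight_inputs[of n k] by (metis binomial_eq_0_iff card.empty not_le)

lemma finite_weight_inputs [simp]: "finite (weight_inputs n k)"
  by (rule finite_subset[OF _ finite_bool_lists[of n]]) (auto dest: length_weight_inputs)

lemma boolean_function_two_weights: "boolean_function n (two_weights n p r)"
  by (auto simp: boolean_function_def two_weights_def weight_inputs_0 dom_def fun_eq_iff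
      dest: length_weight_inputs split: if_splits)

lemma dom_two_weights:
  "dom (two_weights n p r) = weight_inputs n 0 \<union> weight_inputs n p \<union> weight_inputs n r"
  by (auto simp: two_weights_def split: if_splits)

text \<open>
  Extrapolating the average from the weights \<open>0\<close>, \<open>p\<close>, \<open>r\<close> to the weight \<open>n\<close> by Lagrange
  interpolation would give a value exceeding 1.
\<close>

lemma no_small_bm_witness:
  assumes pr: "0 < p" "p < r" "r < n"
    and sep: "(1 - \<epsilon>) * ((real n - p) * (real n - r) * (real r - p)) - \<epsilon> * (real n * (real n - r) * r)
      > real p * r * (real r - p)"
    and d: "d \<le> 2"
    and W: "bm_witness \<epsilon> n (cert_fun (two_weights n p r) (replicate n False)) d P"
  shows False
proof -
  let ?f = "two_weights n p r"
  let ?z = "replicate n False"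
  let ?g = "cert_fun ?f ?z"
  let ?h = "\<lambda>x. peval P (blocks_point x)"
  have z: "?z \<in> weight_inputs n 0" by (simp add: weight_inputs_0)
  have disj: "weight_inputs n 0 \<inter> weight_inputs n p = {}" "weight_inputs n 0 \<inter> weight_inputs n r = {}"
    using pr by (auto intro!: weight_inputs_disjoint)
  have g0: "?g ?z = Some True" by simp
  have g1: "?g x = Some False" if "x \<in> weight_inputs n p \<union> weight_inputs n r" for x
  proof -
    have "x \<notin> weight_inputs n 0" using that disj by blast
    then have "?f x = Some True" "x \<noteq> ?z" "?f ?z = Some False"
      using that z by (auto simp: two_weights_def)
    then show ?thesis by (auto simp: cert_fun_def)
  qed
  have bm: "block_multilinear d n P"
    and wit: "\<And>x. x \<in> dom ?g \<Longrightarrow> 0 \<le> ?h x \<and> \<bar>?h x - bvalue ?g x\<bar> \<le> \<epsilon>"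
    and bdd: "\<And>z. (\<forall>v \<in> {..<d} \<times> {..n}. z v \<in> {-1, 1}) \<Longrightarrow> \<bar>peval P z\<bar> \<le> 1"
    using W unfolding bm_witness_def by blast+
  have "quadratic_average n ?h" by (rule quadratic_average_block_poly[OF bm d])
  then obtain a b c where abc: "\<And>k. k \<le> n \<Longrightarrow>
    (\<Sum>x\<in>weight_inputs n k. ?h x) = real (n choose k) * (a + b * real k + c * (real k)\<^sup>2)"
    unfolding quadratic_average_def by blast
  define q where "q k = a + b * k + c * k\<^sup>2" for k :: real
  have avg_le: "q k \<le> B" if "k \<le> n" "\<And>x. x \<in> weight_inputs n k \<Longrightarrow> ?h x \<le> B" for k :: nat and B
  proof -
    have "real (n choose k) * q k \<le> real (n choose k) * B"
      using sum_bounded_above[of "weight_inputs n k" ?h B] that(2) abc[OF that(1)]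
      by (simp add: card_weight_inputs q_def)
    then show ?thesis using that(1) by (simp add: mult_le_cancel_left_pos)
  qed
  have avg_ge: "B \<le> q k" if "k \<le> n" "\<And>x. x \<in> weight_inputs n k \<Longrightarrow> B \<le> ?h x" for k :: nat and B
  proof -
    have "real (n choose k) * B \<le> real (n choose k) * q k"
      using sum_bounded_below[of "weight_inputs n k" B ?h] that(2) abc[OF that(1)]
      by (simp add: card_weight_inputs q_def)
    then show ?thesis using that(1) by (simp add: mult_le_cancel_left_pos)
  qed
  \<comment> \<open>At \<open>n > r > p > 0\<close> the Lagrange coefficients of the nodes
    \<open>0\<close>, \<open>p\<close>, \<open>r\<close> have signs plus, minus, plus. Hence lower
    bounds are wanted at \<open>0\<close> and \<open>r\<close>, and an upper bound at
    \<open>p\<close>.\<close>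
  have q0: "1 - \<epsilon> \<le> q 0"
  proof -
    have "?z \<in> dom ?g" using g0 by blast
    from wit[OF this] have "\<bar>?h ?z - 1\<bar> \<le> \<epsilon>" by (simp add: bvalue_def)
    then have "1 - \<epsilon> \<le> ?h ?z" by linarith
    then show ?thesis using avg_ge[of 0 "1 - \<epsilon>"] by (simp add: weight_inputs_0)
  qed
  have qp: "q p \<le> \<epsilon>"
  proof (rule avg_le)
    fix x assume "x \<in> weight_inputs n p"
    then have "?g x = Some False" using g1 by blast
    then have "x \<in> dom ?g" "bvalue ?g x = 0" by (auto simp: bvalue_def)
    with wit[OF this(1)] show "?h x \<le> \<epsilon>" by linarith
  qed (use pr in simp)
  have qr: "0 \<le> q r"
  proof (rule avg_ge)
    fix x assume "x \<in> weight_inputs n r"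
    then have "?g x = Some False" using g1 by blast
    then show "0 \<le> ?h x" using wit[of x] by auto
  qed (use pr in simp)
  \<comment> \<open>The all-True point lies outside the domain, so the bound on all sign points is
    used here.\<close>
  have qn: "q n \<le> 1"
  proof (rule avg_le)
    fix x
    have "\<bar>?h x\<bar> \<le> 1" by (rule bdd) (auto simp: blocks_point_def point_def)
    then show "?h x \<le> 1" by linarith
  qed simp
  \<comment> \<open>Lagrange interpolation at the nodes \<open>0\<close>, \<open>p\<close>,
    \<open>r\<close>, multiplied by the common denominator \<open>p * r * (r - p)\<close>.\<close>
  have "q n * (real p * r * (real r - p)) = q 0 * ((real n - p) * (real n - r) * (real r - p))
    - q p * (real n * (real n - r) * r) + q r * (real n * (real n - p) * p)"
    unfolding q_def by (simp add: algebra_simps power2_eq_square)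
  moreover have "q n * (real p * r * (real r - p)) \<le> 1 * (real p * r * (real r - p))"
    using pr by (intro mult_right_mono qn) auto
  moreover have "(1 - \<epsilon>) * ((real n - p) * (real n - r) * (real r - p))
      \<le> q 0 * ((real n - p) * (real n - r) * (real r - p))"
    using pr by (intro mult_right_mono q0) auto
  moreover have "q p * (real n * (real n - r) * r) \<le> \<epsilon> * (real n * (real n - r) * r)"
    using pr by (intro mult_right_mono qp) auto
  moreover have "0 \<le> q r * (real n * (real n - p) * p)"
    using pr qr by simp
  ultimately show False using sep by linarith
qed

section \<open>A bilinear quadratic with values in \<open>[-1, 1]\<close> on the whole cube\<close>

lemma corner_bound:
  fixes x y m g E :: real
  assumes "0 \<le> x" "x \<le> m" "0 \<le> y" "y \<le> m" "0 \<le> g" "m\<^sup>2 \<le> E" "2 * g * m \<le> E"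
  shows "x * y + g * (2 * m - x - y) \<le> E"
\<comment> \<open>The expression is affine in each variable, so it is largest at a corner of the
  square, where it equals \<open>m * m\<close>, \<open>g * m\<close> or \<open>2 * g * m\<close>.
  The sign of \<open>x - g\<close> decides in which direction to move \<open>y\<close>.\<close>
proof (cases "g \<le> x")
  case False
  then have "y * (x - g) \<le> 0" using assms by (intro mult_nonneg_nonpos) auto
  moreover have "0 \<le> g * x" using assms by simp
  ultimately show ?thesis using assms(7) by (simp add: algebra_simps)
next
  case True
  then have "y * (x - g) \<le> m * (x - g)" "x * (m - g) \<le> m * (m - g)"
    using assms by (auto intro!: mult_right_mono)
  then show ?thesis using assms(6) by (simp add: algebra_simps power2_eq_square)
qed

text \<open>Here \<open>x\<close>, \<open>y\<close> are the shifted weights of two cube points and \<open>h\<close> is their Hamming distance.\<close>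

lemma bilinear_bound:
  fixes x y h \<rho> m g E :: real
  assumes xy: "1 / 2 \<le> \<bar>x\<bar>" "- \<rho> \<le> x" "x \<le> m" "1 / 2 \<le> \<bar>y\<bar>" "- \<rho> \<le> y" "y \<le> m"
    and h: "\<bar>x - y\<bar> \<le> h" "h \<le> x + y + 2 * \<rho>" "h \<le> 2 * m - x - y" "h \<le> \<rho> + m"
    and \<rho>: "0 < \<rho>" "\<rho> \<le> m" and g: "g = \<rho> * m / (\<rho> + m) + 1 / 4"
    and E: "m\<^sup>2 \<le> E" "2 * g * m \<le> E" "\<rho> * m + (\<rho> + m) / 4 \<le> E"
  shows "0 \<le> x * y - 1 / 4 + g * h" "x * y + g * h \<le> E"
proof -
  have g0: "0 \<le> g" and h0: "0 \<le> h" using g \<rho> h(1) by auto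
  have gn: "g * (\<rho> + m) = \<rho> * m + (\<rho> + m) / 4" using g \<rho> by (simp add: field_simps)
  \<comment> \<open>Origin of \<open>g\<close>: the ratio \<open>u * v / (u + v)\<close> grows in
    both arguments and is largest at \<open>u = \<rho>\<close>, \<open>v = m\<close>. The summand
    \<open>1 / 4\<close> in \<open>g\<close> pays for the constant because
    \<open>u + v \<ge> 1\<close>.\<close>
  have opp: "u * v \<le> g * (u + v) - 1 / 4" if "1 / 2 \<le> u" "1 / 2 \<le> v" "u \<le> \<rho> \<and> v \<le> m" for u v
  proof -
    have "0 \<le> \<rho> * u * (m - v) + m * v * (\<rho> - u)" using that \<rho> by simp
    then have "u * v * (\<rho> + m) \<le> \<rho> * m * (u + v)" by (simp add: algebra_simps)
    then have "u * v \<le> \<rho> * m / (\<rho> + m) * (u + v)" using \<rho> by (simp add: field_simps)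
    moreover have "1 / 4 \<le> 1 / 4 * (u + v)" using that by simp
    ultimately show ?thesis unfolding g distrib_right by linarith
  qed
  \<comment> \<open>With equal signs the product alone is at least \<open>1 / 4\<close> and the
    corner bound limits it from above. With opposite signs the product is negative, but
    \<open>h \<ge> \<bar>x - y\<bar>\<close> makes the distance term outweigh it.\<close>
  consider "1 / 2 \<le> x" "1 / 2 \<le> y" | "x \<le> - (1 / 2)" "y \<le> - (1 / 2)"
    | "x \<le> - (1 / 2)" "1 / 2 \<le> y" | "1 / 2 \<le> x" "y \<le> - (1 / 2)"
    using xy(1,4) by linarith
  then have "0 \<le> x * y - 1 / 4 + g * h \<and> x * y + g * h \<le> E"
  proof cases
    case 1
    have "1 / 2 * (1 / 2) \<le> x * y" using 1 by (intro mult_mono) auto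
    moreover have "0 \<le> g * h" using g0 h0 by simp
    moreover have "g * h \<le> g * (2 * m - x - y)" using h(3) g0 by (rule mult_left_mono)
    moreover have "x * y + g * (2 * m - x - y) \<le> E"
      using 1 xy g0 E by (intro corner_bound) auto
    ultimately show ?thesis by linarith
  next
    case 2
    have "1 / 2 * (1 / 2) \<le> (- x) * (- y)" using 2 by (intro mult_mono) auto
    moreover have "0 \<le> g * h" using g0 h0 by simp
    moreover have "g * h \<le> g * (2 * \<rho> - (- x) - (- y))" using h(2) g0 by (intro mult_left_mono) auto
    moreover have "(- x) * (- y) + g * (2 * \<rho> - (- x) - (- y)) \<le> E"
    proof (rule corner_bound)
      have "\<rho>\<^sup>2 \<le> m\<^sup>2" using \<rho> by (intro power_mono) auto
      then show "\<rho>\<^sup>2 \<le> E" using E(1) by linarith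
      have "2 * g * \<rho> \<le> 2 * g * m" using \<rho> g0 by (intro mult_left_mono) auto
      then show "2 * g * \<rho> \<le> E" using E(2) by linarith
    qed (use 2 xy g0 in auto)
    ultimately show ?thesis by simp
  next
    case 3
    have "(- x) * y \<le> g * (- x + y) - 1 / 4" using 3 xy by (intro opp) auto
    moreover have "g * (- x + y) \<le> g * h" using h(1) g0 by (intro mult_left_mono) auto
    moreover have "g * h \<le> g * (\<rho> + m)" using h(4) g0 by (rule mult_left_mono)
    moreover have "x * y \<le> 0" using 3 by (intro mult_nonpos_nonneg) auto
    ultimately show ?thesis using gn E(3) by simp
  next
    case 4
    have "(- y) * x \<le> g * (- y + x) - 1 / 4" using 4 xy by (intro opp) auto
    moreover have "g * (- y + x) \<le> g * h" using h(1) g0 by (intro mult_left_mono) auto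
    moreover have "g * h \<le> g * (\<rho> + m)" using h(4) g0 by (rule mult_left_mono)
    moreover have "x * y \<le> 0" using 4 by (intro mult_nonneg_nonpos) auto
    ultimately show ?thesis using gn E(3) by (simp add: mult.commute)
  qed
  then show "0 \<le> x * y - 1 / 4 + g * h" "x * y + g * h \<le> E" by blast+
qed

text \<open>
  On the diagonal this form is \<open>1 - \<alpha> ((k - \<rho>)\<^sup>2 - 1/4)\<close>, with \<open>k\<close> the weight.  The \<open>\<gamma>\<close> term is a multiple
  of the Hamming distance: it vanishes on the diagonal and keeps the other values in \<open>[-1, 1]\<close>.
\<close>

definition weight_form :: "nat \<Rightarrow> real \<Rightarrow> real \<Rightarrow> real \<Rightarrow> (nat \<times> nat) rpoly" where
  "weight_form n \<rho> \<alpha> \<gamma> = block_poly 2 ({..n} \<times> {..n}) (\<lambda>(i, j) k. if k = 0 then i else j)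
     (\<lambda>(i, j). of_bool (i = 0 \<and> j = 0) * (1 + \<alpha> / 4 - \<gamma> * n / 2)
        - \<alpha> * (if i = 0 then n / 2 - \<rho> else 1 / 2) * (if j = 0 then n / 2 - \<rho> else 1 / 2)
        + \<gamma> / 2 * of_bool (i = j \<and> i \<noteq> 0))"

lemma block_multilinear_weight_form: "block_multilinear 2 n (weight_form n \<rho> \<alpha> \<gamma>)"
  unfolding weight_form_def by (rule block_multilinear_block_poly) auto

text \<open>The coefficient matrix is a corner entry plus a rank-one matrix plus a diagonal one, and
  each yields one summand. The vector of the rank-one part is weight minus \<open>\<rho>\<close>
  written in sign coordinates. The distance is \<open>n / 2\<close> minus half the inner product of
  the two sign vectors, which puts \<open>\<gamma> * n / 2\<close> into the corner.\<close>

lemma peval_weight_form: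
  "peval (weight_form n \<rho> \<alpha> \<gamma>) z = (1 + \<alpha> / 4 - \<gamma> * n / 2) * z (0, 0) * z (1, 0)
     - \<alpha> * ((n / 2 - \<rho>) * z (0, 0) + (\<Sum>i<n. z (0, Suc i)) / 2)
         * ((n / 2 - \<rho>) * z (1, 0) + (\<Sum>i<n. z (1, Suc i)) / 2)
     + \<gamma> / 2 * (\<Sum>i<n. z (0, Suc i) * z (1, Suc i))"
proof -
  let ?l = "\<lambda>i. if i = 0 then n / 2 - \<rho> else 1 / 2"
  let ?\<kappa> = "1 + \<alpha> / 4 - \<gamma> * n / 2"
  have lin: "(\<Sum>i\<le>n. ?l i * u i) = (n / 2 - \<rho>) * u 0 + (\<Sum>i<n. u (Suc i)) / 2" for u
    by (subst sum.atMost_shift) (simp add: sum_divide_distrib)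
  have "peval (weight_form n \<rho> \<alpha> \<gamma>) z
    = (\<Sum>i\<le>n. \<Sum>j\<le>n. (of_bool (i = 0 \<and> j = 0) * ?\<kappa> - \<alpha> * ?l i * ?l j
        + \<gamma> / 2 * of_bool (i = j \<and> i \<noteq> 0)) * (z (0, i) * z (1, j)))"
    unfolding weight_form_def peval_block_poly
    by (subst sum.cartesian_product) (auto intro!: sum.cong simp: numeral_2_eq_2)
  also have "\<dots> = (\<Sum>i\<le>n. \<Sum>j\<le>n. of_bool (i = 0 \<and> j = 0) * ?\<kappa> * (z (0, i) * z (1, j)))
      - (\<Sum>i\<le>n. \<Sum>j\<le>n. \<alpha> * ((?l i * z (0, i)) * (?l j * z (1, j))))
      + (\<Sum>i\<le>n. \<Sum>j\<le>n. \<gamma> / 2 * of_bool (i = j \<and> i \<noteq> 0) * (z (0, i) * z (1, j)))"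
    unfolding sum.distrib[symmetric] sum_subtractf[symmetric]
    by (intro sum.cong refl) (simp add: algebra_simps)
  also have "(\<Sum>i\<le>n. \<Sum>j\<le>n. of_bool (i = 0 \<and> j = 0) * ?\<kappa> * (z (0, i) * z (1, j)))
      = ?\<kappa> * z (0, 0) * z (1, 0)"
  proof -
    have "(\<Sum>j\<le>n. of_bool (i = 0 \<and> j = 0) * ?\<kappa> * (z (0, i) * z (1, j)))
      = (if i = 0 then ?\<kappa> * z (0, 0) * z (1, 0) else 0)" for i
    proof -
      have "(\<Sum>j\<le>n. of_bool (i = 0 \<and> j = 0) * ?\<kappa> * (z (0, i) * z (1, j)))
        = (\<Sum>j\<le>n. if j = 0 then of_bool (i = 0) * ?\<kappa> * (z (0, i) * z (1, 0)) else 0)"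
        by (intro sum.cong refl) auto
      then show ?thesis by simp
    qed
    then show ?thesis by simp
  qed
  also have "(\<Sum>i\<le>n. \<Sum>j\<le>n. \<alpha> * ((?l i * z (0, i)) * (?l j * z (1, j))))
      = \<alpha> * ((\<Sum>i\<le>n. ?l i * z (0, i)) * (\<Sum>j\<le>n. ?l j * z (1, j)))"
    by (subst sum_product) (simp only: sum_distrib_left)
  also have "(\<Sum>i\<le>n. \<Sum>j\<le>n. \<gamma> / 2 * of_bool (i = j \<and> i \<noteq> 0) * (z (0, i) * z (1, j)))
      = \<gamma> / 2 * (\<Sum>i<n. z (0, Suc i) * z (1, Suc i))"
  proof -
    have "(\<Sum>j\<le>n. \<gamma> / 2 * of_bool (i = j \<and> i \<noteq> 0) * (z (0, i) * z (1, j)))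
      = (if i = 0 then 0 else \<gamma> / 2 * (z (0, i) * z (1, i)))" if "i \<le> n" for i
    proof -
      have "(\<Sum>j\<le>n. \<gamma> / 2 * of_bool (i = j \<and> i \<noteq> 0) * (z (0, i) * z (1, j)))
        = (\<Sum>j\<le>n. if j = i then of_bool (i \<noteq> 0) * (\<gamma> / 2 * (z (0, i) * z (1, i))) else 0)"
        by (intro sum.cong refl) auto
      also have "\<dots> = of_bool (i \<noteq> 0) * (\<gamma> / 2 * (z (0, i) * z (1, i)))"
        using that by (simp only: sum.delta finite_atMost atMost_iff if_True)
      also have "\<dots> = (if i = 0 then 0 else \<gamma> / 2 * (z (0, i) * z (1, i)))" by simp
      finally show ?thesis .
    qed
    then have "(\<Sum>i\<le>n. \<Sum>j\<le>n. \<gamma> / 2 * of_bool (i = j \<and> i \<noteq> 0) * (z (0, i) * z (1, j)))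
      = (\<Sum>i\<le>n. if i = 0 then 0 else \<gamma> / 2 * (z (0, i) * z (1, i)))"
      by (intro sum.cong) auto
    then show ?thesis by (simp add: sum.atMost_shift sum_distrib_left)
  qed
  finally show ?thesis unfolding lin by (simp only: mult.assoc)
qed

text \<open>Linearity in each block lets the factor \<open>s k\<close> be pulled out, leaving blocks
  whose constant coordinate is 1 and whose True positions form \<open>U k\<close>. The last bracket
  is the size of the symmetric difference, that is, the Hamming distance.\<close>

lemma peval_weight_form_signs:
  fixes n :: nat
  assumes z: "\<And>k i. k < 2 \<Longrightarrow> i < n \<Longrightarrow> z (k, Suc i) = s k * (2 * of_bool (i \<in> U k) - 1)"
    and s: "z (0, 0) = s 0" "z (1, 0) = s 1" and U: "\<And>k. U k \<subseteq> {..<n}"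
  shows "peval (weight_form n \<rho> \<alpha> \<gamma>) z = s 0 * s 1 * (1 + \<alpha> / 4
    - \<alpha> * (real (card (U 0)) - \<rho>) * (real (card (U 1)) - \<rho>)
    - \<gamma> * (real (card (U 0)) + real (card (U 1)) - 2 * real (card (U 0 \<inter> U 1))))"
proof -
  have ind: "(\<Sum>i<n. of_bool (i \<in> V)) = real (card V)" if "V \<subseteq> {..<n}" for V :: "nat set"
    using that by (simp add: Int_absorb1 Int_def[symmetric] Collect_conj_eq)
  have lin: "(\<Sum>i<n. z (k, Suc i)) = s k * (2 * real (card (U k)) - n)" if "k < 2" for k
  proof -
    have "(\<Sum>i<n. z (k, Suc i)) = (\<Sum>i<n. s k * (2 * of_bool (i \<in> U k) - 1))"
      using z[OF that] by (intro sum.cong) auto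
    also have "\<dots> = s k * (2 * (\<Sum>i<n. of_bool (i \<in> U k)) - real n)"
      by (simp only: sum_distrib_left[symmetric] sum_subtractf sum_constant card_lessThan mult_1_right)
    finally show ?thesis unfolding ind[OF U] .
  qed
  have "(\<Sum>i<n. z (0, Suc i) * z (1, Suc i))
    = (\<Sum>i<n. s 0 * s 1 * (4 * of_bool (i \<in> U 0 \<inter> U 1) - 2 * of_bool (i \<in> U 0) - 2 * of_bool (i \<in> U 1) + 1))"
    using z[of 0] z[of 1] by (intro sum.cong) auto
  also have "\<dots> = s 0 * s 1 * (4 * (\<Sum>i<n. of_bool (i \<in> U 0 \<inter> U 1)) - 2 * (\<Sum>i<n. of_bool (i \<in> U 0))
      - 2 * (\<Sum>i<n. of_bool (i \<in> U 1)) + real n)"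
    by (simp only: sum_distrib_left[symmetric] sum_subtractf sum.distrib sum_constant card_lessThan mult_1_right)
  also have "\<dots> = s 0 * s 1 * (4 * real (card (U 0 \<inter> U 1)) - 2 * real (card (U 0)) - 2 * real (card (U 1)) + n)"
    using ind[OF U] ind[of "U 0 \<inter> U 1"] U by (simp only: inf.coboundedI1)
  finally have prod: "(\<Sum>i<n. z (0, Suc i) * z (1, Suc i))
    = s 0 * s 1 * (4 * real (card (U 0 \<inter> U 1)) - 2 * real (card (U 0)) - 2 * real (card (U 1)) + n)" .
  show ?thesis
    unfolding peval_weight_form prod s using lin[of 0] lin[of 1]
    by (simp add: field_simps)
qed

section \<open>Choice of the integer parameters\<close>

lemma Greatest_nat_boundary:
  fixes Q :: "nat \<Rightarrow> bool"
  assumes "Q k" "\<And>y. Q y \<Longrightarrow> y \<le> b"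
  obtains t where "k \<le> t" "Q t" "\<not> Q (Suc t)"
proof -
  have "Q (GREATEST t. Q t)" using assms by (rule GreatestI_nat[of Q k b])
  moreover have "k \<le> (GREATEST t. Q t)" using assms by (rule Greatest_le_nat[of Q k b])
  moreover have "\<not> Q (Suc (GREATEST t. Q t))"
    using Greatest_le_nat[of Q "Suc (GREATEST t. Q t)" b] assms(2) by auto
  ultimately show thesis using that by blast
qed

text \<open>\<open>M\<close> is the greatest integer satisfying the first inequality, so failure at
  \<open>M + 1\<close> gives the matching lower bound on its square. The rational bounds
  \<open>6 / 5\<close> and \<open>3 / 2\<close> enclose the square root of 2, and
  \<open>r \<ge> 16\<close> absorbs the lower-order terms.\<close>

lemma exists_root_two_multiple:
  fixes r :: nat
  assumes r: "16 \<le> r"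
  obtains M :: nat where "real M * (M + 1) \<le> 2 * real r * (real r - 1)" "6 * real r \<le> 5 * M"
    "2 * real M \<le> 3 * r" "2 * (real r)\<^sup>2 - 7 * r \<le> (real M)\<^sup>2"
proof -
  let ?Q = "\<lambda>M :: nat. real M * (M + 1) \<le> 2 * real r * (real r - 1)"
  have half: "2 * real M \<le> 3 * r" if "?Q M" for M
  proof (rule ccontr)
    assume "\<not> 2 * real M \<le> 3 * r"
    then have "3 / 2 * real r * (3 / 2 * real r) \<le> real M * (M + 1)"
      by (intro mult_mono) auto
    with that have "1 / 4 * (real r * real r) + 2 * real r \<le> 0" by (simp add: algebra_simps)
    moreover have "0 \<le> real r * real r" "0 < real r" using r by auto
    ultimately show False by linarith
  qed
  have "?Q 0" using r by simp
  moreover have "M \<le> 2 * r" if "?Q M" for M using half[OF that] by linarith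
  ultimately obtain M where M: "?Q M" "\<not> ?Q (Suc M)" by (rule Greatest_nat_boundary)
  have upper: "2 * real r * (real r - 1) < (M + 1) * (M + 2)"
    using M(2) by (simp add: not_le algebra_simps)
  have M2: "2 * real M \<le> 3 * r" by (rule half[OF M(1)])
  have rr: "16 * real r \<le> real r * real r" using r by (intro mult_right_mono) auto
  have "6 * real r \<le> 5 * M"
  proof (rule ccontr)
    assume "\<not> 6 * real r \<le> 5 * M"
    then have "(real M + 1) * (M + 2) \<le> (6 / 5 * real r + 1) * (6 / 5 * real r + 2)"
      by (intro mult_mono) auto
    with upper have "14 * (real r * real r) < 140 * real r + 50" by (simp add: algebra_simps)
    with rr r show False by linarith
  qed
  moreover have "2 * (real r)\<^sup>2 - 7 * r \<le> (real M)\<^sup>2"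
    using upper M2 r by (simp add: algebra_simps power2_eq_square)
  ultimately show thesis using that[OF M(1) _ M2] by blast
qed

text \<open>\<open>t\<close> is the greatest integer for which the decision quadratic at weight
  \<open>r - t\<close> is still at least \<open>1 - e\<close>; failure at \<open>t + 1\<close> is
  the last inequality. Asymptotically \<open>t / r\<close> is the square root of
  \<open>e / (1 - e)\<close>, which is below 1, so \<open>r - t\<close> grows with
  \<open>r\<close>.\<close>

lemma exists_separating_weight:
  fixes e :: real
  assumes e: "0 \<le> e" "e < 1 / 2"
  obtains r t :: nat where "1 \<le> t" "t < r" "16 \<le> r" "16 \<le> (1 - 2 * e) * (real r - t)"
    "(1 - e) * (real t * (real t - 1)) \<le> e * (real r * (real r - 1))"
    "e * (real r * (real r - 1)) < (1 - e) * (real t * (real t + 1))"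
proof -
  define c where "c = 16 / (1 - 2 * e)"
  have c: "16 \<le> c" "c * (1 - 2 * e) = 16" using e by (simp_all add: c_def field_simps)
  \<comment> \<open>\<open>2 * c + 1\<close> is the coefficient of \<open>r\<close> lost in
    \<open>(r - c) * (r - c - 1)\<close>; beyond this bound \<open>t\<close> cannot lie within
    \<open>c\<close> of \<open>r\<close>.\<close>
  obtain r :: nat where "(2 * c + 1) / (1 - 2 * e) < real r" using reals_Archimedean2 by blast
  then have r: "2 * c + 1 < (1 - 2 * e) * real r" using e by (simp add: field_simps)
  have "(1 - 2 * e) * real r \<le> 1 * real r" using e by (intro mult_right_mono) auto
  with r c(1) have r33: "33 < real r" by linarith
  then have rr: "0 < real r * (real r - 1)" by simp
  let ?Q = "\<lambda>t :: nat. (1 - e) * (real t * (real t - 1)) \<le> e * (real r * (real r - 1))"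
  have less: "t < r" if "?Q t" for t
  proof (rule ccontr)
    assume "\<not> t < r"
    then have "real r * (real r - 1) \<le> real t * (real t - 1)" using r33 by (intro mult_mono) auto
    then have "(1 - e) * (real r * (real r - 1)) \<le> (1 - e) * (real t * (real t - 1))"
      using e by (intro mult_left_mono) auto
    with that have "(1 - 2 * e) * (real r * (real r - 1)) \<le> 0" by (simp add: algebra_simps)
    moreover have "0 < (1 - 2 * e) * (real r * (real r - 1))" 
      by (rule mult_pos_pos[OF _ rr]) (use e in simp)
    ultimately show False by linarith
  qed
  have "0 \<le> e * (real r * (real r - 1))"
    by (rule mult_nonneg_nonneg[OF e(1) less_imp_le[OF rr]])
  then have "?Q 1" by (simp only: of_nat_1 diff_self mult_zero_right)
  moreover have "t \<le> r" if "?Q t" for t using less[OF that] by simp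
  ultimately obtain t where t: "1 \<le> t" "?Q t" "\<not> ?Q (Suc t)"
    by (rule Greatest_nat_boundary[of ?Q 1 r])
  have tr: "t < r" by (rule less[OF t(2)])
  define s where "s = real r - t"
  have s0: "0 \<le> s" using tr by (simp add: s_def)
  have "c \<le> s"
  proof (rule ccontr)
    assume "\<not> c \<le> s"
    then have "(2 * s + 1) * real r \<le> (2 * c + 1) * real r" by (intro mult_right_mono) auto
    moreover have "real t * (real t - 1) = real r * real r - (2 * s + 1) * real r + s * s + s"
      by (simp add: s_def algebra_simps)
    ultimately have "real r * real r - (2 * c + 1) * real r \<le> real t * (real t - 1)"
      using s0 by (smt (verit) mult_nonneg_nonneg)
    then have "(1 - e) * (real r * real r - (2 * c + 1) * real r) \<le> (1 - e) * (real t * (real t - 1))"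
      using e by (intro mult_left_mono) auto
    also have "\<dots> \<le> e * (real r * (real r - 1))" by (rule t(2))
    also have "\<dots> \<le> e * (real r * real r)" using e by (intro mult_left_mono) auto
    finally have "((1 - 2 * e) * real r) * real r \<le> (1 - e) * ((2 * c + 1) * real r)"
      by (simp add: algebra_simps)
    also have "\<dots> \<le> 1 * ((2 * c + 1) * real r)" using e c(1) by (intro mult_right_mono) auto
    finally have "(1 - 2 * e) * real r \<le> 2 * c + 1" using r33 by simp
    with r show False by linarith
  qed
  then have "(1 - 2 * e) * c \<le> (1 - 2 * e) * s" using e by (intro mult_left_mono) auto
  then have "16 \<le> (1 - 2 * e) * (real r - t)" using c(2) by (simp add: s_def mult.commute)
  moreover have "e * (real r * (real r - 1)) < (1 - e) * (real t * (real t + 1))"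
    using t(3) by (simp add: algebra_simps)
  moreover have "16 \<le> r" using r33 by linarith
  ultimately show thesis using that t(1,2) tr by blast
qed

text \<open>The choice \<open>M \<approx> \<surd>2 r\<close> works for every \<open>\<epsilon> < 1/2\<close> because \<open>2 (1 - \<epsilon>) > 1\<close>.\<close>

lemma separation_inequality:
  fixes e r t M :: real
  assumes e: "0 \<le> e" "e < 1 / 2" and t: "1 \<le> t" "t < r" and r: "16 \<le> r"
    and gap: "16 \<le> (1 - 2 * e) * (r - t)"
    and max: "e * (r * (r - 1)) < (1 - e) * (t * (t + 1))"
    and M: "2 * M \<le> 3 * r" "2 * r\<^sup>2 - 7 * r \<le> M\<^sup>2" "0 < M"
  shows "(r - t) * r * t < (1 - e) * ((M + t) * M * t) - e * ((r + M) * M * r)"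
proof -
  define s where "s = r - t"
  define X where "X = (1 - e) * ((M + t) * M * t) - e * ((r + M) * M * r)"
  have s: "0 < s" "s \<le> r" using t by (auto simp: s_def)
  have rr: "0 \<le> r * r" by simp
  have "M * (2 * M + r + t) \<le> 3 / 2 * r * (5 * r)" using M t r by (intro mult_mono) auto
  then have low: "M * (2 * M + r + t) \<le> 15 / 2 * (r * r)" by simp
  have "(2 * r\<^sup>2 - 7 * r) * s \<le> M\<^sup>2 * s" using M s by (intro mult_right_mono) auto
  moreover have "r * s \<le> r * r" using s r by (intro mult_left_mono) auto
  \<comment> \<open>The constant \<open>29 / 2\<close> is \<open>7 + 15 / 2\<close>: the loss in the
    bound on the square of \<open>M\<close> and the terms bounded in \<open>low\<close>. The assumed
    gap of 16 exceeds it.\<close>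
  ultimately have "2 * (r * r) * s - 29 / 2 * (r * r) \<le> M\<^sup>2 * s - M * (2 * M + r + t)"
    using low by (simp add: algebra_simps power2_eq_square)
  then have "(1 - e) * (2 * (r * r) * s - 29 / 2 * (r * r)) \<le> (1 - e) * (M\<^sup>2 * s - M * (2 * M + r + t))"
    using e by (intro mult_left_mono) auto
  moreover have "(1 - e) * (2 * (r * r) * s - 29 / 2 * (r * r))
      = r * r * s + r * r * ((1 - 2 * e) * s - 29 / 2 * (1 - e))"
    by (simp add: algebra_simps)
  moreover have "0 \<le> r * r * ((1 - 2 * e) * s - 29 / 2 * (1 - e))"
    using gap e by (intro mult_nonneg_nonneg rr) (simp add: s_def)
  moreover have "(r - 1) * r * s \<le> r * r * s" using s r by (intro mult_right_mono) auto
  ultimately have main: "(r - 1) * r * s \<le> (1 - e) * (M\<^sup>2 * s - M * (2 * M + r + t))" by linarith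
  \<comment> \<open>Multiplying the target by \<open>r - 1\<close> makes
    \<open>e * (r * (r - 1))\<close> appear, which \<open>max\<close> replaces by
    \<open>(1 - e) * (t * (t + 1))\<close>. The factor \<open>t * (1 - e)\<close> then comes out of
    both terms, and \<open>main\<close> bounds the rest.\<close>
  have "(r + M) * M * (e * (r * (r - 1))) < (r + M) * M * ((1 - e) * (t * (t + 1)))"
    using max M r by (intro mult_strict_left_mono mult_pos_pos) auto
  then have "(1 - e) * ((M + t) * M * t) * (r - 1) - (r + M) * M * ((1 - e) * (t * (t + 1)))
      < (r - 1) * X"
    by (simp add: X_def algebra_simps)
  moreover have "(1 - e) * ((M + t) * M * t) * (r - 1) - (r + M) * M * ((1 - e) * (t * (t + 1)))
      = t * ((1 - e) * (M\<^sup>2 * s - M * (2 * M + r + t)))"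
    by (simp add: s_def algebra_simps power2_eq_square)
  moreover have "t * ((r - 1) * r * s) \<le> t * ((1 - e) * (M\<^sup>2 * s - M * (2 * M + r + t)))"
    using t by (intro mult_left_mono main) auto
  ultimately have "(r - 1) * (s * r * t) < (r - 1) * X" by (simp add: mult_ac)
  then show ?thesis using r by (simp add: X_def s_def mult_less_cancel_left_pos)
qed

section \<open>The gap between decision and certification in block-multilinear degree\<close>

lemma bm_witness_two_weights:
  fixes r t M :: nat
  assumes \<epsilon>: "0 \<le> \<epsilon>" "\<epsilon> < 1 / 2" and t: "1 \<le> t" "t < r" and r: "16 \<le> r"
    and le: "(1 - \<epsilon>) * (real t * (real t - 1)) \<le> \<epsilon> * (real r * (real r - 1))"
    and M: "real M * (M + 1) \<le> 2 * real r * (real r - 1)" "6 * real r \<le> 5 * M" "2 * real M \<le> 3 * r"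
  shows "\<exists>P. bm_witness \<epsilon> (r + M) (two_weights (r + M) (r - t) r) 2 P \<and> P \<noteq> 0"
proof -
  let ?n = "r + M"
  \<comment> \<open>The axis lies midway between \<open>r - 1\<close> and \<open>r\<close>: for
    \<open>\<epsilon> = 0\<close> the choice is \<open>t = 1\<close>, and both of these weights need
    value exactly 1. It also keeps every integer weight at distance at least \<open>1 / 2\<close>,
    as \<open>bilinear_bound\<close> requires.\<close>
  define \<rho> where "\<rho> = real r - 1 / 2"
  define m where "m = real M + 1 / 2"
  define g where "g = \<rho> * m / (\<rho> + m) + 1 / 4"
  \<comment> \<open>Normalized so that the value at weight 0 is exactly
    \<open>\<epsilon>\<close>.\<close>
  define \<alpha> where "\<alpha> = (1 - \<epsilon>) / (real r * (real r - 1))"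
  \<comment> \<open>The largest value of product plus distance term for which the form stays at or
    above -1.\<close>
  define E where "E = 2 / \<alpha> + 1 / 4"
  define P where "P = weight_form ?n \<rho> \<alpha> (\<alpha> * g)"
  have R: "0 < real r * (real r - 1)" using r by simp
  have \<alpha>: "0 < \<alpha>" using \<epsilon> R by (simp add: \<alpha>_def)
  have \<alpha>R: "\<alpha> * (real r * (real r - 1)) = 1 - \<epsilon>"
    unfolding \<alpha>_def by (rule nonzero_eq_divide_eq[THEN iffD1, OF _ refl]) (use R in linarith)
  have "2 * (real r * (real r - 1)) \<le> 2 / \<alpha>"
  proof -
    have "\<alpha> * (real r * (real r - 1)) \<le> 1" using \<alpha>R \<epsilon> by simp
    then show ?thesis using \<alpha> by (simp add: field_simps)
  qed
  then have E0: "2 * (real r * real r) - 2 * real r + 1 / 4 \<le> E" by (simp add: E_def algebra_simps)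
  have \<rho>: "0 < \<rho>" "\<rho> \<le> m" "6 * \<rho> \<le> 5 * m" using r M by (simp_all add: \<rho>_def m_def)
  have rr: "16 * real r \<le> real r * real r" using r by (intro mult_right_mono) auto
  have m2: "m\<^sup>2 \<le> 2 * (real r * real r) - 2 * real r + 1 / 4"
    using M(1) by (simp add: m_def power2_eq_square algebra_simps)
  have E1: "m\<^sup>2 \<le> E" using m2 E0 by linarith
  have E2: "2 * g * m \<le> E"
  proof -
    \<comment> \<open>This is where \<open>M\<close> has to exceed \<open>6 / 5\<close> times
      \<open>r\<close>: the main term of \<open>2 * g * m\<close> becomes \<open>10 / 11\<close> of
      the square of \<open>m\<close>, which leaves room for \<open>m / 2\<close>.\<close>
    have "\<rho> / (\<rho> + m) \<le> 5 / 11" using \<rho> by (simp add: field_simps)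
    then have "2 * m\<^sup>2 * (\<rho> / (\<rho> + m)) \<le> 2 * m\<^sup>2 * (5 / 11)" by (intro mult_left_mono) auto
    moreover have "2 * g * m = 2 * m\<^sup>2 * (\<rho> / (\<rho> + m)) + m / 2"
      by (simp add: g_def power2_eq_square field_simps)
    moreover have "m \<le> 3 / 2 * real r + 1 / 2" using M(3) by (simp add: m_def)
    ultimately show ?thesis using m2 E0 rr r by linarith
  qed
  have E3: "\<rho> * m + (\<rho> + m) / 4 \<le> E"
  proof -
    have m_le: "m \<le> 3 / 2 * real r + 1 / 2" using M(3) by (simp add: m_def)
    then have "\<rho> * m \<le> \<rho> * (3 / 2 * real r + 1 / 2)" using \<rho>(1) by (intro mult_left_mono) auto
    also have "\<dots> = 3 / 2 * (real r * real r) - 1 / 4 * real r - 1 / 4"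
      by (simp add: \<rho>_def field_simps)
    finally have "\<rho> * m \<le> 3 / 2 * (real r * real r) - 1 / 4 * real r - 1 / 4" .
    moreover have "(\<rho> + m) / 4 \<le> 5 / 8 * real r" using m_le by (simp add: \<rho>_def)
    moreover have "16 \<le> real r" using r by simp
    ultimately show ?thesis using E0 rr by linarith
  qed
  have bounded: "\<bar>peval P z\<bar> \<le> 1" if z: "\<forall>v \<in> {..<2} \<times> {..?n}. z v \<in> {-1, 1}" for z
  proof -
    define U where "U k = {i. i < ?n \<and> z (k, Suc i) = z (k, 0)}" for k
    have signs: "z (k, i) = -1 \<or> z (k, i) = 1" if "k < 2" "i \<le> ?n" for k i using z that by auto
    have U: "U k \<subseteq> {..<?n}" for k by (auto simp: U_def)
    have fin: "finite (U k)" for k by (rule finite_subset[OF U]) simp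
    let ?a = "real (card (U 0))" and ?b = "real (card (U 1))" and ?w = "real (card (U 0 \<inter> U 1))"
    let ?x = "?a - \<rho>" and ?y = "?b - \<rho>" and ?h = "?a + ?b - 2 * ?w"
    have agree: "z (k, Suc i) = z (k, 0) * (2 * of_bool (i \<in> U k) - 1)" if "k < 2" "i < ?n" for k i
      using signs[of k 0] signs[of k "Suc i"] that by (auto simp: U_def)
    have "peval P z = z (0, 0) * z (1, 0) * (1 + \<alpha> / 4 - \<alpha> * ?x * ?y - \<alpha> * g * ?h)"
      unfolding P_def
      by (rule peval_weight_form_signs[where s = "\<lambda>k. z (k, 0)" and U = U]) (use agree U in auto)
    also have "\<dots> = z (0, 0) * z (1, 0) * (1 - \<alpha> * (?x * ?y - 1 / 4 + g * ?h))"
      by (simp add: algebra_simps)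
    finally have val: "peval P z = z (0, 0) * z (1, 0) * (1 - \<alpha> * (?x * ?y - 1 / 4 + g * ?h))" .
    have half: "1 / 2 \<le> \<bar>real (card (U k)) - \<rho>\<bar>" for k
    proof -
      have "card (U k) \<le> r - 1 \<or> r \<le> card (U k)" by linarith
      then have "real (card (U k)) \<le> real r - 1 \<or> real r \<le> real (card (U k))" using r by auto
      then show ?thesis unfolding \<rho>_def by linarith
    qed
    have card_U: "card (U k) \<le> ?n" for k using card_mono[OF _ U] by simp
    have w: "?w \<le> ?a" "?w \<le> ?b" using fin by (auto intro: card_mono)
    \<comment> \<open>Both upper bounds on the Hamming distance, by the total length and by the
      number of positions outside the two sets, come from the size of the union.\<close>
    have "card (U 0 \<union> U 1) \<le> card {..<?n}" using U by (intro card_mono) auto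
    then have un: "?a + ?b - ?w \<le> real r + M"
      using card_Un_Int[OF fin fin, of 0 1] by simp
    have "0 \<le> ?x * ?y - 1 / 4 + g * ?h" "?x * ?y + g * ?h \<le> E"
      by (rule bilinear_bound[where \<rho> = \<rho> and m = m];
          use half card_U[of 0] card_U[of 1] w un \<rho> E1 E2 E3 in \<open>simp add: g_def \<rho>_def m_def\<close>)+
    then have "0 \<le> \<alpha> * (?x * ?y - 1 / 4 + g * ?h)" "\<alpha> * (?x * ?y - 1 / 4 + g * ?h) \<le> \<alpha> * (E - 1 / 4)"
      using \<alpha> by (auto intro: mult_left_mono)
    moreover have "\<alpha> * (E - 1 / 4) = 2" using \<alpha> by (simp add: E_def)
    ultimately have "\<bar>1 - \<alpha> * (?x * ?y - 1 / 4 + g * ?h)\<bar> \<le> 1" by linarith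
    moreover have "\<bar>z (0, 0) * z (1, 0)\<bar> = 1" using signs[of 0 0] signs[of 1 0] by auto
    ultimately show ?thesis unfolding val abs_mult[of "z (0, 0) * z (1, 0)"] by simp
  qed
  have val: "peval P (blocks_point x) = 1 - \<alpha> * ((real k - r) * (real k - r + 1))"
    if x: "x \<in> weight_inputs ?n k" for x k
  proof -
    obtain T where T: "T \<subseteq> {..<?n}" "card T = k" "x = map (\<lambda>i. i \<in> T) [0..<?n]"
      using x by (auto simp: weight_inputs_def)
    have "peval P (blocks_point x) = 1 * 1 * (1 + \<alpha> / 4 - \<alpha> * (real (card T) - \<rho>) * (real (card T) - \<rho>)
        - \<alpha> * g * (real (card T) + real (card T) - 2 * real (card (T \<inter> T))))"
      unfolding P_def
      by (rule peval_weight_form_signs[where s = "\<lambda>_. 1" and U = "\<lambda>_. T"])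
        (use T in \<open>auto simp: blocks_point_def point_def simp del: upt_Suc\<close>)
    then show ?thesis using T(2) by (simp add: \<rho>_def algebra_simps)
  qed
  have val_0: "peval P (blocks_point x) = \<epsilon>" if "x \<in> weight_inputs ?n 0" for x
    using val[OF that] \<alpha>R by (simp add: algebra_simps)
  have val_r: "peval P (blocks_point x) = 1" if "x \<in> weight_inputs ?n r" for x
    using val[OF that] by simp
  have val_p: "1 - \<epsilon> \<le> peval P (blocks_point x) \<and> peval P (blocks_point x) \<le> 1"
    if "x \<in> weight_inputs ?n (r - t)" for x
  proof -
    have "peval P (blocks_point x) = 1 - \<alpha> * (real t * (real t - 1))"
      using val[OF that] t by (simp add: of_nat_diff algebra_simps)
    moreover have "0 \<le> \<alpha> * (real t * (real t - 1))" using \<alpha> t by simp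
    moreover have "\<alpha> * (real t * (real t - 1)) \<le> \<epsilon>"
      using le R by (simp add: \<alpha>_def field_simps)
    ultimately show ?thesis by linarith
  qed
  let ?f = "two_weights ?n (r - t) r"
  have disj: "weight_inputs ?n 0 \<inter> (weight_inputs ?n (r - t) \<union> weight_inputs ?n r) = {}"
    using weight_inputs_disjoint[of 0 "r - t" ?n] weight_inputs_disjoint[of 0 r ?n] t by auto
  have "0 \<le> peval P (blocks_point x) \<and> peval P (blocks_point x) \<le> 1 \<and>
      \<bar>peval P (blocks_point x) - bvalue ?f x\<bar> \<le> \<epsilon>" if x: "x \<in> dom ?f" for x
  proof (cases "x \<in> weight_inputs ?n 0")
    case True
    then have "bvalue ?f x = 0" by (simp add: bvalue_def two_weights_def)
    then show ?thesis using val_0[OF True] \<epsilon> by simp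
  next
    case False
    then have x': "x \<in> weight_inputs ?n (r - t) \<union> weight_inputs ?n r" using x dom_two_weights by blast
    then have "bvalue ?f x = 1" using False by (simp add: bvalue_def two_weights_def)
    moreover have "1 - \<epsilon> \<le> peval P (blocks_point x) \<and> peval P (blocks_point x) \<le> 1"
      using x' val_p val_r \<epsilon> by auto
    ultimately show ?thesis using \<epsilon> by auto
  qed
  then have "bm_witness \<epsilon> ?n ?f 2 P"
    unfolding bm_witness_def using bounded block_multilinear_weight_form by (simp add: P_def)
  moreover have "P \<noteq> 0"
  proof
    assume "P = 0"
    obtain x where "x \<in> weight_inputs ?n r" using weight_inputs_nonempty[of r ?n] by auto
    from val_r[OF this] show False by (simp add: \<open>P = 0\<close>)
  qed
  ultimately show ?thesis by blast
qed

text \<open>The explicit quadratic gives the decision problem degree at most 2, while extrapolation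
  excludes witnesses with at most two blocks for certifying the all-False input.\<close>

lemma not_easier_bm_degree:
  assumes \<epsilon>: "0 \<le> \<epsilon>" "\<epsilon> < 1 / 2"
  shows "\<not> certification_easier (bm_degree \<epsilon>)"
proof
  assume easier: "certification_easier (bm_degree \<epsilon>)"
  obtain r t where t: "1 \<le> t" "t < r" and r: "16 \<le> r" and gap: "16 \<le> (1 - 2 * \<epsilon>) * (real r - t)"
    and le: "(1 - \<epsilon>) * (real t * (real t - 1)) \<le> \<epsilon> * (real r * (real r - 1))"
    and max: "\<epsilon> * (real r * (real r - 1)) < (1 - \<epsilon>) * (real t * (real t + 1))"
    by (rule exists_separating_weight[OF \<epsilon>])
  obtain M :: nat where M: "real M * (M + 1) \<le> 2 * real r * (real r - 1)" "6 * real r \<le> 5 * M"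
    "2 * real M \<le> 3 * r" "2 * (real r)\<^sup>2 - 7 * r \<le> (real M)\<^sup>2"
    by (rule exists_root_two_multiple[OF r])
  define n where "n = r + M"
  have M0: "0 < M" using M(2) r by linarith
  let ?f = "two_weights n (r - t) r"
  let ?z = "replicate n False"
  let ?g = "cert_fun ?f ?z"
  have f: "boolean_function n ?f" by (rule boolean_function_two_weights)
  have z: "?z \<in> dom ?f" by (simp add: dom_two_weights weight_inputs_0)
  have g: "boolean_function n ?g" by (rule boolean_function_cert_fun[OF f z])
  obtain P where "bm_witness \<epsilon> n ?f 2 P" "P \<noteq> 0"
    using bm_witness_two_weights[OF \<epsilon> t r le M(1-3)] unfolding n_def by blast
  then have "bm_degree \<epsilon> n ?f \<le> real 2" by (rule bm_degree_le)
  moreover have "bm_degree \<epsilon> n ?g \<le> bm_degree \<epsilon> n ?f"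
    using easier f z unfolding certification_easier_iff by blast
  ultimately have le2: "bm_degree \<epsilon> n ?g \<le> 2" by simp
  \<comment> \<open>A witness of some degree has to be exhibited before the \<open>LEAST\<close>
    defining the degree of \<open>?g\<close> can be known to be attained.\<close>
  have "?g x = Some (x = ?z)" if "x \<in> dom ?g" for x
    using that by (auto simp: cert_fun_def split: if_splits)
  moreover have "?z \<in> dom ?g" by (simp add: domIff)
  ultimately obtain P1 where "bm_witness \<epsilon> n ?g n P1" "P1 \<noteq> 0"
    using exists_bm_witness_all_False[OF \<epsilon>(1) g] by blast
  then obtain P' d where d: "bm_degree \<epsilon> n ?g = real d" "bm_witness \<epsilon> n ?g d P'"
    by (rule bm_degree_attained)
  have p: "real (r - t) = real r - t" using t by (simp add: of_nat_diff)
  show False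
  proof (rule no_small_bm_witness[OF _ _ _ _ _ d(2)])
    show "0 < r - t" "r - t < r" "r < n" using t M0 by (simp_all add: n_def)
    show "d \<le> 2" using le2 d(1) by simp
    \<comment> \<open>With \<open>p = r - t\<close> and \<open>n = r + M\<close> the differences are
      \<open>n - p = M + t\<close>, \<open>n - r = M\<close> and \<open>r - p = t\<close>, which
      turns this into \<open>separation_inequality\<close>.\<close>
    show "real (r - t) * r * (real r - real (r - t)) < (1 - \<epsilon>) * ((real n - real (r - t)) * (real n - r)
        * (real r - real (r - t))) - \<epsilon> * (real n * (real n - r) * r)"
      using separation_inequality[of \<epsilon> "real t" "real r" "real M"] \<epsilon> t r gap max M(3,4) M0
      by (simp add: p n_def algebra_simps)
  qed
qed

section \<open>Classification of the listed measures\<close>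

definition good_measure :: "complexity_measure \<Rightarrow> bool" where
  "good_measure K \<longleftrightarrow> certification_easier K \<and> certification_idempotent K \<and> sandwich K"

lemma good_measure_iff_easier: "good_measure K \<longleftrightarrow> certification_easier K"
  using certification_easier_imp_idempotent certification_idempotent_imp_sandwich
  by (auto simp: good_measure_def)

lemma easier_listed_measures:
  assumes "K \<in> listed_measures"
    and "K \<notin> {C_side True, FC_side True, UC_side True, ndeg_meas}
        \<union> {bm_degree \<epsilon> | \<epsilon>. 0 \<le> \<epsilon> \<and> \<epsilon> < 1 / 2}"
  shows "certification_easier K"
proof -
  note stable = stable_D_query stable_R_query stable_R0_query stable_Q_query stable_Q0_query
    stable_QE_query stable_C_meas stable_UC_meas stable_EC_meas stable_sqrt_CG stable_CG_meas
    stable_MM_meas stable_CAdv_meas stable_FC_meas stable_RS_meas stable_s_meas stable_lambda_meas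
    stable_bs_meas stable_fbs_meas stable_cfbs_meas stable_rdeg_meas
  have deg: "stable_measure deg_meas" "stable_measure adeg_meas"
    unfolding deg_meas_def adeg_meas_def by (rule stable_approx_degree, simp)+
  consider
      "K \<in> {D_query, R_query, R0_query, Q_query, Q0_query, QE_query,
        C_side False, C_side True, C_meas, UC_side False, UC_side True, UC_meas,
        EC_meas, sqrt_CG, CG_meas, MM_meas, CAdv_meas, FC_side False, FC_side True, FC_meas,
        RS_meas, s_meas, lambda_meas, bs_meas, fbs_meas, cfbs_meas,
        deg_meas, adeg_meas, ndeg_meas, rdeg_meas}"
    | \<epsilon> where "K = Prt \<epsilon>" "0 \<le> \<epsilon>" | \<epsilon> where "K = prt_eps \<epsilon>" "0 \<le> \<epsilon>"
    | \<epsilon> where "K = bm_degree \<epsilon>" "0 \<le> \<epsilon>"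
    using assms(1) unfolding listed_measures_def by blast
  then show ?thesis
  proof cases
    case 1
    then have "K \<in> {C_side False, UC_side False, FC_side False} \<or> stable_measure K"
      using assms(2) stable deg by blast
    then show ?thesis
      using stable_measure_imp_easier certification_easier_C_side_False
        certification_easier_UC_side_False certification_easier_FC_side_False by blast
  next
    case 2
    then show ?thesis using stable_Prt stable_measure_imp_easier by blast
  next
    case 3
    then show ?thesis using stable_prt_eps stable_measure_imp_easier by blast
  next
    case 4
    then have "1 / 2 \<le> \<epsilon>" using assms(2) by fastforce
    then show ?thesis unfolding 4(1) by (rule certification_easier_bm_degree)
  qed
qed

theorem theorem13:
  fixes M N :: complexity_measure and n :: nat and f :: bfun
  assumes "boolean_function n f"
  shows "((\<forall>m g. boolean_function m g \<longrightarrow> M m g \<le> N m g) \<longrightarrow> cert M n f \<le> cert N n f)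
    \<and> (stable_measure M \<longrightarrow>
        cert M n f \<le> M n f
        \<and> cert (cert M) n f = cert M n f
        \<and> ((\<forall>m g. boolean_function m g \<longrightarrow> cert M m g \<le> N m g \<and> N m g \<le> M m g)
             \<longrightarrow> cert M n f = cert N n f))
    \<and> (\<forall>K \<in> {C_side False, FC_side False}.
        \<not> stable_measure K \<and> collapses K
        \<and> certification_easier K \<and> certification_idempotent K \<and> sandwich K)
    \<and> {K \<in> listed_measures.
         \<not> (certification_easier K \<and> certification_idempotent K \<and> sandwich K)}
      = {C_side True, FC_side True, UC_side True, ndeg_meas}
        \<union> {bm_degree \<epsilon> | \<epsilon>. 0 \<le> \<epsilon> \<and> \<epsilon> < 1 / 2}"
proof (intro conjI)
  show "(\<forall>m g. boolean_function m g \<longrightarrow> M m g \<le> N m g) \<longrightarrow> cert M n f \<le> cert N n f"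
    using cert_mono[OF assms] by blast
  have "good_measure M" if "stable_measure M"
    unfolding good_measure_iff_easier by (rule stable_measure_imp_easier[OF that])
  then show "stable_measure M \<longrightarrow> cert M n f \<le> M n f \<and> cert (cert M) n f = cert M n f
    \<and> ((\<forall>m g. boolean_function m g \<longrightarrow> cert M m g \<le> N m g \<and> N m g \<le> M m g)
         \<longrightarrow> cert M n f = cert N n f)"
    using assms unfolding good_measure_def certification_easier_def certification_idempotent_def
      sandwich_def by blast
  have "\<not> stable_measure (C_side False)" "\<not> stable_measure (FC_side False)"
    by (rule not_stable_side; simp add: not_easier_C_side_True not_easier_FC_side_True)+
  then show "\<forall>K \<in> {C_side False, FC_side False}. \<not> stable_measure K \<and> collapses K
      \<and> certification_easier K \<and> certification_idempotent K \<and> sandwich K"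
    using collapses_C_side_False collapses_FC_side_False certification_easier_C_side_False
      certification_easier_FC_side_False
    unfolding good_measure_def[symmetric] good_measure_iff_easier by blast
  have "C_side True \<in> listed_measures" "FC_side True \<in> listed_measures"
    "UC_side True \<in> listed_measures" "ndeg_meas \<in> listed_measures"
    "\<And>\<epsilon>. 0 \<le> \<epsilon> \<Longrightarrow> bm_degree \<epsilon> \<in> listed_measures"
    unfolding listed_measures_def by blast+
  then show "{K \<in> listed_measures.
         \<not> (certification_easier K \<and> certification_idempotent K \<and> sandwich K)}
      = {C_side True, FC_side True, UC_side True, ndeg_meas}
        \<union> {bm_degree \<epsilon> | \<epsilon>. 0 \<le> \<epsilon> \<and> \<epsilon> < 1 / 2}"
    unfolding good_measure_def[symmetric] good_measure_iff_easier
    using easier_listed_measures not_easier_C_side_True not_easier_FC_side_True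
      not_easier_UC_side_True not_easier_ndeg_meas not_easier_bm_degree by blast
qed

end
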